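(* Let $\mathscr G$ be an ample groupoid, $K$ a commutative ring with unit, and fix $D\subseteq\mathscr G^0$ containing exactly one element from each orbit. Then there is a bijection between isomorphism classes of spectral simple $K\mathscr G$-modules and pairs $(x,V)$ where $x\in D$ and $V$ is a simple $KG_x$-module (taken up to isomorphism). The simple $K\mathscr G$-module corresponding to $(x,V)$ is $\mathrm{Ind}_x(V)$. When $K$ is a field, the finite dimensional simple $K\mathscr G$-modules correspond to those pairs $(x,V)$ where $x$ is of finite index and $V$ is a finite dimensional simple $KG_x$-module.
   Context: A groupoid is a small category with all arrows invertible; objects are identified with units, $\mathscr G^0$ is the unit space, $d(g)=g^{-1}g$, $r(g)=gg^{-1}$, and $gh$ is defined iff $d(g)=r(h)$. "Compact" includes Hausdorff. An étale groupoid is a topological groupoid, locally compact (not necessarily Hausdorff), with $\mathscr G^0$ locally compact Hausdorff and $d\colon\mathscr G\to\mathscr G^0$ a local homeomorphism. A slice is an open $U\subseteq\mathscr G$ with $d|_U$, $r|_U$ injective. $\mathscr G$ is ample if it is étale and the compact slices form a basis of its topology. $\chi_U$ is the characteristic function of $U$. Give $K$ the discrete topology. $K\mathscr G$ is the $K$-module of functions $\mathscr G\to K$ spanned by those $f$ for which there is an open Hausdorff subspace $V$ such that $f$ vanishes outside $V$ and $f|_V$ is continuous with compact support, with convolution product $f\ast g(x)=\sum_{y\in d^{-1}(d(x))}f(xy^{-1})g(y)$. All modules $M$ over a $K$-algebra $A$ are non-degenerate, i.e. $AM=M$ (this includes simple modules). The orbit of $x\in\mathscr G^0$ is $\{r(g)\mid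 d(g)=x\}$; $x$ has finite index if its orbit is finite. $G_x=\{g\mid d(g)=x=r(g)\}$ is the isotropy group. $L_x=d^{-1}(x)$, on which $G_x$ acts on the right by multiplication; $KL_x$ is the free $K$-module on $L_x$, a $K\mathscr G$-$KG_x$-bimodule with left action $f\cdot t=\sum_{y\in L_x}f(yt^{-1})y$ for $f\in K\mathscr G$, $t\in L_x$. For a $KG_x$-module $V$, $\mathrm{Ind}_x(V)=KL_x\otimes_{KG_x}V$. For a $K\mathscr G$-module $V$, $\mathrm{Res}_x(V)=\bigcap_U\chi_UV$, over all compact open $U\subseteq\mathscr G^0$ with $x\in U$. A non-zero $K\mathscr G$-module $V$ is spectral if $\mathrm{Res}_x(V)\ne0$ for some $x\in\mathscr G^0$. *)

theory Defs
  imports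
    "HOL-Analysis.Abstract_Topological_Spaces"
    "HOL-Algebra.Module"
    "HOL-Algebra.AbelCoset"
begin

section \<open>Modules over a commutative ring\<close>

text \<open>
  The sort \<open>{comm_ring, comm_monoid_mult}\<close> describes the commutative rings with unit;
  \<open>comm_ring_1\<close> would in addition exclude the zero ring. The following record makes the
  locales of HOL-Algebra available for such a type of scalars.
\<close>

definition scalars :: "'k::{comm_ring,comm_monoid_mult} ring" where
  "scalars = \<lparr>carrier = UNIV, mult = (*), one = 1, zero = 0, add = (+)\<rparr>"

definition mspan ::
  "('k::{comm_ring,comm_monoid_mult}, 'm, 'z) module_scheme \<Rightarrow> 'm set \<Rightarrow> 'm set" where
  "mspan M S = \<Inter> {N. submodule N (scalars :: 'k ring) M \<and> S \<subseteq> N}"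

definition finite_dimensional ::
  "('k::{comm_ring,comm_monoid_mult}, 'm, 'z) module_scheme \<Rightarrow> bool" where
  "finite_dimensional M \<longleftrightarrow>
     (\<exists>B. finite B \<and> B \<subseteq> carrier M \<and> mspan M B = carrier M \<and>
        (\<forall>c :: 'm \<Rightarrow> 'k. (\<Oplus>\<^bsub>M\<^esub>b\<in>B. c b \<odot>\<^bsub>M\<^esub> b) = \<zero>\<^bsub>M\<^esub> \<longrightarrow> (\<forall>b\<in>B. c b = 0)))"

text \<open>
  The \<open>module\<close> record of HOL-Algebra also carries a multiplication and a unit. They are
  irrelevant for modules and left unspecified; for algebras the multiplication is used, and the
  unit is left unspecified when the algebra need not have one.
\<close>

definition fun_module :: "'s set \<Rightarrow> ('k::{comm_ring,comm_monoid_mult}, 's \<Rightarrow> 'k) module" where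
  "fun_module S =
     \<lparr>carrier = {u. \<forall>s. s \<notin> S \<longrightarrow> u s = 0}, mult = undefined, one = undefined,
      zero = (\<lambda>s. 0), add = (\<lambda>u v s. u s + v s), smult = (\<lambda>c u s. c * u s)\<rparr>"

definition free_module :: "'s set \<Rightarrow> ('k::{comm_ring,comm_monoid_mult}, 's \<Rightarrow> 'k) module" where
  "free_module S =
     (fun_module S)\<lparr>carrier := {u. finite {s. u s \<noteq> 0} \<and> (\<forall>s. s \<notin> S \<longrightarrow> u s = 0)}\<rparr>"

definition delta :: "'s \<Rightarrow> 's \<Rightarrow> 'k::{comm_ring,comm_monoid_mult}" where
  "delta s = (\<lambda>t. if t = s then 1 else 0)"

text \<open>The linear extension to free modules of a map \<open>\<phi>\<close> between the bases.\<close>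

definition free_map ::
  "('s \<Rightarrow> 't) \<Rightarrow> ('s \<Rightarrow> 'k::{comm_ring,comm_monoid_mult}) \<Rightarrow> 't \<Rightarrow> 'k" where
  "free_map \<phi> w = (\<lambda>t. \<Sum>s | w s \<noteq> 0 \<and> \<phi> s = t. w s)"

definition quotient_module ::
  "('k::{comm_ring,comm_monoid_mult}, 'm, 'z) module_scheme \<Rightarrow> 'm set \<Rightarrow> ('k, 'm set) module" where
  "quotient_module M N =
     \<lparr>carrier = a_rcosets\<^bsub>M\<^esub> N, mult = undefined, one = undefined, zero = N,
      add = (<+>\<^bsub>M\<^esub>), smult = (\<lambda>c X. \<Union>w\<in>X. N +>\<^bsub>M\<^esub> (c \<odot>\<^bsub>M\<^esub> w))\<rparr>"


section \<open>Modules over an algebra\<close>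

record ('k, 'a, 'm) alg_module = "('k, 'm) module" +
  act :: "'a \<Rightarrow> 'm \<Rightarrow> 'm"

text \<open>
  Non-degenerate left modules over a \<open>K\<close>-algebra which need not be unital. \<open>AM\<close> is the span of
  the products \<open>am\<close>.
\<close>

locale alg_mod =
  Module.module "scalars :: 'k ring" M
  for A :: "('k::{comm_ring,comm_monoid_mult}, 'a, 'z) module_scheme" and M :: "('k, 'a, 'm) alg_module" +
  assumes act_closed: "\<lbrakk>a \<in> carrier A; m \<in> carrier M\<rbrakk> \<Longrightarrow> act M a m \<in> carrier M"
    and act_add_left: "\<lbrakk>a \<in> carrier A; b \<in> carrier A; m \<in> carrier M\<rbrakk>
          \<Longrightarrow> act M (a \<oplus>\<^bsub>A\<^esub> b) m = act M a m \<oplus>\<^bsub>M\<^esub> act M b m"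
    and act_add_right: "\<lbrakk>a \<in> carrier A; m \<in> carrier M; n \<in> carrier M\<rbrakk>
          \<Longrightarrow> act M a (m \<oplus>\<^bsub>M\<^esub> n) = act M a m \<oplus>\<^bsub>M\<^esub> act M a n"
    and act_smult_left: "\<lbrakk>a \<in> carrier A; m \<in> carrier M\<rbrakk>
          \<Longrightarrow> act M (c \<odot>\<^bsub>A\<^esub> a) m = c \<odot>\<^bsub>M\<^esub> act M a m"
    and act_smult_right: "\<lbrakk>a \<in> carrier A; m \<in> carrier M\<rbrakk>
          \<Longrightarrow> act M a (c \<odot>\<^bsub>M\<^esub> m) = c \<odot>\<^bsub>M\<^esub> act M a m"
    and act_mult: "\<lbrakk>a \<in> carrier A; b \<in> carrier A; m \<in> carrier M\<rbrakk>
          \<Longrightarrow> act M (a \<otimes>\<^bsub>A\<^esub> b) m = act M a (act M b m)"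
    and nondegenerate:
      "mspan M {act M a m | a m. a \<in> carrier A \<and> m \<in> carrier M} = carrier M"

definition alg_submodule ::
  "('k::{comm_ring,comm_monoid_mult}, 'a, 'z) module_scheme \<Rightarrow>
     ('k, 'a, 'm) alg_module \<Rightarrow> 'm set \<Rightarrow> bool" where
  "alg_submodule A M N \<longleftrightarrow>
     submodule N (scalars :: 'k ring) M \<and> (\<forall>a\<in>carrier A. \<forall>n\<in>N. act M a n \<in> N)"

definition simple_module ::
  "('k::{comm_ring,comm_monoid_mult}, 'a, 'z) module_scheme \<Rightarrow>
     ('k, 'a, 'm) alg_module \<Rightarrow> bool" where
  "simple_module A M \<longleftrightarrow>
     alg_mod A M \<and> carrier M \<noteq> {\<zero>\<^bsub>M\<^esub>} \<and>
     (\<forall>N. alg_submodule A M N \<longrightarrow> N = {\<zero>\<^bsub>M\<^esub>} \<or> N = carrier M)"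

definition alg_module_iso ::
  "('k::{comm_ring,comm_monoid_mult}, 'a, 'z) module_scheme \<Rightarrow>
     ('k, 'a, 'm) alg_module \<Rightarrow> ('k, 'a, 'n) alg_module \<Rightarrow> bool" where
  "alg_module_iso A M N \<longleftrightarrow>
     (\<exists>h. bij_betw h (carrier M) (carrier N) \<and>
        (\<forall>m\<in>carrier M. \<forall>n\<in>carrier M. h (m \<oplus>\<^bsub>M\<^esub> n) = h m \<oplus>\<^bsub>N\<^esub> h n) \<and>
        (\<forall>c. \<forall>m\<in>carrier M. h (c \<odot>\<^bsub>M\<^esub> m) = c \<odot>\<^bsub>N\<^esub> h m) \<and>
        (\<forall>a\<in>carrier A. \<forall>m\<in>carrier M. h (act M a m) = act N a (h m)))"

text \<open>
  \<open>M\<close> may live on a type different from that of the members of its isomorphism class: the class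
  consists of the modules on the type \<open>'n\<close> which are isomorphic to \<open>M\<close>.
\<close>

definition iso_class ::
  "('k::{comm_ring,comm_monoid_mult}, 'a, 'z) module_scheme \<Rightarrow>
     ('k, 'a, 'm) alg_module \<Rightarrow> ('k, 'a, 'n) alg_module set" where
  "iso_class A M = {N. alg_mod A N \<and> alg_module_iso A M N}"

definition iso_classes ::
  "('k::{comm_ring,comm_monoid_mult}, 'a, 'z) module_scheme \<Rightarrow>
     (('k, 'a, 'm) alg_module \<Rightarrow> bool) \<Rightarrow> ('k, 'a, 'm) alg_module set set" where
  "iso_classes A P = {iso_class A M | M. alg_mod A M \<and> P M}"


section \<open>Tensor products\<close>

text \<open>
  For a right \<open>A\<close>-module \<open>P\<close> with action \<open>\<rho>\<close> and a left \<open>A\<close>-module \<open>V\<close>, the tensor product is the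
  free \<open>K\<close>-module on \<open>P \<times> V\<close> modulo the bilinearity and balancing relations.
\<close>

definition tensor_free ::
  "('k::{comm_ring,comm_monoid_mult}, 'p, 'y) module_scheme \<Rightarrow> ('k, 'm, 'w) module_scheme \<Rightarrow>
     ('k, 'p \<times> 'm \<Rightarrow> 'k) module" where
  "tensor_free P V = free_module (carrier P \<times> carrier V)"

definition tensor_relations ::
  "('k::{comm_ring,comm_monoid_mult}, 'a, 'z) module_scheme \<Rightarrow>
     ('k, 'p, 'y) module_scheme \<Rightarrow> ('p \<Rightarrow> 'a \<Rightarrow> 'p) \<Rightarrow> ('k, 'a, 'm) alg_module \<Rightarrow>
     ('p \<times> 'm \<Rightarrow> 'k) set" where
  "tensor_relations A P \<rho> V = (let F = tensor_free P V in
     {delta (p \<oplus>\<^bsub>P\<^esub> q, v) \<ominus>\<^bsub>F\<^esub> (delta (p, v) \<oplus>\<^bsub>F\<^esub> delta (q, v)) | p q v.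
        p \<in> carrier P \<and> q \<in> carrier P \<and> v \<in> carrier V} \<union>
     {delta (p, v \<oplus>\<^bsub>V\<^esub> w) \<ominus>\<^bsub>F\<^esub> (delta (p, v) \<oplus>\<^bsub>F\<^esub> delta (p, w)) | p v w.
        p \<in> carrier P \<and> v \<in> carrier V \<and> w \<in> carrier V} \<union>
     {delta (c \<odot>\<^bsub>P\<^esub> p, v) \<ominus>\<^bsub>F\<^esub> (c \<odot>\<^bsub>F\<^esub> delta (p, v)) | c p v.
        p \<in> carrier P \<and> v \<in> carrier V} \<union>
     {delta (p, c \<odot>\<^bsub>V\<^esub> v) \<ominus>\<^bsub>F\<^esub> (c \<odot>\<^bsub>F\<^esub> delta (p, v)) | c p v.
        p \<in> carrier P \<and> v \<in> carrier V} \<union>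
     {delta (\<rho> p a, v) \<ominus>\<^bsub>F\<^esub> delta (p, act V a v) | p a v.
        p \<in> carrier P \<and> a \<in> carrier A \<and> v \<in> carrier V})"

definition tensor_kernel ::
  "('k::{comm_ring,comm_monoid_mult}, 'a, 'z) module_scheme \<Rightarrow>
     ('k, 'p, 'y) module_scheme \<Rightarrow> ('p \<Rightarrow> 'a \<Rightarrow> 'p) \<Rightarrow> ('k, 'a, 'm) alg_module \<Rightarrow>
     ('p \<times> 'm \<Rightarrow> 'k) set" where
  "tensor_kernel A P \<rho> V = mspan (tensor_free P V) (tensor_relations A P \<rho> V)"

definition tensor ::
  "('k::{comm_ring,comm_monoid_mult}, 'a, 'z) module_scheme \<Rightarrow>
     ('k, 'p, 'y) module_scheme \<Rightarrow> ('p \<Rightarrow> 'a \<Rightarrow> 'p) \<Rightarrow> ('k, 'a, 'm) alg_module \<Rightarrow>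
     ('k, ('p \<times> 'm \<Rightarrow> 'k) set) module" where
  "tensor A P \<rho> V = quotient_module (tensor_free P V) (tensor_kernel A P \<rho> V)"

text \<open>
  The action \<open>f (p \<otimes> v) = (f p) \<otimes> v\<close> on \<open>tensor A P \<rho> V\<close> induced by a left action \<open>l\<close> on \<open>P\<close>.
\<close>

definition tensor_act ::
  "('k::{comm_ring,comm_monoid_mult}, 'a, 'z) module_scheme \<Rightarrow>
     ('k, 'p, 'y) module_scheme \<Rightarrow> ('p \<Rightarrow> 'a \<Rightarrow> 'p) \<Rightarrow> ('k, 'a, 'm) alg_module \<Rightarrow>
     ('b \<Rightarrow> 'p \<Rightarrow> 'p) \<Rightarrow> 'b \<Rightarrow> ('p \<times> 'm \<Rightarrow> 'k) set \<Rightarrow> ('p \<times> 'm \<Rightarrow> 'k) set" where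
  "tensor_act A P \<rho> V l f X =
     (\<Union>w\<in>X. tensor_kernel A P \<rho> V +>\<^bsub>tensor_free P V\<^esub> free_map (\<lambda>(p, v). (l f p, v)) w)"


section \<open>Topological groupoids\<close>

text \<open>The set of arrows is \<open>topspace (gtop G)\<close>; \<open>gmul G g h\<close> is meaningful iff \<open>d g = r h\<close>.\<close>

record 'g top_groupoid =
  gtop :: "'g topology"
  gmul :: "'g \<Rightarrow> 'g \<Rightarrow> 'g"
  ginv :: "'g \<Rightarrow> 'g"

abbreviation arrows :: "'g top_groupoid \<Rightarrow> 'g set" where
  "arrows G \<equiv> topspace (gtop G)"

definition gdom :: "'g top_groupoid \<Rightarrow> 'g \<Rightarrow> 'g" where
  "gdom G g = gmul G (ginv G g) g"

definition gran :: "'g top_groupoid \<Rightarrow> 'g \<Rightarrow> 'g" where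
  "gran G g = gmul G g (ginv G g)"

definition units :: "'g top_groupoid \<Rightarrow> 'g set" where
  "units G = gdom G ` arrows G"

locale groupoid =
  fixes G :: "'g top_groupoid"
  assumes inv_closed: "g \<in> arrows G \<Longrightarrow> ginv G g \<in> arrows G"
    and dom_inv: "g \<in> arrows G \<Longrightarrow> gdom G (ginv G g) = gran G g"
    and ran_inv: "g \<in> arrows G \<Longrightarrow> gran G (ginv G g) = gdom G g"
    and dom_closed: "g \<in> arrows G \<Longrightarrow> gdom G g \<in> arrows G"
    and dom_dom: "g \<in> arrows G \<Longrightarrow> gdom G (gdom G g) = gdom G g"
    and ran_dom: "g \<in> arrows G \<Longrightarrow> gran G (gdom G g) = gdom G g"
    and mul_closed: "\<lbrakk>g \<in> arrows G; h \<in> arrows G; gdom G g = gran G h\<rbrakk>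
          \<Longrightarrow> gmul G g h \<in> arrows G"
    and dom_mul: "\<lbrakk>g \<in> arrows G; h \<in> arrows G; gdom G g = gran G h\<rbrakk>
          \<Longrightarrow> gdom G (gmul G g h) = gdom G h"
    and ran_mul: "\<lbrakk>g \<in> arrows G; h \<in> arrows G; gdom G g = gran G h\<rbrakk>
          \<Longrightarrow> gran G (gmul G g h) = gran G g"
    and mul_assoc: "\<lbrakk>g \<in> arrows G; h \<in> arrows G; k \<in> arrows G;
            gdom G g = gran G h; gdom G h = gran G k\<rbrakk>
          \<Longrightarrow> gmul G (gmul G g h) k = gmul G g (gmul G h k)"
    and mul_dom: "g \<in> arrows G \<Longrightarrow> gmul G g (gdom G g) = g"
    and ran_mul_self: "g \<in> arrows G \<Longrightarrow> gmul G (gran G g) g = g"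

locale topological_groupoid = groupoid +
  assumes continuous_mul:
      "continuous_map
         (subtopology (prod_topology (gtop G) (gtop G))
            {(g, h). g \<in> arrows G \<and> h \<in> arrows G \<and> gdom G g = gran G h})
         (gtop G) (\<lambda>(g, h). gmul G g h)"
    and continuous_inv: "continuous_map (gtop G) (gtop G) (ginv G)"

abbreviation unit_top :: "'g top_groupoid \<Rightarrow> 'g topology" where
  "unit_top G \<equiv> subtopology (gtop G) (units G)"

definition local_homeomorphism :: "'a topology \<Rightarrow> 'b topology \<Rightarrow> ('a \<Rightarrow> 'b) \<Rightarrow> bool" where
  "local_homeomorphism X Y f \<longleftrightarrow>
     (\<forall>x\<in>topspace X. \<exists>U. openin X U \<and> x \<in> U \<and> openin Y (f ` U) \<and>
        homeomorphic_map (subtopology X U) (subtopology Y (f ` U)) f)"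

locale etale_groupoid = topological_groupoid +
  assumes locally_compact: "locally_compact_space (gtop G)"
    and locally_compact_units: "locally_compact_space (unit_top G)"
    and Hausdorff_units: "Hausdorff_space (unit_top G)"
    and local_homeomorphism_dom: "local_homeomorphism (gtop G) (unit_top G) (gdom G)"

definition hcompactin :: "'a topology \<Rightarrow> 'a set \<Rightarrow> bool" where
  "hcompactin X S \<longleftrightarrow> compactin X S \<and> Hausdorff_space (subtopology X S)"

definition slice :: "'g top_groupoid \<Rightarrow> 'g set \<Rightarrow> bool" where
  "slice G U \<longleftrightarrow> openin (gtop G) U \<and> inj_on (gdom G) U \<and> inj_on (gran G) U"

locale ample_groupoid = etale_groupoid +
  assumes compact_slice_basis:
    "\<lbrakk>openin (gtop G) W; g \<in> W\<rbrakk>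
       \<Longrightarrow> \<exists>U. slice G U \<and> hcompactin (gtop G) U \<and> g \<in> U \<and> U \<subseteq> W"

definition orbit :: "'g top_groupoid \<Rightarrow> 'g \<Rightarrow> 'g set" where
  "orbit G x = {gran G g | g. g \<in> arrows G \<and> gdom G g = x}"

definition isotropy :: "'g top_groupoid \<Rightarrow> 'g \<Rightarrow> 'g set" where
  "isotropy G x = {g \<in> arrows G. gdom G g = x \<and> gran G g = x}"

definition L_fibre :: "'g top_groupoid \<Rightarrow> 'g \<Rightarrow> 'g set" where
  "L_fibre G x = {g \<in> arrows G. gdom G g = x}"


section \<open>The groupoid algebra\<close>

text \<open>
  Functions on \<open>G\<close> are functions on the whole type which vanish off \<open>arrows G\<close>. The support is the
  closure, taken in \<open>V\<close>, of the set where \<open>f\<close> does not vanish.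
\<close>

definition alg_generators ::
  "'g top_groupoid \<Rightarrow> ('g \<Rightarrow> 'k::{comm_ring,comm_monoid_mult}) set" where
  "alg_generators G =
     {f. \<exists>V. openin (gtop G) V \<and> Hausdorff_space (subtopology (gtop G) V) \<and>
        (\<forall>g. g \<notin> V \<longrightarrow> f g = 0) \<and>
        continuous_map (subtopology (gtop G) V) (discrete_topology UNIV) f \<and>
        hcompactin (subtopology (gtop G) V)
          (subtopology (gtop G) V closure_of {g \<in> V. f g \<noteq> 0})}"

text \<open>
  For \<open>g\<close> in the groupoid algebra, only finitely many \<open>y\<close> in each fibre of \<open>d\<close> satisfy
  \<open>g y \<noteq> 0\<close>, so that this is the sum over the whole fibre.
\<close>

definition convolution ::
  "'g top_groupoid \<Rightarrow> ('g \<Rightarrow> 'k::{comm_ring,comm_monoid_mult}) \<Rightarrow> ('g \<Rightarrow> 'k) \<Rightarrow> 'g \<Rightarrow> 'k" where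
  "convolution G f g = (\<lambda>x. if x \<in> arrows G
     then \<Sum>y | y \<in> L_fibre G (gdom G x) \<and> g y \<noteq> 0. f (gmul G x (ginv G y)) * g y else 0)"

definition groupoid_algebra ::
  "'g top_groupoid \<Rightarrow> ('k::{comm_ring,comm_monoid_mult}, 'g \<Rightarrow> 'k) module" where
  "groupoid_algebra G =
     (fun_module (arrows G))
       \<lparr>carrier := mspan (fun_module (arrows G)) (alg_generators G), mult := convolution G\<rparr>"

definition char_fun :: "'g set \<Rightarrow> 'g \<Rightarrow> 'k::{comm_ring,comm_monoid_mult}" where
  "char_fun U = (\<lambda>g. if g \<in> U then 1 else 0)"

text \<open>
  The bilinear extension of the multiplication to finitely supported functions; it is used only
  for \<open>u\<close> supported in \<open>L_fibre G x\<close> (or \<open>isotropy G x\<close>) and \<open>a\<close> in \<open>isotropy G x\<close>, where all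
  the products are defined.
\<close>

definition bilinear_mul ::
  "'g top_groupoid \<Rightarrow> ('g \<Rightarrow> 'k::{comm_ring,comm_monoid_mult}) \<Rightarrow> ('g \<Rightarrow> 'k) \<Rightarrow> 'g \<Rightarrow> 'k" where
  "bilinear_mul G u a =
     (\<lambda>z. \<Sum>(s, t)\<in>{(s, t). u s \<noteq> 0 \<and> a t \<noteq> 0 \<and> gmul G s t = z}. u s * a t)"

definition isotropy_algebra ::
  "'g top_groupoid \<Rightarrow> 'g \<Rightarrow> ('k::{comm_ring,comm_monoid_mult}, 'g \<Rightarrow> 'k) module" where
  "isotropy_algebra G x =
     (free_module (isotropy G x))\<lparr>mult := bilinear_mul G, one := delta x\<rparr>"

text \<open>The linear extension in \<open>t\<close> of \<open>f \<cdot> t = (\<Sum>y\<in>L_fibre G x. f (y t\<inverse>) y)\<close>.\<close>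

definition L_act ::
  "'g top_groupoid \<Rightarrow> 'g \<Rightarrow> ('g \<Rightarrow> 'k::{comm_ring,comm_monoid_mult}) \<Rightarrow> ('g \<Rightarrow> 'k) \<Rightarrow> 'g \<Rightarrow> 'k" where
  "L_act G x f u = (\<lambda>y. if y \<in> L_fibre G x
     then \<Sum>t | u t \<noteq> 0. f (gmul G y (ginv G t)) * u t else 0)"


section \<open>Induction, restriction and spectral modules\<close>

definition Ind ::
  "'g top_groupoid \<Rightarrow> 'g \<Rightarrow> ('k::{comm_ring,comm_monoid_mult}, 'g \<Rightarrow> 'k, 'm) alg_module \<Rightarrow>
     ('k, 'g \<Rightarrow> 'k, (('g \<Rightarrow> 'k) \<times> 'm \<Rightarrow> 'k) set) alg_module" where
  "Ind G x V =
     module.extend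
       (tensor (isotropy_algebra G x) (free_module (L_fibre G x)) (bilinear_mul G) V)
       (alg_module.fields
          (tensor_act (isotropy_algebra G x) (free_module (L_fibre G x)) (bilinear_mul G) V
             (L_act G x)))"

definition Res ::
  "'g top_groupoid \<Rightarrow> 'g \<Rightarrow> ('k::{comm_ring,comm_monoid_mult}, 'g \<Rightarrow> 'k, 'm) alg_module \<Rightarrow>
     'm set" where
  "Res G x V = {v \<in> carrier V. \<forall>U. U \<subseteq> units G \<and> openin (unit_top G) U \<and>
     hcompactin (unit_top G) U \<and> x \<in> U \<longrightarrow> v \<in> act V (char_fun U) ` carrier V}"

definition spectral ::
  "'g top_groupoid \<Rightarrow> ('k::{comm_ring,comm_monoid_mult}, 'g \<Rightarrow> 'k, 'm) alg_module \<Rightarrow> bool" where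
  "spectral G V \<longleftrightarrow>
     carrier V \<noteq> {\<zero>\<^bsub>V\<^esub>} \<and> (\<exists>x\<in>units G. Res G x V \<noteq> {\<zero>\<^bsub>V\<^esub>})"

definition orbit_transversal :: "'g top_groupoid \<Rightarrow> 'g set \<Rightarrow> bool" where
  "orbit_transversal G D \<longleftrightarrow> D \<subseteq> units G \<and> (\<forall>x\<in>units G. \<exists>!y. y \<in> D \<and> y \<in> orbit G x)"

text \<open>
  The class of all modules is not a set; isomorphism classes are formed among the modules carried
  by subsets of the following type, with \<open>'u\<close> arbitrary. Simple modules over the groupoid algebra
  and over the isotropy group algebras are cyclic, so the first summand makes the type large
  enough to contain a copy of each of them, while the second allows any given module (on a type
  \<open>'u\<close>) to be among the modules considered.
\<close>

type_synonym ('g, 'k, 'u) universe = "('g \<Rightarrow> 'k) + 'u"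

text \<open>
  The map sending \<open>(x, [V])\<close> to the isomorphism class of \<open>Ind\<^sub>x(V)\<close>. The union is over isomorphic
  modules \<open>V\<close>, hence over equal sets.
\<close>

definition Ind_class ::
  "'g top_groupoid \<Rightarrow>
     'g \<times> ('k::{comm_ring,comm_monoid_mult}, 'g \<Rightarrow> 'k, 'm) alg_module set \<Rightarrow>
     ('k, 'g \<Rightarrow> 'k, 'n) alg_module set" where
  "Ind_class G = (\<lambda>(x, C). \<Union>V\<in>C. iso_class (groupoid_algebra G) (Ind G x V))"

end

theory Submission
  imports Defs
begin

text \<open>
  The groupoid algebra is spanned by the characteristic functions of compact slices, and these
  multiply like the slices themselves. Hence \<open>Ind\<^sub>x(V)\<close> is generated by elements \<open>t \<otimes> v\<close> on which
  a compact slice either acts through its unique arrow composable with \<open>t\<close> or acts as zero, and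
  \<open>v \<mapsto> x \<otimes> v\<close> is injective. These properties alone determine it: for every element \<open>m\<close> and every
  \<open>t\<close> in the fibre, all sufficiently small slices around \<open>t\<inverse>\<close> send \<open>m\<close> to one and the same \<open>x \<otimes> v\<close>,
  and an element all of whose germs at units vanish is zero because a compact local unit of it
  splits into finitely many disjoint pieces annihilating it. It follows that any two modules
  generated by \<open>V\<close> in this way are isomorphic, that the restriction at \<open>x\<close> is \<open>x \<otimes> V\<close>, that
  simplicity passes from \<open>V\<close> to \<open>Ind\<^sub>x(V)\<close>, and that restrictions away from the orbit of \<open>x\<close> vanish.
  Conversely, a simple module \<open>M\<close> whose restriction at \<open>x\<close> is non-zero is generated by this
  restriction in the same way, and for \<open>N\<close> inside the restriction the same germs show that the
  submodule generated by \<open>N\<close> restricts to \<open>N\<close>; so the restriction is simple.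
\<close>


section \<open>Modules over the scalars\<close>

text \<open>Unless \<open>{x}\<close> is open, evaluation at a unit \<open>x\<close> is not an
  element of the algebra, so nothing in the algebra projects a module onto its part at
  \<open>x\<close>. Statements at a point are therefore made as statements about germs: they hold
  for all compact slices inside some open neighbourhood. Open rather than compact neighbourhoods are
  intersected, because in a groupoid that is not Hausdorff two compact slices may meet in a set that
  is not compact. Disjoint decompositions are made only in the unit space or in a Hausdorff open
  set.

  The tensor product and a given simple module live on different types and arise in unrelated ways.
  An axiomatic description with the maps \<open>\<tau> t\<close> as data covers both, so
  restriction, simplicity and dimension are treated once. Uniqueness of the described module makes
  the map on classes well defined and onto; recovering \<open>V\<close> as a restriction makes it
  one-to-one.

  The scalars form a field only where dimension enters: subspaces of finitely generated spaces are
  then finitely generated, and minimal generating sets are independent.\<close>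

lemma scalars_simps [simp]:
  "carrier scalars = UNIV"
  "a \<oplus>\<^bsub>scalars\<^esub> b = a + b"
  "a \<otimes>\<^bsub>scalars\<^esub> b = a * b"
  "\<zero>\<^bsub>scalars\<^esub> = 0"
  "\<one>\<^bsub>scalars\<^esub> = 1"
  by (simp_all add: scalars_def)

lemma cring_scalars: "cring (scalars :: 'k::{comm_ring,comm_monoid_mult} ring)"
proof (rule cringI)
  show "abelian_group (scalars :: 'k ring)"
  proof (rule abelian_groupI)
    fix x :: 'k
    show "\<exists>y\<in>carrier scalars. y \<oplus>\<^bsub>scalars\<^esub> x = \<zero>\<^bsub>scalars\<^esub>"
      by (auto intro: exI[of _ "- x"])
  qed (auto simp: add_ac)
  show "comm_monoid (scalars :: 'k ring)"
    by (rule comm_monoidI) (auto simp: mult_ac)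
qed (auto simp: distrib_right)

lemma a_minus_scalars [simp]: "\<ominus>\<^bsub>scalars\<^esub> a = - (a :: 'k::{comm_ring,comm_monoid_mult})"
proof -
  interpret cring "scalars :: 'k ring" by (rule cring_scalars)
  show ?thesis
    using minus_equality[of "- a" a] by simp
qed

section \<open>Submodules and spans over the scalars\<close>

locale kmodule = Module.module "scalars :: 'k ring" M
  for M :: "('k::{comm_ring,comm_monoid_mult}, 'm, 'z) module_scheme" (structure)
begin

lemma smult_in [simp, intro]: "m \<in> carrier M \<Longrightarrow> c \<odot> m \<in> carrier M"
  by (rule smult_closed) simp_all

lemma smult_distribs:
  "m \<in> carrier M \<Longrightarrow> (a + b) \<odot> m = a \<odot> m \<oplus> b \<odot> m"
  "\<lbrakk>m \<in> carrier M; n \<in> carrier M\<rbrakk> \<Longrightarrow> a \<odot> (m \<oplus> n) = a \<odot> m \<oplus> a \<odot> n"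
  "m \<in> carrier M \<Longrightarrow> (a * b) \<odot> m = a \<odot> (b \<odot> m)"
  using smult_l_distr[of a b m] smult_r_distr[of a m n] smult_assoc1[of a b m] by simp_all

lemma smult_simps [simp]:
  "m \<in> carrier M \<Longrightarrow> 1 \<odot> m = m"
  "m \<in> carrier M \<Longrightarrow> 0 \<odot> m = \<zero>"
  "c \<odot> \<zero> = \<zero>"
  using smult_one[of m] smult_l_null[of m] smult_r_null[of c] by simp_all

lemma smult_minus_one: "m \<in> carrier M \<Longrightarrow> (- 1) \<odot> m = \<ominus> m"
  using smult_l_minus[of 1 m] by simp

lemma diff_eq_zero_iff:
  assumes "m \<in> carrier M" "n \<in> carrier M"
  shows "m \<ominus> n = \<zero> \<longleftrightarrow> m = n"
proof
  assume "m \<ominus> n = \<zero>"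
  then have "\<ominus> (\<ominus> n) = m" using assms by (intro M.minus_equality) (auto simp: a_minus_def)
  then show "m = n" using assms by simp
qed (use assms in \<open>simp add: a_minus_def M.r_neg\<close>)

lemma submodule_scalarsI:
  assumes "H \<subseteq> carrier M" "\<zero> \<in> H" "\<And>a b. \<lbrakk>a \<in> H; b \<in> H\<rbrakk> \<Longrightarrow> a \<oplus> b \<in> H"
    "\<And>c a. a \<in> H \<Longrightarrow> c \<odot> a \<in> H"
  shows "submodule H (scalars :: 'k ring) M"
proof (rule submoduleI)
  fix a assume "a \<in> H"
  then show "\<ominus> a \<in> H"
    using assms(1) assms(4)[of a "- 1"] by (auto simp: smult_minus_one)
qed (use assms in auto)

lemma submodule_scalarsE:
  assumes "submodule H (scalars :: 'k ring) M"
  shows "H \<subseteq> carrier M" "\<zero> \<in> H" "\<And>a b. \<lbrakk>a \<in> H; b \<in> H\<rbrakk> \<Longrightarrow> a \<oplus> b \<in> H"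
    "\<And>c a. a \<in> H \<Longrightarrow> c \<odot> a \<in> H" "\<And>a b. \<lbrakk>a \<in> H; b \<in> H\<rbrakk> \<Longrightarrow> a \<ominus> b \<in> H"
proof -
  note E = submoduleE[OF assms]
  show 1: "H \<subseteq> carrier M" and 3: "\<And>a b. \<lbrakk>a \<in> H; b \<in> H\<rbrakk> \<Longrightarrow> a \<oplus> b \<in> H"
    and 4: "\<And>c a. a \<in> H \<Longrightarrow> c \<odot> a \<in> H"
    using E by auto
  obtain a where "a \<in> H" using E(2) by auto
  then show "\<zero> \<in> H" using 1 4[of a 0] by auto
  show "\<And>a b. \<lbrakk>a \<in> H; b \<in> H\<rbrakk> \<Longrightarrow> a \<ominus> b \<in> H"
    using 3 E(3) by (simp add: a_minus_def)
qed

lemma mspan_subset_carrier: "S \<subseteq> carrier M \<Longrightarrow> mspan M S \<subseteq> carrier M"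
  unfolding mspan_def using carrier_is_submodule by blast

lemma mspan_superset: "S \<subseteq> mspan M S"
  unfolding mspan_def by blast

lemma mspan_minimal: "\<lbrakk>submodule H (scalars :: 'k ring) M; S \<subseteq> H\<rbrakk> \<Longrightarrow> mspan M S \<subseteq> H"
  unfolding mspan_def by blast

lemma mspan_submodule:
  assumes "S \<subseteq> carrier M"
  shows "submodule (mspan M S) (scalars :: 'k ring) M"
proof (rule submodule_scalarsI)
  show "mspan M S \<subseteq> carrier M" using assms by (rule mspan_subset_carrier)
qed (auto simp: mspan_def dest: submodule_scalarsE)

lemma mspan_mono:
  assumes "S \<subseteq> mspan M T" "T \<subseteq> carrier M"
  shows "mspan M S \<subseteq> mspan M T"
  using mspan_minimal[OF mspan_submodule] assms by blast

lemma mspan_induct [consumes 2, case_names zero base add smult]: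
  assumes "m \<in> mspan M S" "S \<subseteq> carrier M"
    and "P \<zero>" "\<And>s. s \<in> S \<Longrightarrow> P s"
    and "\<And>m n. \<lbrakk>m \<in> carrier M; n \<in> carrier M; m \<in> mspan M S; n \<in> mspan M S; P m; P n\<rbrakk> \<Longrightarrow> P (m \<oplus> n)"
    and "\<And>c m. \<lbrakk>m \<in> carrier M; m \<in> mspan M S; P m\<rbrakk> \<Longrightarrow> P (c \<odot> m)"
  shows "P m"
proof -
  note E = submodule_scalarsE[OF mspan_submodule[OF assms(2)]]
  have "submodule {m \<in> mspan M S. P m} (scalars :: 'k ring) M"
    by (rule submodule_scalarsI) (use E assms(2-) in \<open>auto simp: subset_iff\<close>)
  then have "mspan M S \<subseteq> {m \<in> mspan M S. P m}"
    by (rule mspan_minimal) (use mspan_superset[of S] assms(4) in auto)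
  then show ?thesis using assms(1) by blast
qed

lemma finsum_in_submodule:
  assumes "submodule H (scalars :: 'k ring) M" "finite B" "\<And>b. b \<in> B \<Longrightarrow> f b \<in> H"
  shows "(\<Oplus>b\<in>B. f b) \<in> H"
  using assms(2,3)
proof (induction B rule: finite_induct)
  case empty
  then show ?case using submodule_scalarsE[OF assms(1)] by simp
next
  case (insert b B)
  then show ?case using submodule_scalarsE[OF assms(1)]
    by (subst finsum_insert) auto
qed

end

sublocale alg_mod \<subseteq> kmodule M ..

lemma kmodule_subset:
  assumes "kmodule M" "submodule H (scalars :: 'k::{comm_ring,comm_monoid_mult} ring) M"
  shows "kmodule (M\<lparr>carrier := H\<rparr>)"
  using submodule.submodule_is_module[OF assms(2)] assms(1) unfolding kmodule_def by blast

section \<open>Linear maps: images and preimages of submodules and spans\<close>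

definition linear_map where
  "linear_map (M :: ('k::{comm_ring,comm_monoid_mult}, 'm, 'z) module_scheme) (N :: ('k, 'n, 'y) module_scheme) h \<longleftrightarrow>
     (\<forall>m\<in>carrier M. h m \<in> carrier N) \<and>
     (\<forall>m\<in>carrier M. \<forall>n\<in>carrier M. h (m \<oplus>\<^bsub>M\<^esub> n) = h m \<oplus>\<^bsub>N\<^esub> h n) \<and>
     (\<forall>c. \<forall>m\<in>carrier M. h (c \<odot>\<^bsub>M\<^esub> m) = c \<odot>\<^bsub>N\<^esub> h m)"

lemma linear_mapD:
  assumes "linear_map M N h"
  shows "m \<in> carrier M \<Longrightarrow> h m \<in> carrier N"
    "\<lbrakk>m \<in> carrier M; n \<in> carrier M\<rbrakk> \<Longrightarrow> h (m \<oplus>\<^bsub>M\<^esub> n) = h m \<oplus>\<^bsub>N\<^esub> h n"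
    "m \<in> carrier M \<Longrightarrow> h (c \<odot>\<^bsub>M\<^esub> m) = c \<odot>\<^bsub>N\<^esub> h m"
  using assms unfolding linear_map_def by auto

lemma linear_map_zero:
  assumes "linear_map M N h" "kmodule M" "kmodule N"
  shows "h \<zero>\<^bsub>M\<^esub> = \<zero>\<^bsub>N\<^esub>"
proof -
  interpret M: kmodule M by fact
  interpret N: kmodule N by fact
  have "h (0 \<odot>\<^bsub>M\<^esub> \<zero>\<^bsub>M\<^esub>) = 0 \<odot>\<^bsub>N\<^esub> h \<zero>\<^bsub>M\<^esub>" 
    using linear_mapD[OF assms(1)] by blast
  then show ?thesis using linear_mapD(1)[OF assms(1), of "\<zero>\<^bsub>M\<^esub>"] by simp
qed

lemma submodule_vimage:
  assumes "linear_map M N h" "kmodule M" "kmodule N" "submodule H (scalars :: 'k::{comm_ring,comm_monoid_mult} ring) N"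
  shows "submodule {m \<in> carrier M. h m \<in> H} (scalars :: 'k ring) M"
proof -
  interpret M: kmodule M by fact
  interpret N: kmodule N by fact
  note E = N.submodule_scalarsE[OF assms(4)]
  show ?thesis
    by (rule M.submodule_scalarsI)
      (use linear_map_zero[OF assms(1-3)] linear_mapD[OF assms(1)] E in auto)
qed

lemma submodule_image:
  assumes "linear_map M N h" "kmodule M" "kmodule N" "submodule H (scalars :: 'k::{comm_ring,comm_monoid_mult} ring) M"
  shows "submodule (h ` H) (scalars :: 'k ring) N"
proof -
  interpret M: kmodule M by fact
  interpret N: kmodule N by fact
  note E = M.submodule_scalarsE[OF assms(4)]
  note h = linear_mapD[OF assms(1)] linear_map_zero[OF assms(1-3)]
  show ?thesis
  proof (rule N.submodule_scalarsI)
    show "h ` H \<subseteq> carrier N" using E h by auto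
    show "\<zero>\<^bsub>N\<^esub> \<in> h ` H" using E h by (metis image_eqI)
    fix a b c assume "a \<in> h ` H"
    then obtain a' where a: "a' \<in> H" "a = h a'" by auto
    show "c \<odot>\<^bsub>N\<^esub> a \<in> h ` H"
      using a E h by (intro image_eqI[of _ _ "c \<odot>\<^bsub>M\<^esub> a'"]) auto
    assume "b \<in> h ` H"
    then obtain b' where b: "b' \<in> H" "b = h b'" by auto
    show "a \<oplus>\<^bsub>N\<^esub> b \<in> h ` H"
      using a b E h by (intro image_eqI[of _ _ "a' \<oplus>\<^bsub>M\<^esub> b'"]) (auto simp: subset_iff)
  qed
qed

text \<open>Minimality of spans is used twice: the preimage of the span of the images is a submodule
  containing \<open>S\<close>, and the image of the span of \<open>S\<close> is a submodule
  containing the images.\<close>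

lemma image_mspan:
  assumes "linear_map M N h" "kmodule M" "kmodule N" "S \<subseteq> carrier M"
  shows "h ` mspan M S = mspan N (h ` S)"
proof -
  interpret M: kmodule M by fact
  interpret N: kmodule N by fact
  have S: "h ` S \<subseteq> carrier N" using assms(4) linear_mapD(1)[OF assms(1)] by auto
  have "mspan M S \<subseteq> {m \<in> carrier M. h m \<in> mspan N (h ` S)}"
    by (rule M.mspan_minimal[OF submodule_vimage[OF assms(1-3) N.mspan_submodule[OF S]]])
      (use assms(4) N.mspan_superset[of "h ` S"] in auto)
  moreover have "mspan N (h ` S) \<subseteq> h ` mspan M S"
    by (rule N.mspan_minimal[OF submodule_image[OF assms(1-3) M.mspan_submodule[OF assms(4)]]])
      (use M.mspan_superset[of S] in auto)
  ultimately show ?thesis by auto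
qed

subsection \<open>Function modules and free modules\<close>

lemma fun_module_simps [simp]:
  "carrier (fun_module S) = {u. \<forall>s. s \<notin> S \<longrightarrow> u s = 0}"
  "\<zero>\<^bsub>fun_module S\<^esub> = (\<lambda>s. 0)"
  "u \<oplus>\<^bsub>fun_module S\<^esub> v = (\<lambda>s. u s + v s)"
  "c \<odot>\<^bsub>fun_module S\<^esub> u = (\<lambda>s. c * u s)"
  by (simp_all add: fun_module_def)

lemma free_module_simps [simp]:
  "carrier (free_module S) = {u. finite {s. u s \<noteq> 0} \<and> (\<forall>s. s \<notin> S \<longrightarrow> u s = 0)}"
  "\<zero>\<^bsub>free_module S\<^esub> = (\<lambda>s. 0)"
  "u \<oplus>\<^bsub>free_module S\<^esub> v = (\<lambda>s. u s + v s)"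
  "c \<odot>\<^bsub>free_module S\<^esub> u = (\<lambda>s. c * u s)"
  by (simp_all add: free_module_def)

lemma kmodule_fun_module: "kmodule (fun_module S :: ('k::{comm_ring,comm_monoid_mult}, 's \<Rightarrow> 'k) module)"
  unfolding kmodule_def
proof (rule moduleI)
  show "abelian_group (fun_module S :: ('k, 's \<Rightarrow> 'k) module)"
  proof (rule abelian_groupI)
    fix u :: "'s \<Rightarrow> 'k" assume "u \<in> carrier (fun_module S)"
    then show "\<exists>v\<in>carrier (fun_module S). v \<oplus>\<^bsub>fun_module S\<^esub> u = \<zero>\<^bsub>fun_module S\<^esub>"
      by (intro bexI[of _ "\<lambda>s. - u s"]) auto
  qed (auto simp: add_ac)
qed (auto simp: cring_scalars distrib_left distrib_right mult_ac)

lemma free_module_eq: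
  "free_module S = (fun_module S)\<lparr>carrier := {u. finite {s. u s \<noteq> 0} \<and> (\<forall>s. s \<notin> S \<longrightarrow> u s = 0)}\<rparr>"
  by (simp add: free_module_def)

lemma finite_support_add:
  fixes u v :: "'s \<Rightarrow> 'k::comm_monoid_add"
  assumes "finite {s. u s \<noteq> 0}" "finite {s. v s \<noteq> 0}"
  shows "finite {s. u s + v s \<noteq> 0}"
  by (rule finite_subset[OF _ finite_UnI[OF assms]]) auto

lemma finite_support_mult:
  fixes u :: "'s \<Rightarrow> 'k::{comm_ring}"
  assumes "finite {s. u s \<noteq> 0}"
  shows "finite {s. c * u s \<noteq> 0}"
  by (rule finite_subset[OF _ assms]) auto

lemma kmodule_free_module: "kmodule (free_module S :: ('k::{comm_ring,comm_monoid_mult}, 's \<Rightarrow> 'k) module)"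
proof -
  interpret kmodule "fun_module S :: ('k::{comm_ring,comm_monoid_mult}, 's \<Rightarrow> 'k) module"
    by (rule kmodule_fun_module)
  show ?thesis unfolding free_module_eq
    by (intro kmodule_subset kmodule_fun_module submodule_scalarsI)
      (auto intro: finite_support_add finite_support_mult)
qed

lemma finite_support_delta [simp]: "finite {t. delta s t \<noteq> (0::'k::{comm_ring,comm_monoid_mult})}"
  by (rule finite_subset[of _ "{s}"]) (auto simp: delta_def)

lemma delta_in_free_module [simp]: "s \<in> S \<Longrightarrow> delta s \<in> carrier (free_module S)"
  by (auto simp: delta_def)

lemma free_module_spanned:
  "carrier (free_module S) = mspan (free_module S :: ('k::{comm_ring,comm_monoid_mult}, 's \<Rightarrow> 'k) module) (delta ` S)"
proof -
  interpret kmodule "free_module S :: ('k::{comm_ring,comm_monoid_mult}, 's \<Rightarrow> 'k) module"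
    by (rule kmodule_free_module)
  have sub: "delta ` S \<subseteq> carrier (free_module S :: ('k, 's \<Rightarrow> 'k) module)"
    by (intro image_subsetI delta_in_free_module)
  note E = submodule_scalarsE[OF mspan_submodule[OF sub]]
  have "u \<in> mspan (free_module S) (delta ` S)"
    if "finite F" "{s. u s \<noteq> 0} = F" "\<forall>s. s \<notin> S \<longrightarrow> u s = 0" for u :: "'s \<Rightarrow> 'k" and F
    using that
  proof (induction F arbitrary: u rule: finite_induct)
    case empty
    then have "u = (\<lambda>s. 0)" by auto
    then show ?case using E(2) by simp
  next
    case (insert a F)
    \<comment> \<open>Clearing the value at \<open>a\<close> removes exactly \<open>a\<close> from
      the support, so the induction hypothesis applies to \<open>v\<close>.\<close>
    define v where "v = u(a := 0)"
    have aS: "a \<in> S"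
      using insert.prems by blast
    have "v \<in> mspan (free_module S) (delta ` S)"
      using insert by (intro insert.IH) (auto simp: v_def)
    moreover have "u a \<odot>\<^bsub>free_module S\<^esub> delta a \<in> mspan (free_module S) (delta ` S)"
      using aS mspan_superset[of "delta ` S"] by (intro E(4)) auto
    ultimately have "v \<oplus>\<^bsub>free_module S\<^esub> (u a \<odot>\<^bsub>free_module S\<^esub> delta a) \<in> mspan (free_module S) (delta ` S)"
      by (rule E(3))
    moreover have "u = v \<oplus>\<^bsub>free_module S\<^esub> (u a \<odot>\<^bsub>free_module S\<^esub> delta a)"
      by (auto simp: v_def delta_def)
    ultimately show ?case by simp
  qed
  then show ?thesis using mspan_subset_carrier[OF sub] by auto
qed

text \<open>Identities that are linear in an element of a free module are reduced to basis elements
  by this rule. Associativity and compatibility of the actions below are proved in this way.\<close>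

lemma free_module_induct [consumes 1, case_names zero delta add smult]:
  fixes u :: "'s \<Rightarrow> 'k::{comm_ring,comm_monoid_mult}"
  assumes "u \<in> carrier (free_module S)"
    and "P (\<lambda>s. 0)" "\<And>s. s \<in> S \<Longrightarrow> P (delta s)"
    and "\<And>u v. \<lbrakk>u \<in> carrier (free_module S); v \<in> carrier (free_module S); P u; P v\<rbrakk> \<Longrightarrow> P (\<lambda>s. u s + v s)"
    and "\<And>c u. \<lbrakk>u \<in> carrier (free_module S); P u\<rbrakk> \<Longrightarrow> P (\<lambda>s. c * u s)"
  shows "P u"
proof -
  interpret kmodule "free_module S :: ('k::{comm_ring,comm_monoid_mult}, 's \<Rightarrow> 'k) module"
    by (rule kmodule_free_module)
  have sub: "delta ` S \<subseteq> carrier (free_module S :: ('k, 's \<Rightarrow> 'k) module)"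
    by (intro image_subsetI delta_in_free_module)
  from assms(1) have "u \<in> mspan (free_module S) (delta ` S)"
    using free_module_spanned by metis
  then show ?thesis
    using sub
  proof (induction rule: mspan_induct)
    case (add m n)
    then show ?case using assms(4)[of m n] by simp
  next
    case (smult c m)
    then show ?case using assms(5)[of m c] by simp
  qed (use assms(2,3) in auto)
qed

text \<open>The linear map out of the free module that sends \<open>delta s\<close> to
  \<open>\<phi> s\<close>. Summing over the support keeps the index set finite, at the price that
  additivity needs a common larger index set.\<close>

definition lin_comb ::
  "('k::{comm_ring,comm_monoid_mult}, 'm, 'z) module_scheme \<Rightarrow> ('s \<Rightarrow> 'm) \<Rightarrow> ('s \<Rightarrow> 'k) \<Rightarrow> 'm" where
  "lin_comb M \<phi> w = (\<Oplus>\<^bsub>M\<^esub>s\<in>{s. w s \<noteq> 0}. w s \<odot>\<^bsub>M\<^esub> \<phi> s)"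

context kmodule
begin

lemma lin_comb_superset:
  assumes "finite F" "{s. w s \<noteq> 0} \<subseteq> F" "\<And>s. s \<in> F \<Longrightarrow> \<phi> s \<in> carrier M"
  shows "lin_comb M \<phi> w = (\<Oplus>s\<in>F. w s \<odot> \<phi> s)"
  unfolding lin_comb_def
  by (rule add.finprod_mono_neutral_cong_left) (use assms in auto)

lemma linear_map_lin_comb:
  assumes "\<And>s. s \<in> S \<Longrightarrow> \<phi> s \<in> carrier M"
  shows "linear_map (free_module S) M (lin_comb M \<phi>)"
  unfolding linear_map_def
proof (intro conjI ballI allI)
  fix u :: "'a \<Rightarrow> 'k" and c assume u: "u \<in> carrier (free_module S)"
  then have fu: "finite {s. u s \<noteq> 0}" and Su: "{s. u s \<noteq> 0} \<subseteq> S" by auto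
  have \<phi>u: "\<phi> s \<in> carrier M" if "u s \<noteq> 0" for s using that Su assms by auto
  show "lin_comb M \<phi> u \<in> carrier M"
    unfolding lin_comb_def using \<phi>u by (auto intro!: finsum_closed)
  show "lin_comb M \<phi> (c \<odot>\<^bsub>free_module S\<^esub> u) = c \<odot> lin_comb M \<phi> u"
  proof -
    have "lin_comb M \<phi> (\<lambda>s. c * u s) = (\<Oplus>s\<in>{s. u s \<noteq> 0}. (c * u s) \<odot> \<phi> s)"
      using fu \<phi>u by (intro lin_comb_superset) auto
    also have "\<dots> = (\<Oplus>s\<in>{s. u s \<noteq> 0}. c \<odot> (u s \<odot> \<phi> s))"
      using \<phi>u by (intro finsum_cong') (auto simp: smult_distribs)
    also have "\<dots> = c \<odot> lin_comb M \<phi> u"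
      unfolding lin_comb_def using fu \<phi>u by (subst finsum_smult_ldistr) auto
    finally show ?thesis by simp
  qed
  fix v :: "'a \<Rightarrow> 'k" assume v: "v \<in> carrier (free_module S)"
  then have fv: "finite {s. v s \<noteq> 0}" and Sv: "{s. v s \<noteq> 0} \<subseteq> S" by auto
  define F where "F = {s. u s \<noteq> 0} \<union> {s. v s \<noteq> 0}"
  have F: "finite F" "F \<subseteq> S" using fu fv Su Sv by (auto simp: F_def)
  have \<phi>F: "\<phi> s \<in> carrier M" if "s \<in> F" for s using that F assms by auto
  have "lin_comb M \<phi> (\<lambda>s. u s + v s) = (\<Oplus>s\<in>F. (u s + v s) \<odot> \<phi> s)"
    by (rule lin_comb_superset) (use F \<phi>F in \<open>auto simp: F_def\<close>)
  also have "\<dots> = (\<Oplus>s\<in>F. u s \<odot> \<phi> s \<oplus> v s \<odot> \<phi> s)"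
    using \<phi>F by (intro finsum_cong') (auto simp: smult_distribs)
  also have "\<dots> = (\<Oplus>s\<in>F. u s \<odot> \<phi> s) \<oplus> (\<Oplus>s\<in>F. v s \<odot> \<phi> s)"
    using \<phi>F by (intro finsum_addf) auto
  also have "\<dots> = lin_comb M \<phi> u \<oplus> lin_comb M \<phi> v"
    using F \<phi>F by (intro arg_cong2[where f = "(\<oplus>)"] lin_comb_superset[symmetric]) (auto simp: F_def)
  finally show "lin_comb M \<phi> (u \<oplus>\<^bsub>free_module S\<^esub> v) = lin_comb M \<phi> u \<oplus> lin_comb M \<phi> v"
    by simp
qed

lemma lin_comb_delta:
  assumes "\<phi> s \<in> carrier M"
  shows "lin_comb M \<phi> (delta s) = \<phi> s"
proof -
  have "lin_comb M \<phi> (delta s) = (\<Oplus>t\<in>{s}. delta s t \<odot> \<phi> t)"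
    by (rule lin_comb_superset) (use assms in \<open>auto simp: delta_def\<close>)
  then show ?thesis using assms by (simp add: delta_def)
qed

end


subsection \<open>Quotient modules\<close>

locale kmodule_quotient = kmodule M for M :: "('k::{comm_ring,comm_monoid_mult}, 'm, 'z) module_scheme" (structure)
  and N +
  assumes sub: "submodule N (scalars :: 'k ring) M"
begin

sublocale abelian_subgroup N M
  by (intro abelian_subgroupI3 additive_subgroupI M.abelian_group_axioms)
    (rule submodule.axioms(1)[OF sub])

lemmas N_closed = submodule_scalarsE(2-5)[OF sub]

lemma coset_eq_iff:
  assumes "m \<in> carrier M" "n \<in> carrier M"
  shows "N +> m = N +> n \<longleftrightarrow> m \<ominus> n \<in> N"
proof
  assume "N +> m = N +> n"
  then show "m \<ominus> n \<in> N"
    using a_rcos_module[OF assms(2,1)] a_rcos_self[OF assms(1)] by (simp add: a_minus_def)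
next
  assume "m \<ominus> n \<in> N"
  then have "m \<in> N +> n"
    using a_rcos_module[OF assms(2,1)] by (simp add: a_minus_def)
  then show "N +> m = N +> n"
    using a_repr_independence'[OF _ assms(2)] by simp
qed

abbreviation Q where "Q \<equiv> quotient_module M N"

lemma quotient_carrier: "carrier Q = (\<lambda>m. N +> m) ` carrier M"
  by (auto simp: quotient_module_def A_RCOSETS_def')

lemma coset_closed [simp, intro]: "m \<in> carrier M \<Longrightarrow> N +> m \<in> carrier Q"
  by (simp add: quotient_carrier)

lemma quotient_zero: "\<zero>\<^bsub>Q\<^esub> = N +> \<zero>"
  using a_rcos_const[of \<zero>] N_closed(1) by (simp add: quotient_module_def)

lemma quotient_add:
  "\<lbrakk>m \<in> carrier M; n \<in> carrier M\<rbrakk> \<Longrightarrow> (N +> m) \<oplus>\<^bsub>Q\<^esub> (N +> n) = N +> (m \<oplus> n)"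
  using a_rcos_sum by (simp add: quotient_module_def)

text \<open>The union on the left is the form in which scalar multiplication and
  \<open>tensor_act\<close> are defined on cosets. Two members of a coset differ by an element of
  \<open>N\<close>, which \<open>h\<close> keeps in \<open>N\<close>, so all terms of the union are
  the same coset.\<close>

lemma quotient_lift:
  assumes "linear_map M M h" "\<And>n. n \<in> N \<Longrightarrow> h n \<in> N" "m \<in> carrier M"
  shows "(\<Union>w\<in>N +> m. N +> h w) = N +> h m"
proof -
  note h = linear_mapD[OF assms(1)]
  have "N +> h w = N +> h m" if w: "w \<in> N +> m" for w
  proof -
    have w_in: "w \<in> carrier M" using a_elemrcos_carrier[OF assms(3) w] .
    have wm: "w \<oplus> (- 1) \<odot> m \<in> N"
      using w w_in assms(3) a_rcos_module[of m w] by (simp add: smult_minus_one)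
    have "h w \<ominus> h m = h (w \<oplus> (- 1) \<odot> m)"
      using w_in assms(3) h by (simp add: a_minus_def smult_minus_one[of "h m", symmetric])
    then show ?thesis
      using assms(2)[OF wm] w_in assms(3) h by (simp add: coset_eq_iff)
  qed
  moreover have "m \<in> N +> m" using assms(3) by (rule a_rcos_self)
  ultimately show ?thesis by blast
qed

lemma linear_map_smult: "linear_map M M ((\<odot>) c)"
  unfolding linear_map_def
proof (intro conjI ballI allI)
  fix d m assume "m \<in> carrier M"
  then show "c \<odot> (d \<odot> m) = d \<odot> (c \<odot> m)"
    using smult_distribs(3)[of m c d] smult_distribs(3)[of m d c] by (simp add: mult.commute)
qed (simp_all add: smult_distribs)

lemma quotient_smult: "m \<in> carrier M \<Longrightarrow> c \<odot>\<^bsub>Q\<^esub> (N +> m) = N +> (c \<odot> m)"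
  using quotient_lift[OF linear_map_smult, of c m] N_closed(3)
  by (simp add: quotient_module_def)

lemma kmodule_quotient: "kmodule Q"
  unfolding kmodule_def
proof (rule moduleI)
  show "abelian_group Q"
  proof (rule abelian_groupI)
    fix X assume "X \<in> carrier Q"
    then obtain m where m: "m \<in> carrier M" "X = N +> m" by (auto simp: quotient_carrier)
    then have "(N +> (\<ominus> m)) \<oplus>\<^bsub>Q\<^esub> X = \<zero>\<^bsub>Q\<^esub>"
      by (simp add: quotient_add quotient_zero M.l_neg)
    then show "\<exists>Y\<in>carrier Q. Y \<oplus>\<^bsub>Q\<^esub> X = \<zero>\<^bsub>Q\<^esub>"
      using m by (intro bexI[of _ "N +> (\<ominus> m)"]) auto
  qed (auto simp: quotient_carrier quotient_add quotient_zero M.a_ac)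
qed (auto simp: quotient_carrier quotient_add quotient_smult smult_distribs cring_scalars)

end


subsection \<open>Finite generation\<close>

text \<open>This form of finite dimension needs no basis, so it moves along linear maps by spans
  alone; over a field the two notions agree.\<close>

definition finitely_generated ::
  "('k::{comm_ring,comm_monoid_mult}, 'm, 'z) module_scheme \<Rightarrow> bool" where
  "finitely_generated M \<longleftrightarrow> (\<exists>B. finite B \<and> B \<subseteq> carrier M \<and> mspan M B = carrier M)"

lemma scalars_inverse:
  assumes "field (scalars :: 'k::{comm_ring,comm_monoid_mult} ring)" "(c :: 'k) \<noteq> 0"
  obtains d where "d * c = 1"
proof -
  interpret field "scalars :: 'k ring" by fact
  have "c \<in> Units scalars" using assms(2) field_Units by simp
  then show ?thesis using that by (auto simp: Units_def)
qed

context kmodule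
begin

lemma mspan_insert:
  assumes "insert b B \<subseteq> carrier M" "m \<in> mspan M (insert b B)"
  obtains c n where "n \<in> mspan M B" "m = c \<odot> b \<oplus> n"
proof -
  have B: "B \<subseteq> carrier M" "b \<in> carrier M" using assms(1) by auto
  note E = submodule_scalarsE[OF mspan_submodule[OF B(1)]]
  have "\<exists>c n. n \<in> mspan M B \<and> m = c \<odot> b \<oplus> n"
    using assms(2,1)
  proof (induction rule: mspan_induct)
    case zero
    then show ?case using B E by (intro exI[of _ 0] exI[of _ "\<zero>"]) auto
  next
    case (base s)
    show ?case
    proof (cases "s = b")
      case True
      then show ?thesis using B E by (intro exI[of _ 1] exI[of _ "\<zero>"]) auto
    next
      case False
      then have "s \<in> mspan M B" using base mspan_superset[of B] by auto
      then show ?thesis using B E base by (intro exI[of _ 0] exI[of _ s]) (auto simp: subset_iff)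
    qed
  next
    case (add m n)
    then obtain c m' d n' where *: "m' \<in> mspan M B" "m = c \<odot> b \<oplus> m'" "n' \<in> mspan M B" "n = d \<odot> b \<oplus> n'"
      by auto
    moreover have "m' \<in> carrier M" "n' \<in> carrier M" using * E by auto
    ultimately show ?case using B E
      by (intro exI[of _ "c + d"] exI[of _ "m' \<oplus> n'"]) (auto simp: smult_distribs M.a_ac)
  next
    case (smult c m)
    then obtain d m' where *: "m' \<in> mspan M B" "m = d \<odot> b \<oplus> m'"
      by auto
    moreover have "m' \<in> carrier M" using * E by auto
    ultimately show ?case using B E
      by (intro exI[of _ "c * d"] exI[of _ "c \<odot> m'"]) (auto simp: smult_distribs M.a_ac)
  qed
  then show ?thesis using that by blast
qed

text \<open>Induction over \<open>B\<close>. The part of \<open>H\<close> inside the span of the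
  remaining generators has finitely many generators \<open>C\<close>. If that is not all of
  \<open>H\<close>, one further \<open>h\<close> with a non-zero coefficient at \<open>b\<close> is
  enough, as every element of \<open>H\<close> can be corrected by a multiple of
  \<open>h\<close>.\<close>

lemma submodule_finitely_spanned:
  assumes fld: "field (scalars :: 'k ring)" and "finite B" "B \<subseteq> carrier M"
    and "submodule H (scalars :: 'k ring) M" "H \<subseteq> mspan M B"
  shows "\<exists>C. finite C \<and> C \<subseteq> H \<and> mspan M C = H"
  using assms(2-)
proof (induction B arbitrary: H rule: finite_induct)
  case empty
  have "submodule {\<zero>} (scalars :: 'k ring) M" by (rule submodule_scalarsI) auto
  then have "mspan M {} \<subseteq> {\<zero>}" by (rule mspan_minimal) simp
  then have "H = mspan M {}"
    using empty submodule_scalarsE(2)[OF empty(2)] submodule_scalarsE(2)[OF mspan_submodule[of "{}"]]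
    by auto
  then show ?case by (intro exI[of _ "{}"]) auto
next
  case (insert b B)
  then have B: "B \<subseteq> carrier M" and b: "b \<in> carrier M" by auto
  note E = submodule_scalarsE[OF insert.prems(2)] and EB = submodule_scalarsE[OF mspan_submodule[OF B]]
  have sub: "submodule (H \<inter> mspan M B) (scalars :: 'k ring) M"
    by (rule submodule_scalarsI) (use E EB in auto)
  then obtain C where C: "finite C" "C \<subseteq> H \<inter> mspan M B" "mspan M C = H \<inter> mspan M B"
    using insert.IH[OF B sub] by auto
  have C_in: "C \<subseteq> carrier M" using C E by auto
  show ?case
  proof (cases "H \<subseteq> mspan M B")
    case True
    then have "mspan M C = H" using C by auto
    then show ?thesis using C by auto
  next
    case False
    then obtain h where h: "h \<in> H" "h \<notin> mspan M B" by auto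
    obtain c n where cn: "n \<in> mspan M B" "h = c \<odot> b \<oplus> n"
      using mspan_insert[OF insert.prems(1)] h insert.prems(3) by blast
    have n_in: "n \<in> carrier M" and h_in: "h \<in> carrier M" using cn h E EB by auto
    \<comment> \<open>With coefficient zero, \<open>h\<close> would equal \<open>n\<close> and lie
      in the span of \<open>B\<close>.\<close>
    have "c \<noteq> 0" using h cn n_in b by auto
    then obtain d where d: "d * c = 1" using scalars_inverse[OF fld] by blast
    have hC: "insert h C \<subseteq> carrier M" using h_in C_in by auto
    note EC = submodule_scalarsE[OF mspan_submodule[OF hC]]
    have "H \<subseteq> mspan M (insert h C)"
    proof
      fix x assume x: "x \<in> H"
      then have x_in: "x \<in> carrier M" using E by auto
      obtain a m where am: "m \<in> mspan M B" "x = a \<odot> b \<oplus> m"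
        using mspan_insert[OF insert.prems(1)] x insert.prems(3) by blast
      have m_in: "m \<in> carrier M" using am EB by auto
      \<comment> \<open>Since \<open>d\<close> inverts \<open>c\<close>, this multiple of
        \<open>h\<close> has coefficient \<open>a\<close> at \<open>b\<close>; subtracting it from
        \<open>x\<close> leaves an element of the span of \<open>B\<close>.\<close>
      have "(a * d) \<odot> h = (a * (d * c)) \<odot> b \<oplus> (a * d) \<odot> n"
        using cn n_in b by (simp add: smult_distribs)
      then have *: "x \<ominus> (a * d) \<odot> h = m \<ominus> (a * d) \<odot> n"
        using d b m_in n_in am by (simp add: a_minus_def M.minus_add M.a_ac M.r_neg2)
      have "x \<ominus> (a * d) \<odot> h \<in> H \<inter> mspan M B"
        using E(5)[OF x E(4)[OF h(1), of "a * d"]] EB(5)[OF am(1) EB(4)[OF cn(1), of "a * d"]]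
        by (simp add: *)
      then have "x \<ominus> (a * d) \<odot> h \<in> mspan M (insert h C)"
        using mspan_mono[OF _ hC, of C] mspan_superset[of "insert h C"] C by auto
      moreover have "(a * d) \<odot> h \<in> mspan M (insert h C)"
        using EC mspan_superset[of "insert h C"] by auto
      ultimately have "(x \<ominus> (a * d) \<odot> h) \<oplus> (a * d) \<odot> h \<in> mspan M (insert h C)"
        using EC by blast
      moreover have "(x \<ominus> (a * d) \<odot> h) \<oplus> (a * d) \<odot> h = x"
        using x_in h_in by (simp add: a_minus_def M.a_assoc M.l_neg)
      ultimately show "x \<in> mspan M (insert h C)" by simp
    qed
    moreover have "mspan M (insert h C) \<subseteq> H"
      using mspan_minimal[OF insert.prems(2), of "insert h C"] C h by auto
    ultimately show ?thesis using C h by (intro exI[of _ "insert h C"]) auto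
  qed
qed

lemma submodule_finitely_generated:
  assumes "field (scalars :: 'k ring)" "finitely_generated M" "submodule H (scalars :: 'k ring) M"
  obtains C where "finite C" "C \<subseteq> H" "mspan M C = H"
proof -
  obtain B where B: "finite B" "B \<subseteq> carrier M" "mspan M B = carrier M"
    using assms(2) by (auto simp: finitely_generated_def)
  then show ?thesis
    using submodule_finitely_spanned[OF assms(1) B(1,2) assms(3)] submodule_scalarsE(1)[OF assms(3)] that
    by auto
qed

text \<open>A generating set of least cardinality is independent: a relation with an invertible
  coefficient expresses one generator by the others and lets it be dropped.\<close>

lemma finite_dimensional_iff:
  assumes fld: "field (scalars :: 'k ring)"
  shows "finite_dimensional M \<longleftrightarrow> finitely_generated M"
proof
  assume "finite_dimensional M"
  then show "finitely_generated M"
    by (auto simp: finite_dimensional_def finitely_generated_def)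
next
  assume "finitely_generated M"
  then obtain B0 where B0: "finite B0 \<and> B0 \<subseteq> carrier M \<and> mspan M B0 = carrier M"
    by (auto simp: finitely_generated_def)
  let ?gen = "\<lambda>B. finite B \<and> B \<subseteq> carrier M \<and> mspan M B = carrier M"
  obtain B where "?gen B \<and> (\<forall>C. ?gen C \<longrightarrow> card B \<le> card C)"
    using ex_has_least_nat[where m = card and P = ?gen, OF B0] ..
  then have B: "finite B" "B \<subseteq> carrier M" "mspan M B = carrier M"
    and least: "\<And>C. finite C \<Longrightarrow> C \<subseteq> carrier M \<Longrightarrow> mspan M C = carrier M \<Longrightarrow> card B \<le> card C"
    by simp_all
  have indep: "c b = 0" if zero: "(\<Oplus>b\<in>B. c b \<odot> b) = \<zero>" and b: "b \<in> B" for c :: "_ \<Rightarrow> 'k" and b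
  proof (rule ccontr)
    assume "c b \<noteq> 0"
    then obtain d where d: "d * c b = 1" using scalars_inverse[OF fld] by blast
    define C where "C = B - {b}"
    have C: "C \<subseteq> carrier M" "finite C" "b \<notin> C" "B = insert b C" "b \<in> carrier M"
      using B b by (auto simp: C_def)
    note E = submodule_scalarsE[OF mspan_submodule[OF C(1)]]
    define s where "s = (\<Oplus>a\<in>C. c a \<odot> a)"
    have s: "s \<in> mspan M C"
      unfolding s_def by (rule finsum_in_submodule[OF mspan_submodule[OF C(1)] C(2)])
        (use E mspan_superset[of C] in auto)
    then have s_in: "s \<in> carrier M" using E by auto
    have "c b \<odot> b \<oplus> s = \<zero>"
      using zero C unfolding s_def C(4) by (subst (asm) finsum_insert) auto
    then have "c b \<odot> b = \<ominus> s" using C s_in by (intro M.minus_equality[symmetric]) auto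
    then have "d \<odot> (c b \<odot> b) = (- d) \<odot> s"
      using s_in smult_minus_one[OF s_in] smult_distribs(3)[OF s_in, of d "- 1"] by simp
    then have "b = (- d) \<odot> s" using d C smult_distribs(3)[of b d "c b"] by simp
    then have "b \<in> mspan M C" using E s by auto
    then have "B \<subseteq> mspan M C" using C(4) mspan_superset[of C] by auto
    then have "mspan M C = carrier M"
      using mspan_mono[OF _ C(1), of B] B(3) mspan_subset_carrier[OF C(1)] by auto
    then have "card B \<le> card C" using least C by auto
    then show False using C B(1) by auto
  qed
  then show "finite_dimensional M"
    unfolding finite_dimensional_def using B indep by (intro exI[of _ B] conjI allI impI ballI)
qed

end

section \<open>Ample groupoids\<close>

text \<open>Compactness is asked for without the Hausdorff condition: a slice maps injectively and
  continuously into the Hausdorff unit space, so it is Hausdorff anyway.\<close>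

definition compact_slice :: "'g top_groupoid \<Rightarrow> 'g set \<Rightarrow> bool" where
  "compact_slice G U \<longleftrightarrow> slice G U \<and> compactin (gtop G) U"

text \<open>Under this product the compact slices form an inverse semigroup; their characteristic
  functions span the groupoid algebra.\<close>

definition gprod :: "'g top_groupoid \<Rightarrow> 'g set \<Rightarrow> 'g set \<Rightarrow> 'g set" where
  "gprod G U V = {gmul G g h | g h. g \<in> U \<and> h \<in> V \<and> gdom G g = gran G h}"

lemma gprodI: "\<lbrakk>g \<in> U; h \<in> V; gdom G g = gran G h\<rbrakk> \<Longrightarrow> gmul G g h \<in> gprod G U V"
  by (auto simp: gprod_def)

section \<open>Calculus of arrows, units and slices\<close>

context groupoid
begin

abbreviation mul (infixl "\<cdot>" 70) where "mul \<equiv> gmul G"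

lemma inv_mul_self: "ginv G g \<cdot> g = gdom G g"
  by (simp add: gdom_def)

lemma mul_inv_self: "g \<cdot> ginv G g = gran G g"
  by (simp add: gran_def)

lemmas groupoid_simps [simp] = inv_closed dom_inv ran_inv dom_closed dom_dom ran_dom mul_closed
  dom_mul ran_mul mul_dom ran_mul_self inv_mul_self mul_inv_self

lemma ran_closed [simp]: "g \<in> arrows G \<Longrightarrow> gran G g \<in> arrows G"
  using dom_closed[of "ginv G g"] by simp

lemma dom_ran [simp]: "g \<in> arrows G \<Longrightarrow> gdom G (gran G g) = gran G g"
  using dom_dom[of "ginv G g"] by simp

lemma ran_ran [simp]: "g \<in> arrows G \<Longrightarrow> gran G (gran G g) = gran G g"
  using ran_dom[of "ginv G g"] by simp

lemma dom_in_units [simp]: "g \<in> arrows G \<Longrightarrow> gdom G g \<in> units G"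
  by (simp add: units_def)

lemma ran_in_units [simp]: "g \<in> arrows G \<Longrightarrow> gran G g \<in> units G"
  using dom_in_units[of "ginv G g"] by simp

lemma units_closed [simp]: "x \<in> units G \<Longrightarrow> x \<in> arrows G"
  by (auto simp: units_def)

lemma units_subset: "units G \<subseteq> arrows G"
  by auto

lemma arrows_Int_units [simp]: "arrows G \<inter> units G = units G"
  by auto

lemma unit_dom [simp]: "x \<in> units G \<Longrightarrow> gdom G x = x"
  by (metis units_def imageE dom_dom)

lemma unit_ran [simp]: "x \<in> units G \<Longrightarrow> gran G x = x"
  by (metis units_def imageE ran_dom)

lemma unit_mul [simp]: "\<lbrakk>x \<in> units G; g \<in> arrows G; gran G g = x\<rbrakk> \<Longrightarrow> x \<cdot> g = g"
  using ran_mul_self by blast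

lemma mul_unit [simp]: "\<lbrakk>x \<in> units G; g \<in> arrows G; gdom G g = x\<rbrakk> \<Longrightarrow> g \<cdot> x = g"
  using mul_dom by blast

lemma unit_inv [simp]: "x \<in> units G \<Longrightarrow> ginv G x = x"
  using mul_inv_self[of x] ran_mul_self[of "ginv G x"] by simp

lemma inv_inv [simp]:
  assumes "g \<in> arrows G"
  shows "ginv G (ginv G g) = g"
proof -
  have "g = g \<cdot> (ginv G g \<cdot> ginv G (ginv G g))"
    using assms mul_inv_self[of "ginv G g"] by simp
  also have "\<dots> = (g \<cdot> ginv G g) \<cdot> ginv G (ginv G g)"
    using assms by (intro mul_assoc[symmetric]) (auto simp del: mul_inv_self)
  also have "\<dots> = ginv G (ginv G g)"
    using assms ran_mul_self[of "ginv G (ginv G g)"] by simp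
  finally show ?thesis by simp
qed

lemma inv_mul_mul [simp]:
  "\<lbrakk>g \<in> arrows G; h \<in> arrows G; gdom G g = gran G h\<rbrakk> \<Longrightarrow> ginv G g \<cdot> (g \<cdot> h) = h"
  using mul_assoc[of "ginv G g" g h] by simp

lemma mul_inv_mul [simp]:
  "\<lbrakk>g \<in> arrows G; h \<in> arrows G; gran G g = gran G h\<rbrakk> \<Longrightarrow> g \<cdot> (ginv G g \<cdot> h) = h"
  using mul_assoc[of g "ginv G g" h] by simp

lemma mul_mul_inv [simp]:
  "\<lbrakk>g \<in> arrows G; h \<in> arrows G; gdom G g = gran G h\<rbrakk> \<Longrightarrow> (g \<cdot> h) \<cdot> ginv G h = g"
  using mul_assoc[of g h "ginv G h"] mul_dom[of g] by simp

lemma mul_inv_mul' [simp]: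
  "\<lbrakk>g \<in> arrows G; h \<in> arrows G; gdom G g = gdom G h\<rbrakk> \<Longrightarrow> (g \<cdot> ginv G h) \<cdot> h = g"
  using mul_assoc[of g "ginv G h" h] mul_dom[of g] by simp

lemma isotropy_iff: "g \<in> isotropy G x \<longleftrightarrow> g \<in> arrows G \<and> gdom G g = x \<and> gran G g = x"
  by (simp add: isotropy_def)

lemma L_fibre_iff: "g \<in> L_fibre G x \<longleftrightarrow> g \<in> arrows G \<and> gdom G g = x"
  by (simp add: L_fibre_def)

lemma slice_subset: "slice G U \<Longrightarrow> U \<subseteq> arrows G"
  by (auto simp: slice_def dest: openin_subset)

lemma slice_arrow: "\<lbrakk>slice G U; g \<in> U\<rbrakk> \<Longrightarrow> g \<in> arrows G"
  using slice_subset by auto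

lemma slice_dom_eq: "\<lbrakk>slice G U; g \<in> U; h \<in> U; gdom G g = gdom G h\<rbrakk> \<Longrightarrow> g = h"
  by (auto simp: slice_def dest: inj_onD)

lemma slice_ran_eq: "\<lbrakk>slice G U; g \<in> U; h \<in> U; gran G g = gran G h\<rbrakk> \<Longrightarrow> g = h"
  by (auto simp: slice_def dest: inj_onD)

end

section \<open>Continuity of domain and range\<close>

context topological_groupoid
begin

lemma continuous_dom: "continuous_map (gtop G) (unit_top G) (gdom G)"
proof -
  have "continuous_map (gtop G)
      (subtopology (prod_topology (gtop G) (gtop G))
            {(g, h). g \<in> arrows G \<and> h \<in> arrows G \<and> gdom G g = gran G h}) (\<lambda>g. (ginv G g, g))"
    using continuous_inv by (auto simp: continuous_map_in_subtopology continuous_map_pairwise o_def)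
  from continuous_map_compose[OF this continuous_mul]
  have "continuous_map (gtop G) (gtop G) (gdom G)"
    by (simp add: o_def)
  then show ?thesis by (auto simp: continuous_map_in_subtopology)
qed

lemma continuous_ran: "continuous_map (gtop G) (unit_top G) (gran G)"
  by (rule continuous_map_eq[OF continuous_map_compose[OF continuous_inv continuous_dom]]) simp

lemma topspace_unit_top [simp]: "topspace (unit_top G) = units G"
  using units_subset by auto

lemma open_inv_image: "openin (gtop G) U \<Longrightarrow> openin (gtop G) (ginv G ` U)"
proof -
  assume U: "openin (gtop G) U"
  then have "U \<subseteq> arrows G" by (rule openin_subset)
  then have "ginv G ` U = {g \<in> arrows G. ginv G g \<in> U}"
    by (auto intro!: image_eqI[of _ "ginv G" "ginv G _"])
  then show ?thesis using openin_continuous_map_preimage[OF continuous_inv U] by simp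
qed

end

section \<open>Slices of an etale groupoid and their products\<close>

context etale_groupoid
begin

text \<open>Openness is local on the source, and on a chart the domain map is a homeomorphism onto
  an open set.\<close>

lemma open_map_dom: "open_map (gtop G) (unit_top G) (gdom G)"
  unfolding open_map_def
proof (intro allI impI)
  fix U assume U: "openin (gtop G) U"
  show "openin (unit_top G) (gdom G ` U)"
  proof (subst openin_subopen, intro ballI)
    fix y assume "y \<in> gdom G ` U"
    then obtain x where x: "x \<in> U" "y = gdom G x" by auto
    then have "x \<in> arrows G" using U openin_subset by blast
    then obtain V where V: "openin (gtop G) V" "x \<in> V" "openin (unit_top G) (gdom G ` V)"
      "homeomorphic_map (subtopology (gtop G) V) (subtopology (unit_top G) (gdom G ` V)) (gdom G)"
      using local_homeomorphism_dom unfolding local_homeomorphism_def by blast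
    have "openin (subtopology (gtop G) V) (V \<inter> U)"
      using U by (simp add: openin_subtopology_Int2)
    then have "openin (subtopology (unit_top G) (gdom G ` V)) (gdom G ` (V \<inter> U))"
      using homeomorphic_imp_open_map[OF V(4)] unfolding open_map_def by blast
    then have "openin (unit_top G) (gdom G ` (V \<inter> U))"
      using V(3) openin_trans_full by blast
    then show "\<exists>T. openin (unit_top G) T \<and> y \<in> T \<and> T \<subseteq> gdom G ` U"
      using x V(2) by (intro exI[of _ "gdom G ` (V \<inter> U)"]) auto
  qed
qed

lemma open_map_ran: "open_map (gtop G) (unit_top G) (gran G)"
  unfolding open_map_def
proof (intro allI impI)
  fix U assume U: "openin (gtop G) U"
  have "gran G ` U = gdom G ` ginv G ` U"
    using openin_subset[OF U] by (force simp: image_image)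
  then show "openin (unit_top G) (gran G ` U)"
    using open_map_dom open_inv_image[OF U] unfolding open_map_def by simp
qed

text \<open>Near a unit the domain map is injective. If an arrow \<open>g\<close> and its domain
  both lie there, they have the same domain, hence \<open>g\<close> is its own domain and so a
  unit.\<close>

lemma open_units: "openin (gtop G) (units G)"
proof (subst openin_subopen, intro ballI)
  fix x assume x: "x \<in> units G"
  then obtain U where U: "openin (gtop G) U" "x \<in> U"
      "homeomorphic_map (subtopology (gtop G) U) (subtopology (unit_top G) (gdom G ` U)) (gdom G)"
    using local_homeomorphism_dom units_closed[OF x] unfolding local_homeomorphism_def by blast
  have inj: "inj_on (gdom G) U"
    using homeomorphic_imp_injective_map[OF U(3)] openin_subset[OF U(1)] by (simp add: Int_absorb1)
  define W where "W = U \<inter> {g \<in> arrows G. gdom G g \<in> units G \<inter> U}"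
  have "openin (unit_top G) (units G \<inter> U)"
    using U(1) by (simp add: openin_subtopology_Int2)
  then have "openin (gtop G) W"
    unfolding W_def using U(1) openin_continuous_map_preimage[OF continuous_dom] by blast
  moreover have "x \<in> W" using x U(2) by (simp add: W_def)
  moreover have "W \<subseteq> units G"
  proof
    fix g assume g: "g \<in> W"
    then have "g \<in> arrows G" "g \<in> U" "gdom G g \<in> U" by (auto simp: W_def)
    then have "gdom G g = g" using inj_onD[OF inj, of "gdom G g" g] by simp
    then show "g \<in> units G" using g by (auto simp: W_def)
  qed
  ultimately show "\<exists>T. openin (gtop G) T \<and> x \<in> T \<and> T \<subseteq> units G" by blast
qed

lemma openin_unit_top: "openin (unit_top G) W \<longleftrightarrow> openin (gtop G) W \<and> W \<subseteq> units G"
  using open_units by (rule openin_open_subtopology)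

lemma open_dom_image: "openin (gtop G) U \<Longrightarrow> openin (gtop G) (gdom G ` U)"
  using open_map_dom openin_unit_top unfolding open_map_def by blast

lemma open_ran_image: "openin (gtop G) U \<Longrightarrow> openin (gtop G) (gran G ` U)"
  using open_map_ran openin_unit_top unfolding open_map_def by blast

lemma open_dom_preimage: "openin (gtop G) W \<Longrightarrow> openin (gtop G) {g \<in> arrows G. gdom G g \<in> W}"
proof -
  assume "openin (gtop G) W"
  then have "openin (unit_top G) (units G \<inter> W)" by (simp add: openin_subtopology_Int2)
  from openin_continuous_map_preimage[OF continuous_dom this]
  show ?thesis by (rule back_subst[of "openin (gtop G)"]) auto
qed

lemma open_ran_preimage: "openin (gtop G) W \<Longrightarrow> openin (gtop G) {g \<in> arrows G. gran G g \<in> W}"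
proof -
  assume "openin (gtop G) W"
  then have "openin (unit_top G) (units G \<inter> W)" by (simp add: openin_subtopology_Int2)
  from openin_continuous_map_preimage[OF continuous_ran this]
  show ?thesis by (rule back_subst[of "openin (gtop G)"]) auto
qed

lemma slice_homeomorphic:
  assumes "slice G U" "f = gdom G \<or> f = gran G"
  shows "homeomorphic_map (subtopology (gtop G) U) (subtopology (unit_top G) (f ` U)) f"
proof (rule bijective_open_imp_homeomorphic_map)
  have U: "openin (gtop G) U" using assms(1) by (simp add: slice_def)
  have cont: "continuous_map (gtop G) (unit_top G) f" and opn: "open_map (gtop G) (unit_top G) f"
    using assms(2) continuous_dom continuous_ran open_map_dom open_map_ran by auto
  show "continuous_map (subtopology (gtop G) U) (subtopology (unit_top G) (f ` U)) f"
    using cont by (auto simp: continuous_map_in_subtopology intro: continuous_map_from_subtopology)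
  show "open_map (subtopology (gtop G) U) (subtopology (unit_top G) (f ` U)) f"
    by (intro open_map_into_subtopology open_map_from_subtopology opn U) auto
  have "f ` U \<subseteq> units G" using assms slice_subset[OF assms(1)] by auto
  then show "f ` topspace (subtopology (gtop G) U) = topspace (subtopology (unit_top G) (f ` U))"
    using slice_subset[OF assms(1)] units_subset by (auto simp: topspace_subtopology)
  show "inj_on f (topspace (subtopology (gtop G) U))"
    using assms by (auto simp: slice_def intro: inj_on_subset)
qed

lemma slice_compact_iff:
  assumes "slice G U"
  shows "compactin (gtop G) U \<longleftrightarrow> compactin (gtop G) (gdom G ` U)"
proof -
  have "compactin (subtopology (unit_top G) (gdom G ` U)) (gdom G ` U) \<longleftrightarrow>
      compactin (subtopology (gtop G) U) U"
    using homeomorphic_map_compactness[OF slice_homeomorphic[OF assms, of "gdom G"], of U]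
      slice_subset[OF assms] by auto
  moreover have "gdom G ` U \<subseteq> units G" using slice_subset[OF assms] by auto
  ultimately show ?thesis by (simp add: compactin_subtopology)
qed

lemma slice_Hausdorff:
  assumes "slice G U"
  shows "Hausdorff_space (subtopology (gtop G) U)"
proof (rule Hausdorff_space_injective_preimage[OF Hausdorff_units])
  show "continuous_map (subtopology (gtop G) U) (unit_top G) (gdom G)"
    using continuous_dom by (rule continuous_map_from_subtopology)
  show "inj_on (gdom G) (topspace (subtopology (gtop G) U))"
    using assms by (auto simp: slice_def intro: inj_on_subset)
qed

lemma compact_slice_iff: "slice G U \<and> hcompactin (gtop G) U \<longleftrightarrow> compact_slice G U"
  using slice_Hausdorff by (auto simp: compact_slice_def hcompactin_def)

lemma compact_slice_slice: "compact_slice G U \<Longrightarrow> slice G U"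
  by (simp add: compact_slice_def)

lemma compact_slice_open: "compact_slice G U \<Longrightarrow> openin (gtop G) U"
  by (simp add: compact_slice_def slice_def)

lemma slice_of_units: "\<lbrakk>openin (gtop G) W; W \<subseteq> units G\<rbrakk> \<Longrightarrow> slice G W"
  by (auto simp: slice_def inj_on_def subset_iff)

lemma compact_slice_of_units:
  "W \<subseteq> units G \<Longrightarrow> compact_slice G W \<longleftrightarrow> openin (gtop G) W \<and> compactin (gtop G) W"
  using slice_of_units by (auto simp: compact_slice_def slice_def)

lemma compact_slice_of_units_hcompactin:
  assumes "W \<subseteq> units G"
  shows "compact_slice G W \<longleftrightarrow> openin (unit_top G) W \<and> hcompactin (unit_top G) W"
proof -
  have "Hausdorff_space (subtopology (unit_top G) W)"
    using Hausdorff_units by (rule Hausdorff_space_subtopology)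
  then show ?thesis
    using assms by (auto simp: compact_slice_of_units hcompactin_def openin_unit_top compactin_subtopology)
qed

text \<open>Openness is the point. The range map is a homeomorphism of \<open>U\<close> onto an open
  set with inverse \<open>\<sigma>\<close>, so the factor in \<open>U\<close> of an arrow
  \<open>k\<close> can only be \<open>\<sigma> (gran G k)\<close>. The product is the preimage of
  \<open>V\<close> under the continuous map \<open>F\<close>, which removes this factor.\<close>

lemma slice_gprod:
  assumes U: "slice G U" and V: "slice G V"
  shows "slice G (gprod G U V)"
proof -
  have Uo: "openin (gtop G) U" and Vo: "openin (gtop G) V" using assms by (auto simp: slice_def)
  note sub = slice_arrow[OF U] slice_arrow[OF V]
  obtain \<sigma> where "homeomorphic_maps (subtopology (gtop G) U) (subtopology (unit_top G) (gran G ` U)) (gran G) \<sigma>"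
    using slice_homeomorphic[OF U, of "gran G"] by (auto simp: homeomorphic_map_maps)
  then have \<sigma>c: "continuous_map (subtopology (unit_top G) (gran G ` U)) (gtop G) \<sigma>"
    and \<sigma>: "\<And>u. u \<in> U \<Longrightarrow> \<sigma> (gran G u) = u"
    using slice_subset[OF U] by (auto simp: homeomorphic_maps_def continuous_map_in_subtopology)
  define Z where "Z = {k \<in> arrows G. gran G k \<in> gran G ` U}"
  define F where "F k = ginv G (\<sigma> (gran G k)) \<cdot> k" for k
  have Zo: "openin (gtop G) Z"
    unfolding Z_def by (intro open_ran_preimage open_ran_image Uo)
  have c1: "continuous_map (subtopology (gtop G) Z) (subtopology (unit_top G) (gran G ` U)) (gran G)"
    using continuous_ran by (auto simp: continuous_map_in_subtopology Z_def intro: continuous_map_from_subtopology)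
  have c2: "continuous_map (subtopology (gtop G) Z) (gtop G) (\<lambda>k. ginv G (\<sigma> (gran G k)))"
    using continuous_map_compose[OF continuous_map_compose[OF c1 \<sigma>c] continuous_inv] by (simp add: o_def)
  have c3: "continuous_map (subtopology (gtop G) Z) (gtop G) (\<lambda>k. k)"
    using continuous_map_from_subtopology[OF continuous_map_id] by (simp add: id_def)
  have "continuous_map (subtopology (gtop G) Z)
      (subtopology (prod_topology (gtop G) (gtop G))
            {(g, h). g \<in> arrows G \<and> h \<in> arrows G \<and> gdom G g = gran G h})
      (\<lambda>k. (ginv G (\<sigma> (gran G k)), k))"
    using c2 c3 \<sigma> sub(1) by (auto simp: continuous_map_in_subtopology continuous_map_pairwise o_def Z_def)
  from continuous_map_compose[OF this continuous_mul]
  have "continuous_map (subtopology (gtop G) Z) (gtop G) F"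
    by (simp add: o_def F_def[abs_def])
  from openin_continuous_map_preimage[OF this Vo]
  have "openin (gtop G) {k \<in> Z. F k \<in> V}"
    using openin_trans_full[OF _ Zo] openin_subset[OF Zo] by (simp add: Int_absorb1)
  moreover have "{k \<in> Z. F k \<in> V} = gprod G U V"
  proof (rule Set.set_eqI, rule iffI)
    fix k assume "k \<in> {k \<in> Z. F k \<in> V}"
    then obtain u where u: "u \<in> U" "gran G k = gran G u" "k \<in> arrows G" "ginv G u \<cdot> k \<in> V"
      using \<sigma> by (auto simp: Z_def F_def)
    then have "u \<cdot> (ginv G u \<cdot> k) \<in> gprod G U V"
      using sub by (intro gprodI) auto
    then show "k \<in> gprod G U V" using u sub by simp
  next
    fix k assume "k \<in> gprod G U V"
    then obtain u v where "u \<in> U" "v \<in> V" "gdom G u = gran G v" "k = u \<cdot> v"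
      by (auto simp: gprod_def)
    then show "k \<in> {k \<in> Z. F k \<in> V}"
      using sub \<sigma> by (auto simp: Z_def F_def)
  qed
  moreover have "inj_on (gdom G) (gprod G U V)"
  proof (rule inj_onI)
    fix k l assume "k \<in> gprod G U V" "l \<in> gprod G U V" "gdom G k = gdom G l"
    moreover from this obtain u v u' v' where "u \<in> U" "v \<in> V" "gdom G u = gran G v" "k = u \<cdot> v"
      "u' \<in> U" "v' \<in> V" "gdom G u' = gran G v'" "l = u' \<cdot> v'"
      by (auto simp: gprod_def)
    ultimately show "k = l"
      using sub slice_dom_eq[OF V, of v v'] slice_dom_eq[OF U, of u u'] by simp
  qed
  moreover have "inj_on (gran G) (gprod G U V)"
  proof (rule inj_onI)
    fix k l assume "k \<in> gprod G U V" "l \<in> gprod G U V" "gran G k = gran G l"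
    moreover from this obtain u v u' v' where "u \<in> U" "v \<in> V" "gdom G u = gran G v" "k = u \<cdot> v"
      "u' \<in> U" "v' \<in> V" "gdom G u' = gran G v'" "l = u' \<cdot> v'"
      by (auto simp: gprod_def)
    ultimately show "k = l"
      using sub slice_ran_eq[OF V, of v v'] slice_ran_eq[OF U, of u u'] by simp
  qed
  ultimately show ?thesis by (simp add: slice_def)
qed

lemma compactin_unit_top: "W \<subseteq> units G \<Longrightarrow> compactin (unit_top G) W \<longleftrightarrow> compactin (gtop G) W"
  by (simp add: compactin_subtopology)

lemma compact_units_closed:
  "\<lbrakk>compactin (gtop G) W; W \<subseteq> units G\<rbrakk> \<Longrightarrow> closedin (unit_top G) W"
  using compactin_imp_closedin[OF Hausdorff_units] compactin_unit_top by blast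

lemma open_units_diff:
  assumes "compactin (gtop G) W" "W \<subseteq> units G"
  shows "openin (gtop G) (units G - W)"
  using compact_units_closed[OF assms] by (simp add: closedin_def openin_unit_top)

lemma dom_image_units: "compact_slice G U \<Longrightarrow> gdom G ` U \<subseteq> units G"
  using slice_subset[OF compact_slice_slice] by fastforce

lemma ran_image_units: "compact_slice G U \<Longrightarrow> gran G ` U \<subseteq> units G"
  using slice_subset[OF compact_slice_slice] by fastforce

lemma compact_slice_dom: "compact_slice G U \<Longrightarrow> compact_slice G (gdom G ` U)"
  using dom_image_units[of U] open_dom_image[of U] slice_compact_iff[of U]
  by (simp add: compact_slice_of_units compact_slice_slice compact_slice_open) (simp add: compact_slice_def)

lemma compact_slice_ran:
  assumes "compact_slice G U"
  shows "compact_slice G (gran G ` U)"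
proof -
  have "compactin (unit_top G) (gran G ` U)"
    using assms continuous_ran by (intro image_compactin) (auto simp: compact_slice_def)
  then show ?thesis
    using ran_image_units[OF assms] open_ran_image[OF compact_slice_open[OF assms]]
    by (simp add: compact_slice_of_units compactin_unit_top)
qed

lemma compact_slice_inv:
  assumes "compact_slice G U"
  shows "compact_slice G (ginv G ` U)"
proof -
  note sub = slice_arrow[OF compact_slice_slice[OF assms]]
  have "compactin (gtop G) (ginv G ` U)"
    using assms continuous_inv by (intro image_compactin) (auto simp: compact_slice_def)
  moreover have "inj_on (gdom G) (ginv G ` U)" "inj_on (gran G) (ginv G ` U)"
    using assms sub by (auto simp: compact_slice_def slice_def inj_on_def)
  ultimately show ?thesis
    using open_inv_image[OF compact_slice_open[OF assms]] by (simp add: compact_slice_def slice_def)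
qed

text \<open>Compactness is tested on the domains. Those of the product are the domains of the arrows
  of \<open>V\<close> that end in d(U). As d(U) is compact, it is closed in the Hausdorff unit
  space, so these arrows form a closed part \<open>V'\<close> of the compact set
  \<open>V\<close>.\<close>

lemma compact_slice_gprod:
  assumes U: "compact_slice G U" and V: "compact_slice G V"
  shows "compact_slice G (gprod G U V)"
proof -
  note sub = slice_arrow[OF compact_slice_slice[OF U]] slice_arrow[OF compact_slice_slice[OF V]]
  have sl: "slice G (gprod G U V)"
    using slice_gprod U V by (simp add: compact_slice_def)
  define V' where "V' = V \<inter> {h \<in> arrows G. gran G h \<in> gdom G ` U}"
  have cl: "closedin (unit_top G) (gdom G ` U)"
    using compact_units_closed compact_slice_dom[OF U] dom_image_units[OF U]
    by (simp add: compact_slice_def)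
  have "closedin (gtop G) {h \<in> arrows G. gran G h \<in> gdom G ` U}"
    using closedin_continuous_map_preimage[OF continuous_ran cl] .
  then have "compactin (gtop G) V'"
    unfolding V'_def using V compact_Int_closedin by (auto simp: compact_slice_def)
  then have "compactin (unit_top G) (gdom G ` V')"
    using continuous_dom image_compactin by blast
  moreover have eq: "gdom G ` gprod G U V = gdom G ` V'"
  proof
    show "gdom G ` gprod G U V \<subseteq> gdom G ` V'"
    proof
      fix y assume "y \<in> gdom G ` gprod G U V"
      then obtain u v where "u \<in> U" "v \<in> V" "gdom G u = gran G v" "y = gdom G (u \<cdot> v)"
        by (auto simp: gprod_def)
      then show "y \<in> gdom G ` V'"
        using sub by (intro image_eqI[of _ _ v]) (auto simp: V'_def intro!: image_eqI[of _ _ u])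
    qed
    show "gdom G ` V' \<subseteq> gdom G ` gprod G U V"
    proof
      fix y assume "y \<in> gdom G ` V'"
      then obtain u v where "u \<in> U" "v \<in> V" "gran G v = gdom G u" "y = gdom G v"
        by (auto simp: V'_def)
      then show "y \<in> gdom G ` gprod G U V"
        using sub by (intro image_eqI[of _ _ "u \<cdot> v"] gprodI) auto
    qed
  qed
  ultimately have "compactin (gtop G) (gdom G ` gprod G U V)"
    by (simp add: compactin_subtopology)
  then show ?thesis
    using sl slice_compact_iff by (simp add: compact_slice_def)
qed

text \<open>Among units compact sets are closed, so the compact open sets of units form a ring of
  sets. For arbitrary compact slices intersections may fail to be compact.\<close>

lemma compact_slice_units_Int:
  assumes "compact_slice G U" "compact_slice G V" "U \<subseteq> units G" "V \<subseteq> units G"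
  shows "compact_slice G (U \<inter> V)"
proof -
  have "closedin (unit_top G) V"
    using assms compact_units_closed by (simp add: compact_slice_def)
  then have "compactin (unit_top G) (U \<inter> V)"
    using assms by (intro compact_Int_closedin) (auto simp: compactin_unit_top compact_slice_def)
  then show ?thesis
    using assms by (auto simp: compact_slice_of_units compactin_subtopology)
qed

lemma compact_slice_units_Diff:
  assumes "compact_slice G U" "compact_slice G V" "U \<subseteq> units G" "V \<subseteq> units G"
  shows "compact_slice G (U - V)"
proof -
  have V: "openin (gtop G) (units G - V)"
    using open_units_diff assms by (simp add: compact_slice_def)
  have eq: "U - V = U \<inter> (units G - V)" using assms by auto
  have "closedin (unit_top G) (units G - V)"
    using assms(2,4) units_subset
    by (auto simp: closedin_def compact_slice_of_units openin_unit_top Diff_Diff_Int Int_absorb1)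
  then have "compactin (unit_top G) (U - V)"
    unfolding eq using assms by (intro compact_Int_closedin) (auto simp: compactin_unit_top compact_slice_def)
  then show ?thesis
    using assms V unfolding eq by (auto simp: compact_slice_of_units compactin_subtopology)
qed

lemma compact_slice_units_Un:
  assumes "compact_slice G U" "compact_slice G V" "U \<subseteq> units G" "V \<subseteq> units G"
  shows "compact_slice G (U \<union> V)"
  using assms by (auto simp: compact_slice_of_units intro: compactin_Un)

lemma compact_slice_empty: "compact_slice G {}"
  by (simp add: compact_slice_of_units)

lemma open_units_minus_point:
  assumes "x \<in> units G"
  shows "openin (gtop G) (units G - {x})"
  using assms by (intro open_units_diff) auto

text \<open>Points are closed in the unit space. Slices inside such a neighbourhood do not start at
  \<open>x\<close> and so act as zero on whatever sits over \<open>x\<close>; this is how the other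
  arrows drop out of a germ.\<close>

lemma separate_units:
  assumes "g \<in> arrows G" "x \<in> units G" "gdom G g \<noteq> x"
  obtains O' where "openin (gtop G) O'" "g \<in> O'" "\<And>h. h \<in> O' \<Longrightarrow> gdom G h \<noteq> x"
proof
  show "openin (gtop G) {h \<in> arrows G. gdom G h \<in> units G - {x}}"
    by (intro open_dom_preimage open_units_minus_point assms)
qed (use assms in auto)

end

context ample_groupoid
begin

lemma compact_slice_nbhd:
  assumes "openin (gtop G) W" "g \<in> W"
  obtains U where "compact_slice G U" "g \<in> U" "U \<subseteq> W"
  using compact_slice_basis[OF assms] compact_slice_iff by blast

lemma compact_slice_at:
  assumes "g \<in> arrows G"
  obtains U where "compact_slice G U" "g \<in> U"
  by (rule compact_slice_nbhd[OF openin_topspace assms]) (rule that)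

end

section \<open>The groupoid algebra\<close>

lemma groupoid_algebra_simps [simp]:
  "\<zero>\<^bsub>groupoid_algebra G\<^esub> = (\<lambda>s. 0)"
  "a \<oplus>\<^bsub>groupoid_algebra G\<^esub> b = (\<lambda>s. a s + b s)"
  "c \<odot>\<^bsub>groupoid_algebra G\<^esub> a = (\<lambda>s. c * a s)"
  "a \<otimes>\<^bsub>groupoid_algebra G\<^esub> b = convolution G a b"
  "carrier (groupoid_algebra G) = mspan (fun_module (arrows G)) (alg_generators G)"
  by (simp_all add: groupoid_algebra_def fun_module_def)

lemma isotropy_algebra_simps [simp]:
  "\<zero>\<^bsub>isotropy_algebra G x\<^esub> = (\<lambda>s. 0)"
  "a \<oplus>\<^bsub>isotropy_algebra G x\<^esub> b = (\<lambda>s. a s + b s)"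
  "c \<odot>\<^bsub>isotropy_algebra G x\<^esub> a = (\<lambda>s. c * a s)"
  "a \<otimes>\<^bsub>isotropy_algebra G x\<^esub> b = bilinear_mul G a b"
  "carrier (isotropy_algebra G x) = carrier (free_module (isotropy G x))"
  by (simp_all add: isotropy_algebra_def free_module_def fun_module_def)

declare groupoid_algebra_simps(5) [simp del]

section \<open>The algebra is spanned by characteristic functions of compact slices\<close>

context ample_groupoid
begin

lemma alg_generators_subset:
  "alg_generators G \<subseteq> carrier (fun_module (arrows G) :: ('k::{comm_ring,comm_monoid_mult}, 'a \<Rightarrow> 'k) module)"
proof
  fix f :: "'a \<Rightarrow> 'k" assume "f \<in> alg_generators G"
  then obtain V where "openin (gtop G) V" "\<forall>g. g \<notin> V \<longrightarrow> f g = 0"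
    unfolding alg_generators_def by blast
  then show "f \<in> carrier (fun_module (arrows G))"
    using openin_subset by fastforce
qed

lemma char_fun_in_generators:
  assumes "compact_slice G U"
  shows "(char_fun U :: 'a \<Rightarrow> 'k::{comm_ring,comm_monoid_mult}) \<in> alg_generators G"
proof -
  let ?X = "subtopology (gtop G) U"
  have cont: "continuous_map ?X (discrete_topology UNIV) (char_fun U :: 'a \<Rightarrow> 'k)"
    by (rule continuous_map_eq[where f = "\<lambda>_. 1"]) (auto simp: char_fun_def)
  have Haus: "Hausdorff_space ?X"
    using assms by (intro slice_Hausdorff compact_slice_slice)
  have sub: "?X closure_of {g \<in> U. (char_fun U :: 'a \<Rightarrow> 'k) g \<noteq> 0} \<subseteq> U"
    using closure_of_subset_topspace[of ?X] by auto
  have "compactin ?X U"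
    using assms by (simp add: compact_slice_def compactin_subtopology)
  then have "compactin ?X (?X closure_of {g \<in> U. (char_fun U :: 'a \<Rightarrow> 'k) g \<noteq> 0})"
    by (rule closed_compactin[OF _ sub]) simp
  then have "hcompactin ?X (?X closure_of {g \<in> U. (char_fun U :: 'a \<Rightarrow> 'k) g \<noteq> 0})"
    using Haus Hausdorff_space_subtopology by (auto simp: hcompactin_def)
  then show ?thesis
    unfolding alg_generators_def using cont Haus compact_slice_open[OF assms]
    by (intro CollectI exI[of _ U]) (auto simp: char_fun_def)
qed

abbreviation slice_funs :: "('a \<Rightarrow> 'k::{comm_ring,comm_monoid_mult}) set" where
  "slice_funs \<equiv> {char_fun U | U. compact_slice G U}"

text \<open>Induction over a finite cover by compact slices inside \<open>V\<close>. As
  \<open>V\<close> is Hausdorff, each of them is closed and open in \<open>V\<close> and cuts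
  \<open>C\<close> into two compact open pieces: one is a compact slice, the other is covered by the
  remaining slices.\<close>

lemma compact_open_in_span:
  fixes V :: "'a set"
  assumes V: "openin (gtop G) V" "Hausdorff_space (subtopology (gtop G) V)"
    and C: "openin (gtop G) C" "compactin (gtop G) C" "C \<subseteq> V"
  shows "(char_fun C :: 'a \<Rightarrow> 'k::{comm_ring,comm_monoid_mult}) \<in> mspan (fun_module (arrows G)) slice_funs"
proof -
  interpret FM: kmodule "fun_module (arrows G) :: ('k, 'a \<Rightarrow> 'k) module" by (rule kmodule_fun_module)
  have sub: "(slice_funs :: ('a \<Rightarrow> 'k) set) \<subseteq> carrier (fun_module (arrows G))"
    using char_fun_in_generators alg_generators_subset by blast
  note E = FM.submodule_scalarsE[OF FM.mspan_submodule[OF sub]]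
  \<comment> \<open>All compact open \<open>C\<close> at once, because the induction step replaces
    \<open>C\<close> by \<open>C - U\<close>.\<close>
  have ind: "\<forall>C. openin (gtop G) C \<longrightarrow> compactin (gtop G) C \<longrightarrow> C \<subseteq> V \<longrightarrow> C \<subseteq> \<Union>F \<longrightarrow>
      (char_fun C :: 'a \<Rightarrow> 'k) \<in> mspan (fun_module (arrows G)) slice_funs"
    if "finite F" "\<forall>U\<in>F. compact_slice G U \<and> U \<subseteq> V" for F
    using that
  proof (induction F rule: finite_induct)
    case empty
    then show ?case using E(2) by (auto simp: char_fun_def)
  next
    case (insert U F)
    show ?case
    proof (intro allI impI)
      fix C assume C: "openin (gtop G) C" "compactin (gtop G) C" "C \<subseteq> V" "C \<subseteq> \<Union>(insert U F)"
      have U: "compact_slice G U" "U \<subseteq> V" using insert.prems by auto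
      have Uo: "openin (gtop G) U" and Uc: "compactin (gtop G) U"
        using U by (auto simp: compact_slice_def slice_def)
      let ?X = "subtopology (gtop G) V"
      have cl: "closedin ?X U"
        using compactin_imp_closedin[OF V(2)] U Uc by (simp add: compactin_subtopology)
      have cC: "compactin ?X C" using C by (simp add: compactin_subtopology)
      have "compactin ?X (C \<inter> U)" using compact_Int_closedin[OF cC cl] .
      moreover have "slice G (C \<inter> U)"
        using U C Uo by (auto simp: compact_slice_def slice_def intro: inj_on_subset)
      ultimately have CU: "compact_slice G (C \<inter> U)"
        by (simp add: compact_slice_def compactin_subtopology)
      have "openin ?X U" using Uo U V by (simp add: openin_open_subtopology)
      then have "closedin ?X (topspace ?X - U)" by blast
      then have "compactin ?X (C \<inter> (topspace ?X - U))" using compact_Int_closedin[OF cC] by blast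
      moreover have eq: "C \<inter> (topspace ?X - U) = C - U"
        using C openin_subset[OF C(1)] by auto
      ultimately have DC: "compactin (gtop G) (C - U)"
        by (simp add: compactin_subtopology)
      have "closedin ?X U" by fact
      then have "openin ?X (topspace ?X - U)" by blast
      then have "openin (gtop G) (topspace ?X - U)" using V(1) openin_trans_full by blast
      then have DO: "openin (gtop G) (C - U)" using C(1) eq by (metis openin_Int)
      have "(char_fun (C - U) :: 'a \<Rightarrow> 'k) \<in> mspan (fun_module (arrows G)) slice_funs"
        using insert.IH insert.prems DO DC C by auto
      moreover have "(char_fun (C \<inter> U) :: 'a \<Rightarrow> 'k) \<in> mspan (fun_module (arrows G)) slice_funs"
        using CU FM.mspan_superset[of slice_funs] by blast
      ultimately have "char_fun (C - U) \<oplus>\<^bsub>fun_module (arrows G)\<^esub> char_fun (C \<inter> U) \<in>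
          mspan (fun_module (arrows G)) (slice_funs :: ('a \<Rightarrow> 'k) set)"
        by (rule E(3))
      moreover have "char_fun (C - U) \<oplus>\<^bsub>fun_module (arrows G)\<^esub> char_fun (C \<inter> U) = (char_fun C :: 'a \<Rightarrow> 'k)"
        by (auto simp: char_fun_def)
      ultimately show "(char_fun C :: 'a \<Rightarrow> 'k) \<in> mspan (fun_module (arrows G)) slice_funs" by simp
    qed
  qed
  define \<U> where "\<U> = {U. compact_slice G U \<and> U \<subseteq> C}"
  have "\<exists>\<F>. finite \<F> \<and> \<F> \<subseteq> \<U> \<and> C \<subseteq> \<Union>\<F>"
  proof (rule compactinD[OF C(2)])
    show "openin (gtop G) U" if "U \<in> \<U>" for U using that compact_slice_open by (auto simp: \<U>_def)
    show "C \<subseteq> \<Union>\<U>"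
    proof
      fix g assume "g \<in> C"
      then obtain U where "compact_slice G U" "g \<in> U" "U \<subseteq> C"
        using compact_slice_nbhd[OF C(1)] by metis
      then show "g \<in> \<Union>\<U>" by (auto simp: \<U>_def)
    qed
  qed
  then obtain F where "finite F" "F \<subseteq> \<U>" "C \<subseteq> \<Union>F" by blast
  moreover have "\<forall>U\<in>F. compact_slice G U \<and> U \<subseteq> V" using \<open>F \<subseteq> \<U>\<close> C by (auto simp: \<U>_def)
  ultimately show ?thesis using ind[of F] C by blast
qed

text \<open>A continuous function into a discrete space has closed and open level sets, and on a
  compact support it takes finitely many values. It is thus a finite combination of characteristic
  functions of compact open subsets of the Hausdorff set \<open>V\<close>.\<close>

lemma generator_in_span:
  fixes f :: "'a \<Rightarrow> 'k::{comm_ring,comm_monoid_mult}"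
  assumes "f \<in> alg_generators G"
  shows "f \<in> mspan (fun_module (arrows G)) slice_funs"
proof -
  interpret FM: kmodule "fun_module (arrows G) :: ('k, 'a \<Rightarrow> 'k) module" by (rule kmodule_fun_module)
  have sub: "(slice_funs :: ('a \<Rightarrow> 'k) set) \<subseteq> carrier (fun_module (arrows G))"
    using char_fun_in_generators alg_generators_subset by blast
  note E = FM.submodule_scalarsE[OF FM.mspan_submodule[OF sub]]
  obtain V where V: "openin (gtop G) V" "Hausdorff_space (subtopology (gtop G) V)"
    and f0: "\<And>g. g \<notin> V \<Longrightarrow> f g = 0"
    and fc: "continuous_map (subtopology (gtop G) V) (discrete_topology UNIV) f"
    and fs: "hcompactin (subtopology (gtop G) V) (subtopology (gtop G) V closure_of {g \<in> V. f g \<noteq> 0})"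
    using assms unfolding alg_generators_def by blast
  let ?X = "subtopology (gtop G) V"
  have X: "topspace ?X = V" using openin_subset[OF V(1)] by auto
  have clo: "openin ?X {g \<in> V. f g \<in> T}" "closedin ?X {g \<in> V. f g \<in> T}" for T
    using openin_continuous_map_preimage[OF fc, of T] closedin_continuous_map_preimage[OF fc, of T]
    unfolding X by simp_all
  define S where "S = {g \<in> V. f g \<noteq> 0}"
  \<comment> \<open>The set where \<open>f\<close> does not vanish is already closed, so the compact
    support is this set itself.\<close>
  have "closedin ?X S" using clo(2)[of "- {0}"] by (simp add: S_def)
  then have S: "compactin ?X S" using fs by (simp add: hcompactin_def S_def closure_of_closedin)
  then have fin: "finite (f ` S)"
    using image_compactin[OF S fc] compactin_discrete_topology by blast
  have lev: "char_fun {g \<in> V. f g = c} \<in> mspan (fun_module (arrows G)) (slice_funs :: ('a \<Rightarrow> 'k) set)"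
    if "c \<noteq> 0" for c
  proof (rule compact_open_in_span[OF V])
    have "{g \<in> V. f g = c} = {g \<in> V. f g \<in> {c}}" by auto
    then have "openin ?X {g \<in> V. f g = c}" "closedin ?X {g \<in> V. f g = c}" using clo[of "{c}"] by simp_all
    then show "openin (gtop G) {g \<in> V. f g = c}" using V(1) openin_trans_full by blast
    have "compactin ?X {g \<in> V. f g = c}"
      by (rule closed_compactin[OF S _ \<open>closedin ?X {g \<in> V. f g = c}\<close>])
        (use that in \<open>auto simp: S_def\<close>)
    then show "compactin (gtop G) {g \<in> V. f g = c}" by (simp add: compactin_subtopology)
  qed auto
  have "(\<lambda>g. if g \<in> V \<and> f g \<in> T then f g else 0) \<in> mspan (fun_module (arrows G)) slice_funs"
    if "finite T" "0 \<notin> T" for T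
    using that
  proof (induction T rule: finite_induct)
    case empty
    then show ?case using E(2) by simp
  next
    case (insert c T)
    then have "(\<lambda>g. if g \<in> V \<and> f g \<in> T then f g else 0) \<oplus>\<^bsub>fun_module (arrows G)\<^esub>
        (c \<odot>\<^bsub>fun_module (arrows G)\<^esub> char_fun {g \<in> V. f g = c}) \<in> mspan (fun_module (arrows G)) slice_funs"
      using E(3)[OF _ E(4)[OF lev]] by simp
    moreover have "(\<lambda>g. if g \<in> V \<and> f g \<in> T then f g else 0) \<oplus>\<^bsub>fun_module (arrows G)\<^esub>
        (c \<odot>\<^bsub>fun_module (arrows G)\<^esub> char_fun {g \<in> V. f g = c}) =
        (\<lambda>g. if g \<in> V \<and> f g \<in> insert c T then f g else 0)"
      using insert by (auto simp: char_fun_def)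
    ultimately show ?case by simp
  qed
  moreover have "0 \<notin> f ` S" by (auto simp: S_def)
  ultimately have "(\<lambda>g. if g \<in> V \<and> f g \<in> f ` S then f g else 0) \<in> mspan (fun_module (arrows G)) slice_funs"
    using fin by blast
  moreover have "(\<lambda>g. if g \<in> V \<and> f g \<in> f ` S then f g else 0) = f"
  proof
    fix g
    have "f g = 0" if "g \<notin> S" using that f0[of g] by (auto simp: S_def)
    then show "(if g \<in> V \<and> f g \<in> f ` S then f g else 0) = f g"
      by (cases "g \<in> S") (auto simp: S_def)
  qed
  ultimately show ?thesis by simp
qed

lemma groupoid_algebra_spanned:
  "carrier (groupoid_algebra G :: ('k::{comm_ring,comm_monoid_mult}, 'a \<Rightarrow> 'k) module) =
     mspan (fun_module (arrows G)) slice_funs"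
proof -
  interpret FM: kmodule "fun_module (arrows G) :: ('k, 'a \<Rightarrow> 'k) module" by (rule kmodule_fun_module)
  have gen: "alg_generators G \<subseteq> mspan (fun_module (arrows G)) (slice_funs :: ('a \<Rightarrow> 'k) set)"
    by (intro subsetI generator_in_span)
  have sl: "(slice_funs :: ('a \<Rightarrow> 'k) set) \<subseteq> alg_generators G"
    using char_fun_in_generators by blast
  have sl': "(slice_funs :: ('a \<Rightarrow> 'k) set) \<subseteq> mspan (fun_module (arrows G)) (alg_generators G)"
    using sl FM.mspan_superset[of "alg_generators G"] by (rule order_trans)
  show ?thesis unfolding groupoid_algebra_simps(5)
    by (intro equalityI FM.mspan_mono gen sl' alg_generators_subset
        order_trans[OF sl alg_generators_subset])
qed

text \<open>Reduces linear statements about the algebra to compact slices; the topology then enters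
  only through the calculus of slices.\<close>

lemma groupoid_algebra_induct [consumes 1, case_names zero slice add smult]:
  fixes a :: "'a \<Rightarrow> 'k::{comm_ring,comm_monoid_mult}"
  assumes "a \<in> carrier (groupoid_algebra G)"
    and "P (\<lambda>s. 0)" "\<And>U. compact_slice G U \<Longrightarrow> P (char_fun U)"
    and "\<And>a b. \<lbrakk>a \<in> carrier (groupoid_algebra G); b \<in> carrier (groupoid_algebra G); P a; P b\<rbrakk>
      \<Longrightarrow> P (\<lambda>s. a s + b s)"
    and "\<And>c a. \<lbrakk>a \<in> carrier (groupoid_algebra G); P a\<rbrakk> \<Longrightarrow> P (\<lambda>s. c * a s)"
  shows "P a"
proof -
  interpret FM: kmodule "fun_module (arrows G) :: ('k, 'a \<Rightarrow> 'k) module" by (rule kmodule_fun_module)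
  have sub: "(slice_funs :: ('a \<Rightarrow> 'k) set) \<subseteq> carrier (fun_module (arrows G))"
    using char_fun_in_generators alg_generators_subset by blast
  note A = groupoid_algebra_spanned[where 'k = 'k]
  have "a \<in> mspan (fun_module (arrows G)) slice_funs" using assms(1) by (simp add: A)
  then show ?thesis using sub
  proof (induction rule: FM.mspan_induct)
    case (add m n)
    then show ?case using assms(4)[of m n] by (simp add: A)
  next
    case (smult c m)
    then show ?case using assms(5)[of m c] by (simp add: A)
  qed (use assms(2,3) in auto)
qed

lemma groupoid_algebra_closed:
  fixes a b :: "'a \<Rightarrow> 'k::{comm_ring,comm_monoid_mult}"
  shows "(\<lambda>s. 0) \<in> carrier (groupoid_algebra G :: ('k, 'a \<Rightarrow> 'k) module)"
    "compact_slice G U \<Longrightarrow> (char_fun U :: 'a \<Rightarrow> 'k) \<in> carrier (groupoid_algebra G)"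
    "\<lbrakk>a \<in> carrier (groupoid_algebra G); b \<in> carrier (groupoid_algebra G)\<rbrakk>
      \<Longrightarrow> (\<lambda>s. a s + b s) \<in> carrier (groupoid_algebra G)"
    "a \<in> carrier (groupoid_algebra G) \<Longrightarrow> (\<lambda>s. c * a s) \<in> carrier (groupoid_algebra G)"
proof -
  interpret FM: kmodule "fun_module (arrows G) :: ('k, 'a \<Rightarrow> 'k) module" by (rule kmodule_fun_module)
  note E = FM.submodule_scalarsE[OF FM.mspan_submodule[OF alg_generators_subset]]
  show "(\<lambda>s. 0) \<in> carrier (groupoid_algebra G :: ('k, 'a \<Rightarrow> 'k) module)"
    using E(2) by (simp add: groupoid_algebra_simps(5))
  show "compact_slice G U \<Longrightarrow> (char_fun U :: 'a \<Rightarrow> 'k) \<in> carrier (groupoid_algebra G)"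
    using char_fun_in_generators FM.mspan_superset[of "alg_generators G"]
    by (auto simp: groupoid_algebra_simps(5))
  show "\<lbrakk>a \<in> carrier (groupoid_algebra G); b \<in> carrier (groupoid_algebra G)\<rbrakk>
      \<Longrightarrow> (\<lambda>s. a s + b s) \<in> carrier (groupoid_algebra G)"
    using E(3)[of a b] by (simp add: groupoid_algebra_simps(5))
  show "a \<in> carrier (groupoid_algebra G) \<Longrightarrow> (\<lambda>s. c * a s) \<in> carrier (groupoid_algebra G)"
    using E(4)[of a c] by (simp add: groupoid_algebra_simps(5))
qed

section \<open>Convolution in terms of slices\<close>

lemma groupoid_algebra_finite_fibre:
  fixes a :: "'a \<Rightarrow> 'k::{comm_ring,comm_monoid_mult}"
  assumes "a \<in> carrier (groupoid_algebra G)"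
  shows "finite {y \<in> L_fibre G x. a y \<noteq> 0}"
  using assms
proof (induction rule: groupoid_algebra_induct)
  case zero
  then show ?case by simp
next
  case (slice U)
  have "finite {y \<in> U. gdom G y = x}"
  proof (cases "{y \<in> U. gdom G y = x} = {}")
    case False
    then obtain y where "y \<in> U" "gdom G y = x" by auto
    then have "{y \<in> U. gdom G y = x} \<subseteq> {y}"
      using slice_dom_eq[OF compact_slice_slice[OF slice]] by auto
    then show ?thesis using finite_subset by blast
  qed (simp only: finite.emptyI)
  then show ?case
    by (rule rev_finite_subset) (auto simp: char_fun_def L_fibre_iff split: if_splits)
next
  case (add a b)
  then show ?case by (intro finite_subset[OF _ finite_UnI[OF add.IH]]) auto
next
  case (smult c a)
  then show ?case by (intro finite_subset[OF _ smult.IH]) auto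
qed

text \<open>The sum defining a convolution runs over the support of the right factor, which changes
  under addition. A common larger index set makes linearity in that factor visible.\<close>

lemma convolution_superset:
  fixes f g :: "'a \<Rightarrow> 'k::{comm_ring,comm_monoid_mult}"
  assumes "x \<in> arrows G" "finite F" "F \<subseteq> L_fibre G (gdom G x)" "{y \<in> L_fibre G (gdom G x). g y \<noteq> 0} \<subseteq> F"
  shows "convolution G f g x = (\<Sum>y\<in>F. f (x \<cdot> ginv G y) * g y)"
  unfolding convolution_def using assms
  by (auto intro!: sum.mono_neutral_left)

lemma convolution_left:
  fixes f f' g :: "'a \<Rightarrow> 'k::{comm_ring,comm_monoid_mult}"
  shows "convolution G (\<lambda>s. 0) g = (\<lambda>s. 0)"
    "convolution G (\<lambda>s. f s + f' s) g = (\<lambda>s. convolution G f g s + convolution G f' g s)"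
    "convolution G (\<lambda>s. c * f s) g = (\<lambda>s. c * convolution G f g s)"
  by (auto simp: convolution_def distrib_right sum.distrib sum_distrib_left mult.assoc)

lemma convolution_right:
  fixes f g g' :: "'a \<Rightarrow> 'k::{comm_ring,comm_monoid_mult}"
  assumes "g \<in> carrier (groupoid_algebra G)"
  shows "convolution G f (\<lambda>s. 0) = (\<lambda>s. 0)"
    "g' \<in> carrier (groupoid_algebra G) \<Longrightarrow>
      convolution G f (\<lambda>s. g s + g' s) = (\<lambda>s. convolution G f g s + convolution G f g' s)"
    "convolution G f (\<lambda>s. c * g s) = (\<lambda>s. c * convolution G f g s)"
proof -
  show "convolution G f (\<lambda>s. 0) = (\<lambda>s. 0)" by (auto simp: convolution_def)
  have supp: "finite {y \<in> L_fibre G x. h y \<noteq> 0}" "{y \<in> L_fibre G x. h y \<noteq> 0} \<subseteq> L_fibre G x"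
    if "h \<in> carrier (groupoid_algebra G)" for h :: "'a \<Rightarrow> 'k" and x
    using groupoid_algebra_finite_fibre[OF that] by auto
  show "convolution G f (\<lambda>s. c * g s) = (\<lambda>s. c * convolution G f g s)"
  proof
    fix x show "convolution G f (\<lambda>s. c * g s) x = c * convolution G f g x"
    proof (cases "x \<in> arrows G")
      case True
      have c: "{y \<in> L_fibre G (gdom G x). c * g y \<noteq> 0} \<subseteq> {y \<in> L_fibre G (gdom G x). g y \<noteq> 0}" by auto
      note sup = convolution_superset[OF True supp[OF assms]]
      show ?thesis unfolding sup[OF order_refl] sup[OF c]
        by (simp add: sum_distrib_left mult.left_commute)
    qed (simp add: convolution_def)
  qed
  assume g': "g' \<in> carrier (groupoid_algebra G)"
  show "convolution G f (\<lambda>s. g s + g' s) = (\<lambda>s. convolution G f g s + convolution G f g' s)"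
  proof
    fix x show "convolution G f (\<lambda>s. g s + g' s) x = convolution G f g x + convolution G f g' x"
    proof (cases "x \<in> arrows G")
      case True
      let ?F = "{y \<in> L_fibre G (gdom G x). g y \<noteq> 0} \<union> {y \<in> L_fibre G (gdom G x). g' y \<noteq> 0}"
      have F: "finite ?F" "?F \<subseteq> L_fibre G (gdom G x)" using supp[OF assms] supp[OF g'] by auto
      have d: "{y \<in> L_fibre G (gdom G x). g y + g' y \<noteq> 0} \<subseteq> ?F" by auto
      note sup = convolution_superset[OF True F]
      show ?thesis unfolding sup[OF d] sup[OF Un_upper1] sup[OF Un_upper2]
        by (simp add: distrib_left sum.distrib)
    qed (simp add: convolution_def)
  qed
qed

text \<open>The slice \<open>V\<close> has at most one arrow \<open>v\<close> with the domain of
  \<open>x\<close>, so the sum reduces to the value of the first factor at x v^{-1}. This arrow lies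
  in \<open>U\<close> exactly if \<open>x\<close> is a product of arrows of \<open>U\<close> and
  \<open>V\<close>.\<close>

lemma convolution_char_fun:
  assumes "slice G U" "slice G V"
  shows "convolution G (char_fun U) (char_fun V) =
    (char_fun (gprod G U V) :: 'a \<Rightarrow> 'k::{comm_ring,comm_monoid_mult})"
proof
  note sub = slice_arrow[OF assms(1)] slice_arrow[OF assms(2)]
  fix x
  show "convolution G (char_fun U) (char_fun V) x = (char_fun (gprod G U V) x :: 'k)"
  proof (cases "x \<in> arrows G \<and> (\<exists>v\<in>V. gdom G v = gdom G x)")
    case True
    then obtain v where v: "v \<in> V" "gdom G v = gdom G x" and x: "x \<in> arrows G" by auto
    have "convolution G (char_fun U) (char_fun V) x =
        (\<Sum>y\<in>{v}. char_fun U (x \<cdot> ginv G y) * (char_fun V y :: 'k))"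
      by (rule convolution_superset[OF x])
        (use v sub slice_dom_eq[OF assms(2)] in \<open>auto simp: L_fibre_iff char_fun_def split: if_splits\<close>)
    also have "\<dots> = char_fun U (x \<cdot> ginv G v)" using v by (simp add: char_fun_def)
    also have "x \<cdot> ginv G v \<in> U \<longleftrightarrow> x \<in> gprod G U V"
    proof
      assume "x \<cdot> ginv G v \<in> U"
      then have "(x \<cdot> ginv G v) \<cdot> v \<in> gprod G U V"
        using v x sub by (intro gprodI) auto
      then show "x \<in> gprod G U V" using v x sub by simp
    next
      assume "x \<in> gprod G U V"
      then obtain u w where "u \<in> U" "w \<in> V" "gdom G u = gran G w" "x = u \<cdot> w"
        by (auto simp: gprod_def)
      moreover from this have "w = v" using slice_dom_eq[OF assms(2)] v sub by simp
      ultimately show "x \<cdot> ginv G v \<in> U" using sub by simp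
    qed
    then have "(char_fun U (x \<cdot> ginv G v) :: 'k) = char_fun (gprod G U V) x"
      by (simp add: char_fun_def)
    finally show ?thesis .
  next
    case False
    then have "{y \<in> L_fibre G (gdom G x). (char_fun V y :: 'k) \<noteq> 0} = {}" if "x \<in> arrows G"
      using that by (auto simp: L_fibre_iff char_fun_def)
    then have "convolution G (char_fun U) (char_fun V) x = (0 :: 'k)"
      by (simp add: convolution_def)
    moreover have "x \<notin> gprod G U V"
      using False sub by (auto simp: gprod_def)
    ultimately show ?thesis by (simp add: char_fun_def)
  qed
qed

lemma convolution_closed:
  fixes f g :: "'a \<Rightarrow> 'k::{comm_ring,comm_monoid_mult}"
  assumes "f \<in> carrier (groupoid_algebra G)" "g \<in> carrier (groupoid_algebra G)"
  shows "convolution G f g \<in> carrier (groupoid_algebra G)"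
  using assms
proof (induction rule: groupoid_algebra_induct)
  case (slice U)
  from slice(2,1) show ?case
  proof (induction rule: groupoid_algebra_induct)
    case zero
    then show ?case
      by (simp only: convolution_right(1)[OF groupoid_algebra_closed(1)] groupoid_algebra_closed(1))
  next
    case (slice V)
    then show ?case
      by (simp add: convolution_char_fun compact_slice_slice groupoid_algebra_closed compact_slice_gprod)
  qed (simp_all add: convolution_right groupoid_algebra_closed)
qed (simp_all add: convolution_left groupoid_algebra_closed)

end


section \<open>The bimodule of the fibre\<close>

text \<open>A finite rectangle replaces the set of pairs with product \<open>z\<close>: in this form
  the sums for different factors run over the same index set and can be added.\<close>

lemma bilinear_mul_superset:
  fixes u a :: "'g \<Rightarrow> 'k::{comm_ring,comm_monoid_mult}"
  assumes "finite S" "finite T" "{s. u s \<noteq> 0} \<subseteq> S" "{t. a t \<noteq> 0} \<subseteq> T"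
  shows "bilinear_mul G u a z = (\<Sum>s\<in>S. \<Sum>t\<in>T. if gmul G s t = z then u s * a t else 0)"
proof -
  have "bilinear_mul G u a z = (\<Sum>(s, t)\<in>S \<times> T. if gmul G s t = z then u s * a t else 0)"
    unfolding bilinear_mul_def
    by (rule sum.mono_neutral_cong_left) (use assms in \<open>auto simp: subset_iff split: if_splits\<close>)
  then show ?thesis by (simp add: sum.cartesian_product)
qed

lemma bilinear_mul_left:
  fixes u v a :: "'g \<Rightarrow> 'k::{comm_ring,comm_monoid_mult}"
  assumes "finite {s. a s \<noteq> 0}"
  shows "bilinear_mul G (\<lambda>s. 0) a = (\<lambda>s. 0)"
    "\<lbrakk>finite {s. u s \<noteq> 0}; finite {s. v s \<noteq> 0}\<rbrakk> \<Longrightarrow>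
      bilinear_mul G (\<lambda>s. u s + v s) a = (\<lambda>s. bilinear_mul G u a s + bilinear_mul G v a s)"
    "finite {s. u s \<noteq> 0} \<Longrightarrow> bilinear_mul G (\<lambda>s. c * u s) a = (\<lambda>s. c * bilinear_mul G u a s)"
proof -
  note sup = bilinear_mul_superset[OF _ assms _ order_refl]
  show "bilinear_mul G (\<lambda>s. 0) a = (\<lambda>s. 0)" by (simp add: bilinear_mul_def)
  assume u: "finite {s. u s \<noteq> 0}"
  have c: "{s. c * u s \<noteq> 0} \<subseteq> {s. u s \<noteq> 0}" by auto
  show "bilinear_mul G (\<lambda>s. c * u s) a = (\<lambda>s. c * bilinear_mul G u a s)"
    by (rule ext) (auto simp: sup[OF u order_refl] sup[OF u c] sum_distrib_left mult.assoc intro!: sum.cong)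
  assume "finite {s. v s \<noteq> 0}"
  with u have S: "finite ({s. u s \<noteq> 0} \<union> {s. v s \<noteq> 0})" by simp
  have d: "{s. u s + v s \<noteq> 0} \<subseteq> {s. u s \<noteq> 0} \<union> {s. v s \<noteq> 0}" by auto
  show "bilinear_mul G (\<lambda>s. u s + v s) a = (\<lambda>s. bilinear_mul G u a s + bilinear_mul G v a s)"
    by (rule ext) (auto simp: sup[OF S d] sup[OF S Un_upper1] sup[OF S Un_upper2] sum.distrib[symmetric] distrib_right intro!: sum.cong)
qed

lemma bilinear_mul_right:
  fixes u a b :: "'g \<Rightarrow> 'k::{comm_ring,comm_monoid_mult}"
  assumes "finite {s. u s \<noteq> 0}"
  shows "bilinear_mul G u (\<lambda>s. 0) = (\<lambda>s. 0)"
    "\<lbrakk>finite {s. a s \<noteq> 0}; finite {s. b s \<noteq> 0}\<rbrakk> \<Longrightarrow>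
      bilinear_mul G u (\<lambda>s. a s + b s) = (\<lambda>s. bilinear_mul G u a s + bilinear_mul G u b s)"
    "finite {s. a s \<noteq> 0} \<Longrightarrow> bilinear_mul G u (\<lambda>s. c * a s) = (\<lambda>s. c * bilinear_mul G u a s)"
proof -
  note sup = bilinear_mul_superset[OF assms _ order_refl]
  show "bilinear_mul G u (\<lambda>s. 0) = (\<lambda>s. 0)" by (simp add: bilinear_mul_def)
  assume a: "finite {s. a s \<noteq> 0}"
  have c: "{s. c * a s \<noteq> 0} \<subseteq> {s. a s \<noteq> 0}" by auto
  show "bilinear_mul G u (\<lambda>s. c * a s) = (\<lambda>s. c * bilinear_mul G u a s)"
    by (rule ext) (auto simp: sup[OF a order_refl] sup[OF a c] sum_distrib_left mult.left_commute intro!: sum.cong)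
  assume "finite {s. b s \<noteq> 0}"
  with a have S: "finite ({s. a s \<noteq> 0} \<union> {s. b s \<noteq> 0})" by simp
  have d: "{s. a s + b s \<noteq> 0} \<subseteq> {s. a s \<noteq> 0} \<union> {s. b s \<noteq> 0}" by auto
  show "bilinear_mul G u (\<lambda>s. a s + b s) = (\<lambda>s. bilinear_mul G u a s + bilinear_mul G u b s)"
    by (rule ext) (auto simp: sup[OF S d] sup[OF S Un_upper1] sup[OF S Un_upper2] sum.distrib[symmetric] distrib_left intro!: sum.cong)
qed

lemma bilinear_mul_delta:
  "bilinear_mul G (delta s) (delta t) = (delta (gmul G s t) :: 'g \<Rightarrow> 'k::{comm_ring,comm_monoid_mult})"
proof
  fix z
  show "bilinear_mul G (delta s) (delta t) z = (delta (gmul G s t) z :: 'k)"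
    by (subst bilinear_mul_superset[where S = "{s}" and T = "{t}"]) (auto simp: delta_def)
qed

lemma L_act_left:
  fixes f f' u :: "'g \<Rightarrow> 'k::{comm_ring,comm_monoid_mult}"
  shows "L_act G x (\<lambda>s. 0) u = (\<lambda>s. 0)"
    "L_act G x (\<lambda>s. f s + f' s) u = (\<lambda>s. L_act G x f u s + L_act G x f' u s)"
    "L_act G x (\<lambda>s. c * f s) u = (\<lambda>s. c * L_act G x f u s)"
  by (auto simp: L_act_def distrib_right sum.distrib sum_distrib_left mult.assoc)

lemma L_act_superset:
  fixes f u :: "'g \<Rightarrow> 'k::{comm_ring,comm_monoid_mult}"
  assumes "finite F" "{t. u t \<noteq> 0} \<subseteq> F"
  shows "L_act G x f u y = (if y \<in> L_fibre G x then \<Sum>t\<in>F. f (gmul G y (ginv G t)) * u t else 0)"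
  unfolding L_act_def using assms by (auto intro!: sum.mono_neutral_left)

lemma L_act_right:
  fixes f u v :: "'g \<Rightarrow> 'k::{comm_ring,comm_monoid_mult}"
  shows "L_act G x f (\<lambda>s. 0) = (\<lambda>s. 0)"
    "\<lbrakk>finite {s. u s \<noteq> 0}; finite {s. v s \<noteq> 0}\<rbrakk> \<Longrightarrow>
      L_act G x f (\<lambda>s. u s + v s) = (\<lambda>s. L_act G x f u s + L_act G x f v s)"
    "finite {s. u s \<noteq> 0} \<Longrightarrow> L_act G x f (\<lambda>s. c * u s) = (\<lambda>s. c * L_act G x f u s)"
proof -
  show "L_act G x f (\<lambda>s. 0) = (\<lambda>s. 0)" by (auto simp: L_act_def)
  assume u: "finite {s. u s \<noteq> 0}"
  show "L_act G x f (\<lambda>s. c * u s) = (\<lambda>s. c * L_act G x f u s)"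
  proof
    fix y
    have "L_act G x f (\<lambda>s. c * u s) y =
        (if y \<in> L_fibre G x then \<Sum>t\<in>{s. u s \<noteq> 0}. f (gmul G y (ginv G t)) * (c * u t) else 0)"
      by (rule L_act_superset) (use u in auto)
    also have "\<dots> = c * L_act G x f u y"
      by (simp add: L_act_def sum_distrib_left mult.left_commute)
    finally show "L_act G x f (\<lambda>s. c * u s) y = c * L_act G x f u y" .
  qed
  assume v: "finite {s. v s \<noteq> 0}"
  show "L_act G x f (\<lambda>s. u s + v s) = (\<lambda>s. L_act G x f u s + L_act G x f v s)"
  proof
    fix y
    let ?F = "{s. u s \<noteq> 0} \<union> {s. v s \<noteq> 0}"
    have sub: "{t. u t + v t \<noteq> 0} \<subseteq> ?F" by auto
    show "L_act G x f (\<lambda>s. u s + v s) y = L_act G x f u y + L_act G x f v y"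
      using u v sub L_act_superset[of ?F "\<lambda>s. u s + v s" G x f y] L_act_superset[of ?F u G x f y]
        L_act_superset[of ?F v G x f y]
      by (cases "y \<in> L_fibre G x") (auto simp: distrib_left sum.distrib)
  qed
qed

context ample_groupoid
begin

text \<open>The coefficient at \<open>y\<close> asks whether y t^{-1} lies in \<open>U\<close>. This
  arrow starts at r(t), and \<open>u\<close> is the only arrow of \<open>U\<close> that starts
  there.\<close>

lemma L_act_char_fun:
  assumes "slice G U" "t \<in> L_fibre G x" "u \<in> U" "gdom G u = gran G t"
  shows "L_act G x (char_fun U) (delta t) = (delta (u \<cdot> t) :: 'a \<Rightarrow> 'k::{comm_ring,comm_monoid_mult})"
proof
  fix y
  have t: "t \<in> arrows G" "gdom G t = x" using assms(2) by (auto simp: L_fibre_iff)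
  have u: "u \<in> arrows G" using slice_arrow[OF assms(1,3)] .
  have *: "L_act G x (char_fun U) (delta t) y =
      (if y \<in> L_fibre G x then char_fun U (y \<cdot> ginv G t) else (0 :: 'k))"
    by (subst L_act_superset[where F = "{t}"]) (auto simp: delta_def)
  have "y \<cdot> ginv G t \<in> U \<longleftrightarrow> y = u \<cdot> t" if y: "y \<in> L_fibre G x"
  proof
    assume yt: "y \<cdot> ginv G t \<in> U"
    have "y \<cdot> ginv G t = u"
      by (rule slice_dom_eq[OF assms(1) yt assms(3)]) (use y t assms(4) in \<open>auto simp: L_fibre_iff\<close>)
    moreover have "(y \<cdot> ginv G t) \<cdot> t = y" using y t by (simp add: L_fibre_iff)
    ultimately show "y = u \<cdot> t" by simp
  next
    assume "y = u \<cdot> t"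
    then show "y \<cdot> ginv G t \<in> U" using u t assms by simp
  qed
  moreover have "u \<cdot> t \<in> L_fibre G x" using u t assms by (simp add: L_fibre_iff)
  ultimately show "L_act G x (char_fun U) (delta t) y = (delta (u \<cdot> t) y :: 'k)"
    unfolding * by (auto simp: char_fun_def delta_def)
qed

lemma L_act_char_fun_0:
  assumes "slice G U" "t \<in> L_fibre G x" "gran G t \<notin> gdom G ` U"
  shows "L_act G x (char_fun U) (delta t) = ((\<lambda>s. 0) :: 'a \<Rightarrow> 'k::{comm_ring,comm_monoid_mult})"
proof
  fix y
  have t: "t \<in> arrows G" "gdom G t = x" using assms(2) by (auto simp: L_fibre_iff)
  have *: "L_act G x (char_fun U) (delta t) y =
      (if y \<in> L_fibre G x then char_fun U (y \<cdot> ginv G t) else (0 :: 'k))"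
    by (subst L_act_superset[where F = "{t}"]) (auto simp: delta_def)
  have "y \<cdot> ginv G t \<notin> U" if "y \<in> L_fibre G x"
  proof
    assume "y \<cdot> ginv G t \<in> U"
    then have "gdom G (y \<cdot> ginv G t) \<in> gdom G ` U" by (rule imageI)
    then show False using assms(3) that t by (simp add: L_fibre_iff)
  qed
  then show "L_act G x (char_fun U) (delta t) y = (0 :: 'k)"
    unfolding * by (simp add: char_fun_def)
qed

text \<open>A slice is a partial injection of the fibre: it moves a basis element to a basis element
  or kills it. The computations with the bimodule rest on this dichotomy.\<close>

lemma L_act_char_fun_cases:
  assumes "slice G U" "t \<in> L_fibre G x"
  obtains u where "u \<in> U" "gdom G u = gran G t" "u \<cdot> t \<in> L_fibre G x"
    "L_act G x (char_fun U) (delta t) = (delta (u \<cdot> t) :: 'a \<Rightarrow> 'k::{comm_ring,comm_monoid_mult})"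
  | "gran G t \<notin> gdom G ` U"
    "L_act G x (char_fun U) (delta t) = ((\<lambda>s. 0) :: 'a \<Rightarrow> 'k::{comm_ring,comm_monoid_mult})"
proof (cases "gran G t \<in> gdom G ` U")
  case True
  then obtain u where u: "u \<in> U" "gdom G u = gran G t" by force
  then have "u \<cdot> t \<in> L_fibre G x"
    using assms(2) slice_arrow[OF assms(1)] by (simp add: L_fibre_iff)
  then show ?thesis using that(1)[OF u _ L_act_char_fun[OF assms u]] by blast
next
  case False
  then show ?thesis using that(2) L_act_char_fun_0[OF assms] by blast
qed

lemma L_act_closed:
  fixes f u :: "'a \<Rightarrow> 'k::{comm_ring,comm_monoid_mult}"
  assumes "f \<in> carrier (groupoid_algebra G)" "u \<in> carrier (free_module (L_fibre G x))"
  shows "L_act G x f u \<in> carrier (free_module (L_fibre G x))"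
  using assms
proof (induction rule: groupoid_algebra_induct)
  case (slice U)
  from slice(2,1) show ?case
  proof (induction rule: free_module_induct)
    case (delta t)
    show ?case
      by (rule L_act_char_fun_cases[OF compact_slice_slice[OF delta(2)] delta(1), where 'k = 'k])
        (simp_all only: delta_in_free_module, simp)
  qed (auto simp: L_act_right finite_support_add finite_support_mult)
qed (auto simp: L_act_left finite_support_add finite_support_mult)

text \<open>Linearity in all three arguments leaves two slices and one basis element. The claim is
  then associativity of arrows, together with the fact that both sides vanish for the same
  \<open>t\<close>.\<close>

lemma L_act_convolution:
  fixes f g u :: "'a \<Rightarrow> 'k::{comm_ring,comm_monoid_mult}"
  assumes "f \<in> carrier (groupoid_algebra G)" "g \<in> carrier (groupoid_algebra G)"
    "u \<in> carrier (free_module (L_fibre G x))"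
  shows "L_act G x (convolution G f g) u = L_act G x f (L_act G x g u)"
proof -
  have fin: "finite {s. L_act G x g u s \<noteq> 0}"
    if "g \<in> carrier (groupoid_algebra G)" "u \<in> carrier (free_module (L_fibre G x))"
    for g u :: "'a \<Rightarrow> 'k"
    using L_act_closed[OF that] by simp
  show ?thesis using assms
  proof (induction arbitrary: g u rule: groupoid_algebra_induct)
    case (slice U)
    note U = slice(1)
    from slice(2,3) show ?case
    proof (induction arbitrary: u rule: groupoid_algebra_induct)
      case zero
      then show ?case
        by (simp only: convolution_right(1)[OF groupoid_algebra_closed(1)] L_act_left(1) L_act_right(1))
    next
      case (slice V)
      note V = slice(1)
      from slice(2) show ?case
      proof (induction rule: free_module_induct)
        case (delta t)
        note t = delta
        then have ta: "t \<in> arrows G" "gdom G t = x" by (auto simp: L_fibre_iff)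
        have UV: "slice G (gprod G U V)"
          using slice_gprod U V compact_slice_slice by blast
        note sub = slice_arrow[OF compact_slice_slice[OF U]] slice_arrow[OF compact_slice_slice[OF V]]
        show ?case unfolding convolution_char_fun[OF compact_slice_slice[OF U] compact_slice_slice[OF V]]
        proof (rule L_act_char_fun_cases[OF compact_slice_slice[OF V] t, where 'k = 'k])
          fix v assume v: "v \<in> V" "gdom G v = gran G t" "v \<cdot> t \<in> L_fibre G x"
            and eq: "L_act G x (char_fun V) (delta t) = (delta (v \<cdot> t) :: 'a \<Rightarrow> 'k)"
          show "L_act G x (char_fun (gprod G U V)) (delta t) =
              (L_act G x (char_fun U) (L_act G x (char_fun V) (delta t)) :: 'a \<Rightarrow> 'k)"
            unfolding eq
          proof (rule L_act_char_fun_cases[OF compact_slice_slice[OF U] v(3), where 'k = 'k])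
            fix u assume u: "u \<in> U" "gdom G u = gran G (v \<cdot> t)" 
              and eq: "L_act G x (char_fun U) (delta (v \<cdot> t)) = (delta (u \<cdot> (v \<cdot> t)) :: 'a \<Rightarrow> 'k)"
            have "gdom G u = gran G v" using u v ta sub by simp
            then have uv: "u \<cdot> v \<in> gprod G U V" using u v by (intro gprodI)
            have "L_act G x (char_fun (gprod G U V)) (delta t) = (delta ((u \<cdot> v) \<cdot> t) :: 'a \<Rightarrow> 'k)"
              by (rule L_act_char_fun[OF UV t uv]) (use \<open>gdom G u = gran G v\<close> u v ta sub in simp)
            then show "L_act G x (char_fun (gprod G U V)) (delta t) =
                (L_act G x (char_fun U) (delta (v \<cdot> t)) :: 'a \<Rightarrow> 'k)"
              unfolding eq using u v ta sub \<open>gdom G u = gran G v\<close> by (simp add: mul_assoc)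
          next
            assume nu: "gran G (v \<cdot> t) \<notin> gdom G ` U"
              and eq: "L_act G x (char_fun U) (delta (v \<cdot> t)) = ((\<lambda>s. 0) :: 'a \<Rightarrow> 'k)"
            \<comment> \<open>An arrow of the product starting at r(t) has its factor from
              \<open>V\<close> over r(t). That factor must be \<open>v\<close>, so its other factor
              would be an arrow of \<open>U\<close> starting at r(v), where \<open>U\<close> has
              none.\<close>
            have "gran G t \<notin> gdom G ` gprod G U V"
            proof
              assume "gran G t \<in> gdom G ` gprod G U V"
              then obtain u' v' where *: "u' \<in> U" "v' \<in> V" "gdom G u' = gran G v'" "gran G t = gdom G (u' \<cdot> v')"
                by (auto simp: gprod_def)
              then have "v' = v"
                using slice_dom_eq[OF compact_slice_slice[OF V]] v sub by simp
              then have "gran G (v \<cdot> t) = gdom G u'" using * v ta sub by simp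
              then show False using nu *(1) by blast
            qed
            then show "L_act G x (char_fun (gprod G U V)) (delta t) =
                (L_act G x (char_fun U) (delta (v \<cdot> t)) :: 'a \<Rightarrow> 'k)"
              unfolding eq by (rule L_act_char_fun_0[OF UV t])
          qed
        next
          assume nv: "gran G t \<notin> gdom G ` V"
            and eq: "L_act G x (char_fun V) (delta t) = ((\<lambda>s. 0) :: 'a \<Rightarrow> 'k)"
          have "gran G t \<notin> gdom G ` gprod G U V"
            using nv sub by (auto simp: gprod_def)
          then show "L_act G x (char_fun (gprod G U V)) (delta t) =
              (L_act G x (char_fun U) (L_act G x (char_fun V) (delta t)) :: 'a \<Rightarrow> 'k)"
            unfolding eq L_act_right(1) by (rule L_act_char_fun_0[OF UV t])
        qed
      next
        case zero
        then show ?case by (simp add: L_act_right)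
      next
        case (add u v)
        then show ?case using fin[OF groupoid_algebra_closed(2)[OF V]]
          by (simp add: L_act_right)
      next
        case (smult c u)
        then show ?case using fin[OF groupoid_algebra_closed(2)[OF V]]
          by (simp add: L_act_right)
      qed
    next
      case (add a b)
      then show ?case using fin[OF add(1,5)] fin[OF add(2,5)]
        by (simp add: convolution_right L_act_left L_act_right)
    next
      case (smult c a)
      then show ?case using fin[OF smult(1,3)]
        by (simp add: convolution_right L_act_left L_act_right)
    qed
  qed (simp_all add: convolution_left L_act_left)
qed

lemma bilinear_mul_closed:
  fixes u a :: "'a \<Rightarrow> 'k::{comm_ring,comm_monoid_mult}"
  assumes "u \<in> carrier (free_module (L_fibre G x))" "a \<in> carrier (free_module (isotropy G x))"
  shows "bilinear_mul G u a \<in> carrier (free_module (L_fibre G x))"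
  using assms
proof (induction rule: free_module_induct)
  case (delta s)
  from delta(2,1) show ?case
  proof (induction rule: free_module_induct)
    case (delta t)
    then have "s \<cdot> t \<in> L_fibre G x" by (simp add: L_fibre_iff isotropy_iff)
    then show ?case unfolding bilinear_mul_delta by (rule delta_in_free_module)
  qed (auto simp: bilinear_mul_right finite_support_add finite_support_mult)
qed (auto simp: bilinear_mul_left finite_support_add finite_support_mult)

text \<open>The two actions commute: on basis elements this is associativity, and right
  multiplication by an isotropy element does not change the range of \<open>t\<close>, so a slice
  kills both sides or neither.\<close>

lemma L_act_bilinear_mul:
  fixes f u a :: "'a \<Rightarrow> 'k::{comm_ring,comm_monoid_mult}"
  assumes "f \<in> carrier (groupoid_algebra G)" "u \<in> carrier (free_module (L_fibre G x))"
    "a \<in> carrier (free_module (isotropy G x))"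
  shows "L_act G x f (bilinear_mul G u a) = bilinear_mul G (L_act G x f u) a"
proof -
  have fin: "finite {s. L_act G x g u s \<noteq> 0}"
    if "g \<in> carrier (groupoid_algebra G)" "u \<in> carrier (free_module (L_fibre G x))"
    for g u :: "'a \<Rightarrow> 'k"
    using L_act_closed[OF that] by simp
  have finb: "finite {s. bilinear_mul G u a s \<noteq> 0}"
    if "u \<in> carrier (free_module (L_fibre G x))" "a \<in> carrier (free_module (isotropy G x))"
    for u a :: "'a \<Rightarrow> 'k"
    using bilinear_mul_closed[OF that] by simp
  show ?thesis using assms
  proof (induction arbitrary: u a rule: groupoid_algebra_induct)
    case (slice U)
    note U = slice(1)
    from slice(2,3) show ?case
    proof (induction arbitrary: a rule: free_module_induct)
      case (delta t)
      note t = delta(1)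
      from delta(2) show ?case
      proof (induction rule: free_module_induct)
        case (delta g)
        note sub = slice_arrow[OF compact_slice_slice[OF U]]
        have tg: "t \<in> arrows G" "gdom G t = x" "g \<in> arrows G" "gdom G g = x" "gran G g = x"
          using t delta by (auto simp: L_fibre_iff isotropy_iff)
        then have tgL: "t \<cdot> g \<in> L_fibre G x" by (simp add: L_fibre_iff)
        show ?case
        proof (rule L_act_char_fun_cases[OF compact_slice_slice[OF U] t, where 'k = 'k])
          fix u assume u: "u \<in> U" "gdom G u = gran G t"
            and eq: "L_act G x (char_fun U) (delta t) = (delta (u \<cdot> t) :: 'a \<Rightarrow> 'k)"
          have "L_act G x (char_fun U) (delta (t \<cdot> g)) = (delta (u \<cdot> (t \<cdot> g)) :: 'a \<Rightarrow> 'k)"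
            by (rule L_act_char_fun[OF compact_slice_slice[OF U] tgL u(1)]) (use u tg in simp)
          then show ?thesis
            unfolding eq bilinear_mul_delta using u tg sub by (simp add: mul_assoc)
        next
          assume nu: "gran G t \<notin> gdom G ` U"
            and eq: "L_act G x (char_fun U) (delta t) = ((\<lambda>s. 0) :: 'a \<Rightarrow> 'k)"
          have "L_act G x (char_fun U) (delta (t \<cdot> g)) = ((\<lambda>s. 0) :: 'a \<Rightarrow> 'k)"
            by (rule L_act_char_fun_0[OF compact_slice_slice[OF U] tgL]) (use nu tg in simp)
          then show ?thesis
            unfolding eq bilinear_mul_delta by (simp add: bilinear_mul_left)
        qed
      next
        case zero
        then show ?case using fin[OF groupoid_algebra_closed(2)[OF U] delta_in_free_module[OF t]]
          by (simp add: bilinear_mul_right L_act_right)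
      next
        case (add a b)
        then show ?case using fin[OF groupoid_algebra_closed(2)[OF U] delta_in_free_module[OF t]]
          finb[OF delta_in_free_module[OF t]]
          by (simp add: bilinear_mul_right L_act_right)
      next
        case (smult c a)
        then show ?case using fin[OF groupoid_algebra_closed(2)[OF U] delta_in_free_module[OF t]]
          finb[OF delta_in_free_module[OF t]]
          by (simp add: bilinear_mul_right L_act_right)
      qed
    next
      case zero
      then show ?case by (simp add: bilinear_mul_left L_act_right)
    next
      case (add u v)
      then show ?case
        using fin[OF groupoid_algebra_closed(2)[OF U] add(1)] fin[OF groupoid_algebra_closed(2)[OF U] add(2)]
          finb[OF add(1,5)] finb[OF add(2,5)]
        by (simp add: bilinear_mul_left L_act_right)
    next
      case (smult c u)
      then show ?case
        using fin[OF groupoid_algebra_closed(2)[OF U] smult(1)] finb[OF smult(1,3)]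
        by (simp add: bilinear_mul_left L_act_right)
    qed
  next
    case zero
    then show ?case by (simp add: L_act_left bilinear_mul_left)
  next
    case (add f g)
    then show ?case using fin[OF add(1,5)] fin[OF add(2,5)]
      by (simp add: L_act_left bilinear_mul_left)
  next
    case (smult c f)
    then show ?case using fin[OF smult(1,3)]
      by (simp add: L_act_left bilinear_mul_left)
  qed
qed

end

section \<open>Non-degenerate modules over the groupoid algebra\<close>

context ample_groupoid
begin

lemma gprod_units:
  assumes "U \<subseteq> units G" "V \<subseteq> units G"
  shows "gprod G U V = U \<inter> V"
proof
  show "gprod G U V \<subseteq> U \<inter> V"
    using assms by (auto simp: gprod_def subset_iff)
  show "U \<inter> V \<subseteq> gprod G U V"
  proof
    fix x assume x: "x \<in> U \<inter> V"
    then have "x \<cdot> x \<in> gprod G U V" using assms by (intro gprodI) (auto simp: subset_iff)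
    then show "x \<in> gprod G U V" using x assms by (auto simp: subset_iff)
  qed
qed

lemma gprod_ran:
  assumes "slice G U"
  shows "gprod G (gran G ` U) U = U"
proof
  note sub = slice_arrow[OF assms]
  show "gprod G (gran G ` U) U \<subseteq> U" using sub by (auto simp: gprod_def)
  show "U \<subseteq> gprod G (gran G ` U) U"
  proof
    fix u assume u: "u \<in> U"
    then have "gran G u \<cdot> u \<in> gprod G (gran G ` U) U" using sub by (intro gprodI) auto
    then show "u \<in> gprod G (gran G ` U) U" using u sub by simp
  qed
qed

lemma gprod_inv:
  assumes "slice G U"
  shows "gprod G (ginv G ` U) U = gdom G ` U"
proof
  note sub = slice_arrow[OF assms]
  show "gprod G (ginv G ` U) U \<subseteq> gdom G ` U"
  proof
    fix y assume "y \<in> gprod G (ginv G ` U) U"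
    then obtain u w where uw: "u \<in> U" "w \<in> U" "gdom G (ginv G u) = gran G w" "y = ginv G u \<cdot> w"
      by (auto simp: gprod_def)
    then have "u = w" using slice_ran_eq[OF assms] sub by simp
    then show "y \<in> gdom G ` U" using uw by simp
  qed
  show "gdom G ` U \<subseteq> gprod G (ginv G ` U) U"
  proof
    fix y assume "y \<in> gdom G ` U"
    then obtain u where u: "u \<in> U" "y = gdom G u" by auto
    then have "ginv G u \<cdot> u \<in> gprod G (ginv G ` U) U" using sub by (intro gprodI) auto
    then show "y \<in> gprod G (ginv G ` U) U" using u by simp
  qed
qed

text \<open>Multiplication by d(V) on the right keeps just those arrows of \<open>U\<close> that
  start in d(V), and on \<open>U\<close> an arrow is determined by where it starts.\<close>

lemma gprod_subset_dom:
  assumes "slice G U" "V \<subseteq> U"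
  shows "gprod G U (gdom G ` V) = V"
proof
  note sub = slice_arrow[OF assms(1)]
  show "gprod G U (gdom G ` V) \<subseteq> V"
  proof
    fix y assume "y \<in> gprod G U (gdom G ` V)"
    then obtain u v where uv: "u \<in> U" "v \<in> V" "gdom G u = gran G (gdom G v)" "y = u \<cdot> gdom G v"
      by (auto simp: gprod_def)
    then have "u = v" using slice_dom_eq[OF assms(1), of u v] sub assms(2) by auto
    then show "y \<in> V" using uv sub by simp
  qed
  show "V \<subseteq> gprod G U (gdom G ` V)"
  proof
    fix v assume v: "v \<in> V"
    then have "v \<cdot> gdom G v \<in> gprod G U (gdom G ` V)" using sub assms(2) by (intro gprodI) auto
    then show "v \<in> gprod G U (gdom G ` V)" using v sub assms(2) by auto
  qed
qed

lemma compact_units_slice: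
  assumes "openin (gtop G) W" "z \<in> W" "z \<in> units G"
  obtains U where "compact_slice G U" "z \<in> U" "U \<subseteq> W" "U \<subseteq> units G"
proof -
  have "openin (gtop G) (W \<inter> units G)" using assms(1) open_units by blast
  then obtain U where "compact_slice G U" "z \<in> U" "U \<subseteq> W \<inter> units G"
    by (rule compact_slice_nbhd[where g = z]) (use assms in auto)
  then show ?thesis using that by auto
qed

end

section \<open>Slices acting on a module, and local units\<close>

locale groupoid_module = ample_groupoid G + alg_mod "groupoid_algebra G" M
  for G :: "'g top_groupoid" and M :: "('k::{comm_ring,comm_monoid_mult}, 'g \<Rightarrow> 'k, 'm) alg_module" (structure)
begin

abbreviation slice_act ("\<chi>") where "slice_act U \<equiv> act M (char_fun U)"

lemma slice_act_closed [simp, intro]: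
  "\<lbrakk>compact_slice G U; m \<in> carrier M\<rbrakk> \<Longrightarrow> \<chi> U m \<in> carrier M"
  by (intro act_closed groupoid_algebra_closed)

lemma linear_map_act: "a \<in> carrier (groupoid_algebra G) \<Longrightarrow> linear_map M M (act M a)"
  by (simp add: linear_map_def act_closed act_add_right act_smult_right)

lemma act_zero: "a \<in> carrier (groupoid_algebra G) \<Longrightarrow> act M a \<zero> = \<zero>"
  using linear_map_zero[OF linear_map_act kmodule_axioms kmodule_axioms] .

lemmas slice_act_simps =
  act_add_right[OF groupoid_algebra_closed(2)] act_smult_right[OF groupoid_algebra_closed(2)]
  act_zero[OF groupoid_algebra_closed(2)]

lemma slice_act_mult:
  assumes "compact_slice G U" "compact_slice G V" "m \<in> carrier M"
  shows "\<chi> U (\<chi> V m) = \<chi> (gprod G U V) m"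
  using act_mult[OF groupoid_algebra_closed(2)[OF assms(1)] groupoid_algebra_closed(2)[OF assms(2)] assms(3)]
    assms by (simp add: convolution_char_fun compact_slice_slice)

lemma act_simps:
  assumes "m \<in> carrier M"
  shows "act M (\<lambda>s. 0) m = \<zero>"
    "\<lbrakk>a \<in> carrier (groupoid_algebra G); b \<in> carrier (groupoid_algebra G)\<rbrakk> \<Longrightarrow>
      act M (\<lambda>s. a s + b s) m = act M a m \<oplus> act M b m"
    "a \<in> carrier (groupoid_algebra G) \<Longrightarrow> act M (\<lambda>s. c * a s) m = c \<odot> act M a m"
  using act_smult_left[of "\<lambda>s. 0" m 0] act_add_left[of a b m] act_smult_left[of a m c] assms
    groupoid_algebra_closed(1) act_closed
  by simp_all

lemma alg_submoduleI:
  assumes "submodule N (scalars :: 'k ring) M"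
    and "\<And>U n. \<lbrakk>compact_slice G U; n \<in> N\<rbrakk> \<Longrightarrow> \<chi> U n \<in> N"
  shows "alg_submodule (groupoid_algebra G) M N"
proof -
  note E = submodule_scalarsE[OF assms(1)]
  have "act M a n \<in> N" if "a \<in> carrier (groupoid_algebra G)" and n: "n \<in> N" for a n
    using that(1)
  proof (induction rule: groupoid_algebra_induct)
    case (slice U)
    then show ?case using assms(2) n by blast
  qed (use E n act_simps[of n] in auto)
  then show ?thesis using assms(1) by (simp add: alg_submodule_def)
qed

lemma slice_act_units_subset:
  assumes "compact_slice G W" "compact_slice G W'" "W \<subseteq> W'" "W' \<subseteq> units G" "m \<in> carrier M"
  shows "\<chi> W' (\<chi> W m) = \<chi> W m" "\<chi> W (\<chi> W' m) = \<chi> W m"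
  using assms by (simp_all add: slice_act_mult gprod_units Int_absorb1 Int_absorb2)

lemma slice_act_ran:
  assumes "compact_slice G U" "m \<in> carrier M"
  shows "\<chi> (gran G ` U) (\<chi> U m) = \<chi> U m"
  using assms by (simp add: slice_act_mult compact_slice_ran gprod_ran compact_slice_slice)

text \<open>The inverse slice undoes the action of \<open>U\<close> up to the characteristic
  function of d(U). Annihilation by a slice thereby becomes annihilation by a set of units, and such
  sets can be made disjoint.\<close>

lemma slice_act_dom:
  assumes "compact_slice G U" "m \<in> carrier M" "\<chi> U m = \<zero>"
  shows "\<chi> (gdom G ` U) m = \<zero>"
proof -
  have "\<chi> (ginv G ` U) (\<chi> U m) = \<chi> (gdom G ` U) m"
    using assms(1,2) by (subst slice_act_mult) (auto simp: compact_slice_inv gprod_inv compact_slice_slice)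
  then show ?thesis
    using assms by (simp add: act_zero groupoid_algebra_closed compact_slice_inv)
qed

text \<open>The algebra may lack a unit. By non-degeneracy \<open>m\<close> is a combination of
  products; a product with a slice \<open>U\<close> is fixed by the characteristic function of r(U),
  and the union of two compact open sets of units serves for a sum.\<close>

lemma local_unit:
  assumes "m \<in> carrier M"
  shows "\<exists>W. compact_slice G W \<and> W \<subseteq> units G \<and> \<chi> W m = m"
proof -
  define P where "P m \<longleftrightarrow> m \<in> carrier M \<and> (\<exists>W. compact_slice G W \<and> W \<subseteq> units G \<and> \<chi> W m = m)" for m
  have P0: "P \<zero>"
    unfolding P_def
    by (auto intro!: exI[of _ "{}"] simp: compact_slice_empty act_zero groupoid_algebra_closed)
  have P_add: "P (m \<oplus> n)" if Pm: "P m" and Pn: "P n" for m n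
  proof -
    obtain W where W: "m \<in> carrier M" "compact_slice G W" "W \<subseteq> units G" "\<chi> W m = m"
      using Pm unfolding P_def by blast
    obtain W' where W': "n \<in> carrier M" "compact_slice G W'" "W' \<subseteq> units G" "\<chi> W' n = n"
      using Pn unfolding P_def by blast
    have "compact_slice G (W \<union> W')" "W \<union> W' \<subseteq> units G"
      using W W' compact_slice_units_Un by auto
    moreover from this have "\<chi> (W \<union> W') (\<chi> W m) = \<chi> W m" "\<chi> (W \<union> W') (\<chi> W' n) = \<chi> W' n"
      using W W' by (intro slice_act_units_subset; blast)+
    ultimately show ?thesis
      unfolding P_def using W W' by (intro conjI exI[of _ "W \<union> W'"]) (auto simp: slice_act_simps)
  qed
  have P_smult: "P (c \<odot> m)" if "P m" for c m
    using that by (auto simp: P_def slice_act_simps)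
  have P_act: "P (act M a m)" if "a \<in> carrier (groupoid_algebra G)" "m \<in> carrier M" for a m
    using that(1)
  proof (induction rule: groupoid_algebra_induct)
    case (slice U)
    then show ?case
      unfolding P_def using that(2) slice_act_ran compact_slice_ran ran_image_units by blast
  qed (use that(2) P0 P_add P_smult act_simps[OF that(2)] in auto)
  have "m \<in> mspan M {act M a m | a m. a \<in> carrier (groupoid_algebra G) \<and> m \<in> carrier M}"
    using assms nondegenerate by simp
  moreover have "{act M a m | a m. a \<in> carrier (groupoid_algebra G) \<and> m \<in> carrier M} \<subseteq> carrier M"
    using act_closed by auto
  ultimately have "P m"
  proof (induction rule: mspan_induct)
    case base
    then show ?case using P_act by blast
  qed (use P0 P_add P_smult act_closed in auto)
  then show ?thesis by (simp add: P_def)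
qed

lemma slice_act_disjoint_Un:
  assumes "compact_slice G W" "compact_slice G W'" "W \<inter> W' = {}" "m \<in> carrier M"
  shows "\<chi> (W \<union> W') m = \<chi> W m \<oplus> \<chi> W' m"
proof -
  have "char_fun (W \<union> W') = (\<lambda>s. char_fun W s + (char_fun W' s :: 'k))"
    using assms(3) by (intro ext) (auto simp: char_fun_def)
  then show ?thesis using assms by (simp add: act_simps groupoid_algebra_closed)
qed

text \<open>
  The compact set \<open>W\<close> with \<open>\<chi> W m = m\<close> is a finite disjoint union of pieces which annihilate \<open>m\<close>.
\<close>

lemma zero_if_locally_zero:
  assumes m: "m \<in> carrier M"
    and loc: "\<And>z. z \<in> units G \<Longrightarrow> \<exists>U. compact_slice G U \<and> z \<in> gdom G ` U \<and> \<chi> U m = \<zero>"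
  shows "m = \<zero>"
proof -
  obtain W where W: "compact_slice G W" "W \<subseteq> units G" "\<chi> W m = m"
    using local_unit[OF m] by blast
  define \<W> where "\<W> = {W'. compact_slice G W' \<and> W' \<subseteq> units G \<and> \<chi> W' m = \<zero>}"
  have Un: "\<Union>F \<in> \<W>" if "finite F" "F \<subseteq> \<W>" for F
    using that
  proof (induction F rule: finite_induct)
    case empty
    have "(char_fun {} :: 'g \<Rightarrow> 'k) = (\<lambda>s. 0)" by (auto simp: char_fun_def)
    then show ?case using m by (simp add: \<W>_def compact_slice_empty act_simps)
  next
    case (insert A F)
    define B where "B = \<Union>F"
    have A: "compact_slice G A" "A \<subseteq> units G" "\<chi> A m = \<zero>"
      and B: "compact_slice G B" "B \<subseteq> units G" "\<chi> B m = \<zero>"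
      using insert by (auto simp: \<W>_def B_def)
    \<comment> \<open>Characteristic functions add up only over disjoint sets, so \<open>A\<close>
      is removed from \<open>B\<close> before the union is formed.\<close>
    have BA: "compact_slice G (B - A)" "B - A \<subseteq> units G"
      using A B compact_slice_units_Diff by auto
    have "\<chi> (B - A) m = \<chi> (B - A) (\<chi> B m)"
      using slice_act_units_subset(2)[OF BA(1) B(1) _ B(2) m] by auto
    also have "\<dots> = \<zero>" using B BA by (simp add: slice_act_simps)
    finally have "\<chi> (A \<union> (B - A)) m = \<zero>"
      using A BA m by (subst slice_act_disjoint_Un) auto
    moreover have "A \<union> (B - A) = \<Union>(insert A F)" by (auto simp: B_def)
    ultimately show ?case
      using A B compact_slice_units_Un[OF A(1) BA(1) A(2) BA(2)] by (auto simp: \<W>_def)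
  qed
  have "\<exists>\<F>. finite \<F> \<and> \<F> \<subseteq> \<W> \<and> W \<subseteq> \<Union>\<F>"
  proof (rule compactinD)
    show "compactin (gtop G) W" using W by (simp add: compact_slice_def)
    show "openin (gtop G) U" if "U \<in> \<W>" for U using that compact_slice_open by (auto simp: \<W>_def)
    show "W \<subseteq> \<Union>\<W>"
    proof
      fix z assume "z \<in> W"
      then obtain U where U: "compact_slice G U" "z \<in> gdom G ` U" "\<chi> U m = \<zero>"
        using loc[of z] W by auto
      then have "gdom G ` U \<in> \<W>"
        using compact_slice_dom dom_image_units slice_act_dom m by (simp add: \<W>_def)
      then show "z \<in> \<Union>\<W>" using U by blast
    qed
  qed
  then obtain F where F: "finite F" "F \<subseteq> \<W>" "W \<subseteq> \<Union>F" by blast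
  then have "\<Union>F \<in> \<W>" using Un by blast
  then have "\<chi> W (\<chi> (\<Union>F) m) = \<zero>" using W by (simp add: \<W>_def slice_act_simps)
  moreover have "\<chi> W (\<chi> (\<Union>F) m) = \<chi> W m"
    using \<open>\<Union>F \<in> \<W>\<close> F W m by (intro slice_act_units_subset) (auto simp: \<W>_def)
  ultimately show ?thesis using W by simp
qed

text \<open>A compact open set of units acts as an idempotent, so lying in its image means being
  fixed by it.\<close>

lemma Res_iff:
  "v \<in> Res G x M \<longleftrightarrow> v \<in> carrier M \<and>
     (\<forall>W. compact_slice G W \<and> W \<subseteq> units G \<and> x \<in> W \<longrightarrow> \<chi> W v = v)"
proof -
  have "v \<in> \<chi> W ` carrier M \<longleftrightarrow> \<chi> W v = v"
    if W: "compact_slice G W" "W \<subseteq> units G" and v: "v \<in> carrier M" for W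
  proof
    assume "v \<in> \<chi> W ` carrier M"
    then obtain m where "m \<in> carrier M" "v = \<chi> W m" by auto
    then show "\<chi> W v = v" using slice_act_units_subset(1)[OF W(1) W(1) _ W(2)] by auto
  next
    assume "\<chi> W v = v"
    then show "v \<in> \<chi> W ` carrier M" using v by (metis imageI)
  qed
  then show ?thesis
    unfolding Res_def using compact_slice_of_units_hcompactin by auto
qed

end


section \<open>Induced modules\<close>

text \<open>
  Here \<open>\<tau> t v\<close> has the role of \<open>t \<otimes> v\<close>. Since the algebra is spanned by characteristic functions of
  compact slices, the two action rules express the formula \<open>f (t \<otimes> v) = (\<Sum>y. f (y t\<inverse>) (y \<otimes> v))\<close>
  without a sum.
\<close>

locale induced_module = groupoid_module G M + V: alg_mod "isotropy_algebra G x" V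
  for G :: "'g top_groupoid" and M :: "('k::{comm_ring,comm_monoid_mult}, 'g \<Rightarrow> 'k, 'm) alg_module" (structure)
    and x :: 'g and V :: "('k, 'g \<Rightarrow> 'k, 'v) alg_module" +
  fixes \<tau> :: "'g \<Rightarrow> 'v \<Rightarrow> 'm"
  assumes x_unit: "x \<in> units G"
    and ind_closed: "\<lbrakk>t \<in> L_fibre G x; v \<in> carrier V\<rbrakk> \<Longrightarrow> \<tau> t v \<in> carrier M"
    and ind_add: "\<lbrakk>t \<in> L_fibre G x; v \<in> carrier V; w \<in> carrier V\<rbrakk> \<Longrightarrow> \<tau> t (v \<oplus>\<^bsub>V\<^esub> w) = \<tau> t v \<oplus> \<tau> t w"
    and ind_smult: "\<lbrakk>t \<in> L_fibre G x; v \<in> carrier V\<rbrakk> \<Longrightarrow> \<tau> t (c \<odot>\<^bsub>V\<^esub> v) = c \<odot> \<tau> t v"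
    and ind_balanced: "\<lbrakk>t \<in> L_fibre G x; g \<in> isotropy G x; v \<in> carrier V\<rbrakk>
      \<Longrightarrow> \<tau> (gmul G t g) v = \<tau> t (act V (delta g) v)"
    and ind_act: "\<lbrakk>compact_slice G U; u \<in> U; t \<in> L_fibre G x; v \<in> carrier V; gdom G u = gran G t\<rbrakk>
      \<Longrightarrow> act M (char_fun U) (\<tau> t v) = \<tau> (gmul G u t) v"
    and ind_act_0: "\<lbrakk>compact_slice G U; t \<in> L_fibre G x; v \<in> carrier V; gran G t \<notin> gdom G ` U\<rbrakk>
      \<Longrightarrow> act M (char_fun U) (\<tau> t v) = \<zero>"
    and ind_span: "mspan M {\<tau> t v | t v. t \<in> L_fibre G x \<and> v \<in> carrier V} = carrier M"
    and ind_inj: "\<lbrakk>v \<in> carrier V; \<tau> x v = \<zero>\<rbrakk> \<Longrightarrow> v = \<zero>\<^bsub>V\<^esub>"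
begin

lemma x_in_fibre [simp]: "x \<in> L_fibre G x"
  using x_unit by (simp add: L_fibre_iff)

lemma linear_map_ind: "t \<in> L_fibre G x \<Longrightarrow> linear_map V M (\<tau> t)"
  by (simp add: linear_map_def ind_closed ind_add ind_smult)

lemma ind_zero: "t \<in> L_fibre G x \<Longrightarrow> \<tau> t \<zero>\<^bsub>V\<^esub> = \<zero>"
  using linear_map_zero[OF linear_map_ind V.kmodule_axioms kmodule_axioms] .

lemma inj_ind: "inj_on (\<tau> x) (carrier V)"
proof (rule inj_onI)
  fix v w assume vw: "v \<in> carrier V" "w \<in> carrier V" "\<tau> x v = \<tau> x w"
  have "\<tau> x (v \<oplus>\<^bsub>V\<^esub> (- 1) \<odot>\<^bsub>V\<^esub> w) = \<tau> x v \<oplus> (- 1) \<odot> \<tau> x w"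
    using vw by (simp add: ind_add ind_smult)
  also have "\<dots> = \<zero>" using vw ind_closed by (simp add: smult_minus_one M.r_neg)
  finally have "v \<oplus>\<^bsub>V\<^esub> (- 1) \<odot>\<^bsub>V\<^esub> w = \<zero>\<^bsub>V\<^esub>" using vw by (intro ind_inj) auto
  then have "v \<ominus>\<^bsub>V\<^esub> w = \<zero>\<^bsub>V\<^esub>" using vw by (simp add: V.smult_minus_one a_minus_def)
  then show "v = w" using vw by (simp add: V.diff_eq_zero_iff)
qed

lemma generators_subset: "{\<tau> t v | t v. t \<in> L_fibre G x \<and> v \<in> carrier V} \<subseteq> carrier M"
  using ind_closed by auto

lemma carrier_induct [consumes 1, case_names zero base add smult]:
  assumes "m \<in> carrier M"
    and "P \<zero>" "\<And>t v. \<lbrakk>t \<in> L_fibre G x; v \<in> carrier V\<rbrakk> \<Longrightarrow> P (\<tau> t v)"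
    and "\<And>m n. \<lbrakk>m \<in> carrier M; n \<in> carrier M; P m; P n\<rbrakk> \<Longrightarrow> P (m \<oplus> n)"
    and "\<And>c m. \<lbrakk>m \<in> carrier M; P m\<rbrakk> \<Longrightarrow> P (c \<odot> m)"
  shows "P m"
proof -
  have "m \<in> mspan M {\<tau> t v | t v. t \<in> L_fibre G x \<and> v \<in> carrier V}"
    using assms(1) ind_span by simp
  then show ?thesis using generators_subset
    by (induction rule: mspan_induct) (use assms(2-) in auto)
qed

text \<open>A generator \<open>\<tau> t v\<close> sits over the single unit r(t) and is killed by
  every slice that does not start there. The set \<open>Z\<close> plays the part of a support of
  \<open>m\<close>, as if \<open>m\<close> were a finitely supported section over the orbit.\<close>

lemma finite_orbit_support:
  assumes "m \<in> carrier M"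
  shows "\<exists>Z. finite Z \<and> Z \<subseteq> orbit G x \<and> (\<forall>U. compact_slice G U \<and> gdom G ` U \<inter> Z = {} \<longrightarrow> \<chi> U m = \<zero>)"
  using assms
proof (induction rule: carrier_induct)
  case zero
  then show ?case by (intro exI[of _ "{}"]) (auto simp: slice_act_simps)
next
  case (base t v)
  then show ?case
    by (intro exI[of _ "{gran G t}"]) (auto simp: ind_act_0 orbit_def L_fibre_iff)
next
  case (add m n)
  then obtain Z Z' where "finite Z" "Z \<subseteq> orbit G x" "\<forall>U. compact_slice G U \<and> gdom G ` U \<inter> Z = {} \<longrightarrow> \<chi> U m = \<zero>"
    "finite Z'" "Z' \<subseteq> orbit G x" "\<forall>U. compact_slice G U \<and> gdom G ` U \<inter> Z' = {} \<longrightarrow> \<chi> U n = \<zero>"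
    by blast
  then show ?case using add(1,2)
    by (intro exI[of _ "Z \<union> Z'"]) (auto simp: slice_act_simps Int_Un_distrib)
next
  case (smult c m)
  then show ?case by (auto simp: slice_act_simps)
qed

lemma orbit_units: "z \<in> orbit G x \<Longrightarrow> z \<in> units G"
  by (auto simp: orbit_def)

lemma open_units_minus_finite:
  assumes "finite Z" "Z \<subseteq> units G"
  shows "openin (gtop G) (units G - Z)"
  using assms(1) assms(2) units_subset by (intro open_units_diff finite_imp_compactin) auto

lemma small_slice_avoiding:
  assumes "finite Z" "Z \<subseteq> units G" "z \<in> units G - Z" "openin (gtop G) W" "z \<in> W"
  obtains U where "compact_slice G U" "z \<in> U" "U \<subseteq> W" "U \<subseteq> units G" "gdom G ` U \<inter> Z = {}"
proof -
  have "openin (gtop G) (W \<inter> (units G - Z))"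
    using open_units_minus_finite assms by blast
  then obtain U where U: "compact_slice G U" "z \<in> U" "U \<subseteq> W \<inter> (units G - Z)"
    by (rule compact_slice_nbhd[where g = z]) (use assms in auto)
  moreover have "gdom G ` U \<inter> Z = {}" using U by (auto simp: subset_iff)
  ultimately show ?thesis using that by auto
qed

text \<open>A slice containing the inverse of \<open>t\<close> starts at r(t), so the hypothesis
  covers the units of the orbit. Any other unit has a neighbourhood avoiding the finite set
  \<open>Z\<close>, and slices inside it annihilate \<open>m\<close> anyway.\<close>

lemma zero_if_zero_on_orbit:
  assumes m: "m \<in> carrier M"
    and loc: "\<And>t. t \<in> L_fibre G x \<Longrightarrow> \<exists>U. compact_slice G U \<and> ginv G t \<in> U \<and> \<chi> U m = \<zero>"
  shows "m = \<zero>"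
proof (rule zero_if_locally_zero[OF m])
  fix z assume z: "z \<in> units G"
  show "\<exists>U. compact_slice G U \<and> z \<in> gdom G ` U \<and> \<chi> U m = \<zero>"
  proof (cases "z \<in> orbit G x")
    case True
    then obtain t where t: "t \<in> L_fibre G x" "z = gran G t" by (auto simp: orbit_def L_fibre_iff)
    then obtain U where "compact_slice G U" "ginv G t \<in> U" "\<chi> U m = \<zero>" using loc by blast
    moreover have "z = gdom G (ginv G t)" using t by (simp add: L_fibre_iff)
    ultimately show ?thesis by blast
  next
    case False
    obtain Z where Z: "finite Z" "Z \<subseteq> orbit G x" "\<forall>U. compact_slice G U \<and> gdom G ` U \<inter> Z = {} \<longrightarrow> \<chi> U m = \<zero>"
      using finite_orbit_support[OF m] by blast
    have "Z \<subseteq> units G" "z \<in> units G - Z" using Z False z orbit_units by auto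
    then obtain U where "compact_slice G U" "z \<in> U" "gdom G ` U \<inter> Z = {}" 
      by (rule small_slice_avoiding[OF Z(1) _ _ openin_topspace]) (use z in auto)
    moreover from this have "z \<in> gdom G ` U" using z by (intro image_eqI[of _ _ z]) auto
    ultimately show ?thesis using Z by blast
  qed
qed

end

text \<open>
  This is the submodule of the direct product spanned by the pairs \<open>(f i, f' i)\<close>: the graph of the
  isomorphism sending \<open>f i\<close> to \<open>f' i\<close> if there is one.
\<close>

inductive linked for M M' and f :: "'i \<Rightarrow> 'm" and f' :: "'i \<Rightarrow> 'n" and I where
  zero: "linked M M' f f' I \<zero>\<^bsub>M\<^esub> \<zero>\<^bsub>M'\<^esub>"
| base: "i \<in> I \<Longrightarrow> linked M M' f f' I (f i) (f' i)"
| add: "\<lbrakk>linked M M' f f' I m m'; linked M M' f f' I n n'\<rbrakk> \<Longrightarrow> linked M M' f f' I (m \<oplus>\<^bsub>M\<^esub> n) (m' \<oplus>\<^bsub>M'\<^esub> n')"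
| smult: "linked M M' f f' I m m' \<Longrightarrow> linked M M' f f' I (c \<odot>\<^bsub>M\<^esub> m) (c \<odot>\<^bsub>M'\<^esub> m')"

lemma linked_sym: "linked M M' f f' I m m' \<Longrightarrow> linked M' M f' f I m' m"
  by (induction rule: linked.induct) (auto intro: linked.intros)

lemma linked_closed:
  assumes "kmodule M" "kmodule M'" "f ` I \<subseteq> carrier M" "f' ` I \<subseteq> carrier M'" "linked M M' f f' I m m'"
  shows "m \<in> carrier M \<and> m' \<in> carrier M'"
proof -
  interpret M: kmodule M by fact
  interpret M': kmodule M' by fact
  show ?thesis using assms(5) by (induction rule: linked.induct) (use assms in auto)
qed

lemma linked_total:
  assumes "kmodule M" "f ` I \<subseteq> carrier M" "m \<in> mspan M (f ` I)"
  shows "\<exists>m'. linked M M' f f' I m m'"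
proof -
  interpret M: kmodule M by fact
  show ?thesis using assms(3,2)
  proof (induction rule: M.mspan_induct)
    case (base s)
    then show ?case using linked.base by (metis imageE)
  qed (blast intro: linked.intros)+
qed

text \<open>\<open>linked\<close> is closed under differences, so it is the graph of a bijection as
  soon as zero is linked to zero alone in both directions. This replaces a proof that an assignment
  on generators respects all relations among them.\<close>

lemma alg_module_iso_if_linked:
  fixes M :: "('k::{comm_ring,comm_monoid_mult}, 'a, 'm) alg_module" and M' :: "('k, 'a, 'n) alg_module"
  assumes M: "kmodule M" and M': "kmodule M'"
    and span: "mspan M (f ` I) = carrier M" and span': "mspan M' (f' ` I) = carrier M'"
    and sub: "f ` I \<subseteq> carrier M" and sub': "f' ` I \<subseteq> carrier M'"
    and inj: "\<And>m'. linked M M' f f' I \<zero>\<^bsub>M\<^esub> m' \<Longrightarrow> m' = \<zero>\<^bsub>M'\<^esub>"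
    and inj': "\<And>m. linked M M' f f' I m \<zero>\<^bsub>M'\<^esub> \<Longrightarrow> m = \<zero>\<^bsub>M\<^esub>"
    and act: "\<And>a m m'. \<lbrakk>a \<in> carrier A; linked M M' f f' I m m'\<rbrakk> \<Longrightarrow> linked M M' f f' I (act M a m) (act M' a m')"
  shows "alg_module_iso A M M'"
proof -
  interpret M: kmodule M by fact
  interpret M': kmodule M' by fact
  let ?R = "linked M M' f f' I"
  have total: "\<exists>m'. ?R m m'" if "m \<in> carrier M" for m
    using linked_total[OF M sub] that span by blast
  have total': "\<exists>m. ?R m m'" if "m' \<in> carrier M'" for m'
    using linked_total[OF M' sub'] that span' linked_sym by metis
  note cl = linked_closed[OF M M' sub sub']
  have diff: "?R (m \<ominus>\<^bsub>M\<^esub> n) (m' \<ominus>\<^bsub>M'\<^esub> n')" if "?R m m'" "?R n n'" for m m' n n'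
    using linked.add[OF that(1) linked.smult[OF that(2), of "- 1"]] cl[OF that(2)]
    by (simp add: a_minus_def M.smult_minus_one M'.smult_minus_one)
  have uniq: "m' = n'" if "?R m m'" "?R m n'" for m m' n'
  proof -
    have "m \<ominus>\<^bsub>M\<^esub> m = \<zero>\<^bsub>M\<^esub>" using cl[OF that(1)] by (simp add: M.diff_eq_zero_iff)
    then have "m' \<ominus>\<^bsub>M'\<^esub> n' = \<zero>\<^bsub>M'\<^esub>" using diff[OF that] inj by simp
    then show ?thesis using cl[OF that(1)] cl[OF that(2)] by (simp add: M'.diff_eq_zero_iff)
  qed
  have uniq': "m = n" if "?R m m'" "?R n m'" for m n m'
  proof -
    have "m' \<ominus>\<^bsub>M'\<^esub> m' = \<zero>\<^bsub>M'\<^esub>" using cl[OF that(1)] by (simp add: M'.diff_eq_zero_iff)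
    then have "m \<ominus>\<^bsub>M\<^esub> n = \<zero>\<^bsub>M\<^esub>" using diff[OF that] inj' by simp
    then show ?thesis using cl[OF that(1)] cl[OF that(2)] by (simp add: M.diff_eq_zero_iff)
  qed
  define h where "h m = (SOME m'. ?R m m')" for m
  have h: "?R m (h m)" if "m \<in> carrier M" for m
    unfolding h_def using total[OF that] by (rule someI_ex)
  have h_eq: "h m = m'" if "?R m m'" for m m'
    using uniq[OF h that] cl[OF that] by simp
  show ?thesis unfolding alg_module_iso_def
  proof (intro exI[of _ h] conjI ballI allI)
    show "bij_betw h (carrier M) (carrier M')"
    proof (rule bij_betw_imageI)
      show "inj_on h (carrier M)"
      proof (rule inj_onI)
        fix m n assume "m \<in> carrier M" "n \<in> carrier M" "h m = h n"
        then show "m = n" using uniq'[OF h[of m]] h[of n] by simp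
      qed
      show "h ` carrier M = carrier M'"
      proof
        show "h ` carrier M \<subseteq> carrier M'" using h cl by blast
        show "carrier M' \<subseteq> h ` carrier M"
        proof
          fix m' assume "m' \<in> carrier M'"
          then obtain m where m: "?R m m'" using total' by blast
          then show "m' \<in> h ` carrier M" using h_eq[OF m] cl[OF m] by (intro image_eqI[of _ _ m]) auto
        qed
      qed
    qed
  qed (auto intro!: h_eq intro: linked.intros h act)
qed

section \<open>Modules over the algebra of the isotropy group\<close>

locale isotropy_module = ample_groupoid G + alg_mod "isotropy_algebra G x" V
  for G :: "'g top_groupoid" and x :: 'g
    and V :: "('k::{comm_ring,comm_monoid_mult}, 'g \<Rightarrow> 'k, 'v) alg_module" (structure) +
  assumes x_unit: "x \<in> units G"
begin

lemma delta_closed: "g \<in> isotropy G x \<Longrightarrow> (delta g :: 'g \<Rightarrow> 'k) \<in> carrier (isotropy_algebra G x)"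
  by (simp only: isotropy_algebra_simps delta_in_free_module)

lemma x_isotropy [simp]: "x \<in> isotropy G x"
  using x_unit by (simp add: isotropy_iff)

lemma isotropy_act_closed [simp, intro]:
  "\<lbrakk>g \<in> isotropy G x; v \<in> carrier V\<rbrakk> \<Longrightarrow> act V (delta g) v \<in> carrier V"
  using delta_closed act_closed by blast

lemma isotropy_act_simps:
  assumes "v \<in> carrier V"
  shows "act V (\<lambda>s. 0) v = \<zero>"
    "\<lbrakk>a \<in> carrier (free_module (isotropy G x)); b \<in> carrier (free_module (isotropy G x))\<rbrakk> \<Longrightarrow>
      act V (\<lambda>s. a s + b s) v = act V a v \<oplus> act V b v"
    "a \<in> carrier (free_module (isotropy G x)) \<Longrightarrow> act V (\<lambda>s. c * a s) v = c \<odot> act V a v"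
  using act_smult_left[of "\<lambda>s. 0" v 0] act_add_left[of a b v] act_smult_left[of a v c] assms
    act_closed[of "\<lambda>s. 0" v]
  by simp_all

text \<open>Modules are only assumed to be non-degenerate. The unit acts as the identity because it
  fixes all products \<open>act V a m\<close>, and these span.\<close>

lemma isotropy_act_unit:
  assumes "v \<in> carrier V"
  shows "act V (delta x) v = v"
proof -
  note dx = delta_closed[OF x_isotropy]
  have unit: "bilinear_mul G (delta x) a = a" if "a \<in> carrier (free_module (isotropy G x))" for a :: "'g \<Rightarrow> 'k"
    using that
  proof (induction rule: free_module_induct)
    case (delta g)
    then show ?case by (simp add: bilinear_mul_delta isotropy_iff x_unit)
  qed (simp_all add: bilinear_mul_right)
  have sub: "{act V a m | a m. a \<in> carrier (isotropy_algebra G x) \<and> m \<in> carrier V} \<subseteq> carrier V"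
    using act_closed by auto
  have "v \<in> mspan V {act V a m | a m. a \<in> carrier (isotropy_algebra G x) \<and> m \<in> carrier V}"
    using assms nondegenerate by simp
  then show ?thesis using sub
  proof (induction rule: mspan_induct)
    case (base s)
    then obtain a m where am: "a \<in> carrier (isotropy_algebra G x)" "m \<in> carrier V" "s = act V a m" by auto
    then show ?case using act_mult[OF dx am(1,2)] unit[of a] by simp
  next
    case zero
    then show ?case using linear_map_zero[OF _ kmodule_axioms kmodule_axioms, of "act V (delta x)"]
      act_closed[OF dx] act_add_right[OF dx] act_smult_right[OF dx] by (simp add: linear_map_def)
  qed (use act_add_right[OF dx] act_smult_right[OF dx] in auto)
qed

lemma isotropy_submoduleI:
  assumes "submodule N (scalars :: 'k ring) V"
    and "\<And>g n. \<lbrakk>g \<in> isotropy G x; n \<in> N\<rbrakk> \<Longrightarrow> act V (delta g) n \<in> N"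
  shows "alg_submodule (isotropy_algebra G x) V N"
proof -
  note E = submodule_scalarsE[OF assms(1)]
  have "act V a n \<in> N" if "a \<in> carrier (free_module (isotropy G x))" and n: "n \<in> N" for a n
    using that(1)
  proof (induction rule: free_module_induct)
    case (delta g)
    then show ?case using assms(2) n by blast
  qed (use E n isotropy_act_simps[of n] in auto)
  then show ?thesis using assms(1) by (simp add: alg_submodule_def)
qed

end

lemma isotropy_module_isoI:
  assumes "isotropy_module G x V" "isotropy_module G x V'"
    and h: "bij_betw h (carrier V) (carrier V')" "linear_map V V' h"
    and act: "\<And>g v. \<lbrakk>g \<in> isotropy G x; v \<in> carrier V\<rbrakk> \<Longrightarrow> h (act V (delta g) v) = act V' (delta g) (h v)"
  shows "alg_module_iso (isotropy_algebra G x) V V'"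
proof -
  interpret V: isotropy_module G x V by fact
  interpret V': isotropy_module G x V' by fact
  note hD = linear_mapD[OF h(2)] linear_map_zero[OF h(2) V.kmodule_axioms V'.kmodule_axioms]
  have "h (act V a v) = act V' a (h v)" if "a \<in> carrier (free_module (isotropy G x))" and v: "v \<in> carrier V" for a v
    using that(1)
  proof (induction rule: free_module_induct)
    case zero
    then show ?case using V.isotropy_act_simps[OF v] V'.isotropy_act_simps[of "h v"] v hD by simp
  next
    case (delta g)
    then show ?case using act v by blast
  next
    case (add a b)
    moreover have "act V a v \<in> carrier V" "act V b v \<in> carrier V"
      using add V.act_closed v by simp_all
    ultimately show ?case
      using V.isotropy_act_simps(2)[OF v, of a b] V'.isotropy_act_simps(2)[of "h v" a b] v hD by simp
  next
    case (smult c a)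
    moreover have "act V a v \<in> carrier V"
      using smult V.act_closed v by simp
    ultimately show ?case
      using V.isotropy_act_simps(3)[OF v, of a c] V'.isotropy_act_simps(3)[of "h v" a c] v hD by simp
  qed
  then show ?thesis
    unfolding alg_module_iso_def using h by (intro exI[of _ h]) (auto simp: linear_map_def)
qed

context induced_module
begin

sublocale V: isotropy_module G x V
  by unfold_locales (rule x_unit)

lemma generators_image:
  "(\<lambda>(t, v). \<tau> t v) ` (L_fibre G x \<times> carrier V) = {\<tau> t v | t v. t \<in> L_fibre G x \<and> v \<in> carrier V}"
  by auto

lemma ind_isotropy:
  assumes "g \<in> isotropy G x" "v \<in> carrier V"
  shows "\<tau> g v = \<tau> x (act V (delta g) v)"
  using ind_balanced[OF x_in_fibre assms] assms(1) x_unit by (simp add: isotropy_iff)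

lemma ind_eq_slice_act:
  assumes "compact_slice G U" "t \<in> U" "t \<in> L_fibre G x" "v \<in> carrier V"
  shows "\<chi> U (\<tau> x v) = \<tau> t v"
  using ind_act[OF assms(1,2) x_in_fibre assms(4)] assms x_unit by (simp add: L_fibre_iff)

end

section \<open>Two models over the same isotropy module, compared by germs\<close>

locale induced_pair = I: induced_module G M x V \<tau> + I': induced_module G M' x V \<tau>'
  for G :: "'g top_groupoid" and M :: "('k::{comm_ring,comm_monoid_mult}, 'g \<Rightarrow> 'k, 'm) alg_module"
    and M' :: "('k, 'g \<Rightarrow> 'k, 'n) alg_module"
    and x :: 'g and V :: "('k, 'g \<Rightarrow> 'k, 'v) alg_module" and \<tau> \<tau>'
begin

abbreviation rel where
  "rel \<equiv> linked M M' (\<lambda>(t, v). \<tau> t v) (\<lambda>(t, v). \<tau>' t v) (L_fibre G x \<times> carrier V)"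

lemma rel_closed: "rel m m' \<Longrightarrow> m \<in> carrier M \<and> m' \<in> carrier M'"
  by (rule linked_closed[OF I.kmodule_axioms I'.kmodule_axioms])
    (auto intro: I.ind_closed I'.ind_closed)

text \<open>A slice around the inverse of \<open>t\<close> moves the part of \<open>m\<close> over
  r(t) to the unit \<open>x\<close> and, if it is small, kills the finitely many other parts. What
  remains is \<open>\<tau> x v\<close>. Only rules shared by both models are used, so the same
  \<open>v\<close> serves for \<open>m\<close> and its partner.\<close>

lemma germ:
  assumes "rel m m'" "t \<in> L_fibre G x"
  shows "\<exists>v\<in>carrier V. \<exists>W. openin (gtop G) W \<and> ginv G t \<in> W \<and>
    (\<forall>U. compact_slice G U \<and> ginv G t \<in> U \<and> U \<subseteq> W \<longrightarrow>
      act M (char_fun U) m = \<tau> x v \<and> act M' (char_fun U) m' = \<tau>' x v)"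
  using assms(1)
proof (induction rule: linked.induct)
  case zero
  have "ginv G t \<in> arrows G" using assms(2) by (simp add: I.L_fibre_iff)
  then show ?case
    by (intro bexI[of _ "\<zero>\<^bsub>V\<^esub>"] exI[of _ "arrows G"])
      (auto simp: I.slice_act_simps I'.slice_act_simps I.ind_zero I'.ind_zero)
next
  case (base i)
  then obtain s v where i: "i = (s, v)" "s \<in> L_fibre G x" "v \<in> carrier V" by auto
  have s: "s \<in> arrows G" "gdom G s = x" and t: "t \<in> arrows G" "gdom G t = x"
    using i(2) assms(2) by (auto simp: I.L_fibre_iff)
  show ?case
  proof (cases "gran G s = gran G t")
    case True
    \<comment> \<open>\<open>s\<close> and \<open>t\<close> have the same domain and range, so
      \<open>s\<close> is \<open>t\<close> followed on the right by this element of the isotropy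
      group.\<close>
    define g where "g = gmul G (ginv G t) s"
    have g: "g \<in> isotropy G x" using s t True by (simp add: g_def I.isotropy_iff)
    have "act M (char_fun U) (\<tau> s v) = \<tau> x (act V (delta g) v) \<and>
        act M' (char_fun U) (\<tau>' s v) = \<tau>' x (act V (delta g) v)"
      if "compact_slice G U" "ginv G t \<in> U" for U
      using that i True t I.ind_act[of U "ginv G t" s v] I'.ind_act[of U "ginv G t" s v]
        I.ind_isotropy[OF g i(3)] I'.ind_isotropy[OF g i(3)]
      by (simp add: g_def)
    then show ?thesis using i g t
      by (intro bexI[of _ "act V (delta g) v"] exI[of _ "arrows G"]) auto
  next
    case False
    \<comment> \<open>Slices inside \<open>W\<close> do not start at r(s) and hence kill this
      generator in both models.\<close>
    obtain W where W: "openin (gtop G) W" "ginv G t \<in> W" "\<And>h. h \<in> W \<Longrightarrow> gdom G h \<noteq> gran G s"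
      by (rule I.separate_units[of "ginv G t" "gran G s"]) (use s t False in auto)
    have "act M (char_fun U) (\<tau> s v) = \<zero>\<^bsub>M\<^esub> \<and> act M' (char_fun U) (\<tau>' s v) = \<zero>\<^bsub>M'\<^esub>"
      if "compact_slice G U" "U \<subseteq> W" for U
    proof -
      have "gran G s \<notin> gdom G ` U" using that W(3) by fastforce
      then show ?thesis using that i I.ind_act_0 I'.ind_act_0 by blast
    qed
    then show ?thesis using W(1,2) i
      by (intro bexI[of _ "\<zero>\<^bsub>V\<^esub>"] exI[of _ W]) (auto simp: I.ind_zero I'.ind_zero)
  qed
next
  case (add m m' n n')
  then obtain v W w W' where
    "v \<in> carrier V" "openin (gtop G) W" "ginv G t \<in> W"
    "\<forall>U. compact_slice G U \<and> ginv G t \<in> U \<and> U \<subseteq> W \<longrightarrow>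
      act M (char_fun U) m = \<tau> x v \<and> act M' (char_fun U) m' = \<tau>' x v"
    "w \<in> carrier V" "openin (gtop G) W'" "ginv G t \<in> W'"
    "\<forall>U. compact_slice G U \<and> ginv G t \<in> U \<and> U \<subseteq> W' \<longrightarrow>
      act M (char_fun U) n = \<tau> x w \<and> act M' (char_fun U) n' = \<tau>' x w"
    by blast
  then show ?case using rel_closed[OF add(1)] rel_closed[OF add(2)]
    by (intro bexI[of _ "v \<oplus>\<^bsub>V\<^esub> w"] exI[of _ "W \<inter> W'"])
      (auto simp: I.slice_act_simps I'.slice_act_simps I.ind_add I'.ind_add)
next
  case (smult m m' c)
  then obtain v W where
    "v \<in> carrier V" "openin (gtop G) W" "ginv G t \<in> W"
    "\<forall>U. compact_slice G U \<and> ginv G t \<in> U \<and> U \<subseteq> W \<longrightarrow>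
      act M (char_fun U) m = \<tau> x v \<and> act M' (char_fun U) m' = \<tau>' x v"
    by blast
  then show ?case using rel_closed[OF smult(1)]
    by (intro bexI[of _ "c \<odot>\<^bsub>V\<^esub> v"] exI[of _ W])
      (auto simp: I.slice_act_simps I'.slice_act_simps I.ind_smult I'.ind_smult)
qed

text \<open>Where zero has germ \<open>\<tau> x v\<close>, its partner has germ
  \<open>\<tau>' x v\<close>. Injectivity of \<open>\<tau> x\<close> forces \<open>v\<close> to
  vanish, and an element all of whose germs on the orbit vanish is zero.\<close>

lemma rel_zero:
  assumes "rel \<zero>\<^bsub>M\<^esub> m'"
  shows "m' = \<zero>\<^bsub>M'\<^esub>"
proof (rule I'.zero_if_zero_on_orbit)
  show "m' \<in> carrier M'" using rel_closed[OF assms] by simp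
  fix t assume "t \<in> L_fibre G x"
  then obtain v W where v: "v \<in> carrier V" "openin (gtop G) W" "ginv G t \<in> W"
    "\<forall>U. compact_slice G U \<and> ginv G t \<in> U \<and> U \<subseteq> W \<longrightarrow>
      act M (char_fun U) \<zero>\<^bsub>M\<^esub> = \<tau> x v \<and> act M' (char_fun U) m' = \<tau>' x v"
    using germ[OF assms] by blast
  obtain U where U: "compact_slice G U" "ginv G t \<in> U" "U \<subseteq> W"
    using I.compact_slice_nbhd[OF v(2,3)] .
  then have "\<tau> x v = \<zero>\<^bsub>M\<^esub>" using v(4) I.slice_act_simps(3)[OF U(1)] by metis
  then have "v = \<zero>\<^bsub>V\<^esub>" using I.ind_inj v(1) by blast
  then have "act M' (char_fun U) m' = \<zero>\<^bsub>M'\<^esub>" using v(4) U I'.ind_zero by simp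
  then show "\<exists>U. compact_slice G U \<and> ginv G t \<in> U \<and> act M' (char_fun U) m' = \<zero>\<^bsub>M'\<^esub>"
    using U by blast
qed

lemma rel_act:
  assumes "a \<in> carrier (groupoid_algebra G)" "rel m m'"
  shows "rel (act M a m) (act M' a m')"
  using assms(1)
proof (induction rule: I.groupoid_algebra_induct)
  case zero
  then show ?case
    using I.act_simps(1)[of m] I'.act_simps(1)[of m'] rel_closed[OF assms(2)] linked.zero by metis
next
  case (slice U)
  from assms(2) show ?case
  proof (induction rule: linked.induct)
    case zero
    then show ?case using slice by (simp add: I.slice_act_simps I'.slice_act_simps linked.zero)
  next
    case (base i)
    then obtain s v where i: "i = (s, v)" "s \<in> L_fibre G x" "v \<in> carrier V" by auto
    show ?case
    proof (cases "gran G s \<in> gdom G ` U")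
      case True
      then obtain u where u: "u \<in> U" "gdom G u = gran G s" by force
      then have "gmul G u s \<in> L_fibre G x"
        using i I.slice_arrow[OF I.compact_slice_slice[OF slice]] by (simp add: I.L_fibre_iff)
      then have "rel (\<tau> (gmul G u s) v) (\<tau>' (gmul G u s) v)"
        using linked.base[of "(gmul G u s, v)" _ M M' "\<lambda>(t, v). \<tau> t v" "\<lambda>(t, v). \<tau>' t v"] i by simp
      then show ?thesis
        using I.ind_act[OF slice u(1) i(2,3) u(2)] I'.ind_act[OF slice u(1) i(2,3) u(2)] i by simp
    next
      case False
      then show ?thesis
        using I.ind_act_0[OF slice i(2,3)] I'.ind_act_0[OF slice i(2,3)] i linked.zero by simp
    qed
  next
    case (add m m' n n')
    then show ?case using slice rel_closed[OF add(1)] rel_closed[OF add(2)]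
      by (simp add: I.slice_act_simps I'.slice_act_simps linked.add)
  next
    case (smult m m' c)
    then show ?case using slice rel_closed[OF smult(1)]
      by (simp add: I.slice_act_simps I'.slice_act_simps linked.smult)
  qed
next
  case (add a b)
  then show ?case
    using I.act_simps(2)[of m a b] I'.act_simps(2)[of m' a b] rel_closed[OF assms(2)]
    by (simp add: linked.add)
next
  case (smult c a)
  then show ?case
    using I.act_simps(3)[of m a c] I'.act_simps(3)[of m' a c] rel_closed[OF assms(2)]
    by (simp add: linked.smult)
qed

end

lemma (in induced_pair) swap: "induced_pair G M' M x V \<tau>' \<tau>"
  by unfold_locales

lemma (in induced_pair) alg_module_iso: "alg_module_iso (groupoid_algebra G) M M'"
proof (rule alg_module_iso_if_linked[OF I.kmodule_axioms I'.kmodule_axioms])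
  interpret S: induced_pair G M' M x V \<tau>' \<tau> by (rule swap)
  show "m = \<zero>\<^bsub>M\<^esub>" if "rel m \<zero>\<^bsub>M'\<^esub>" for m
    using linked_sym[OF that] by (rule S.rel_zero)
qed (use I.ind_span I'.ind_span I.generators_subset I'.generators_subset rel_zero rel_act
    in \<open>simp_all only: I.generators_image I'.generators_image\<close>)

section \<open>Restriction, simplicity, support and dimension of an induced module\<close>

context induced_module
begin

lemma pair_self: "induced_pair G M M x V \<tau> \<tau>"
  by unfold_locales

text \<open>A model is compared with itself: every element is linked to itself, so
  \<open>germ\<close> applies to single elements.\<close>

lemma element_germ:
  assumes "m \<in> carrier M" "t \<in> L_fibre G x"
  obtains v W where "v \<in> carrier V" "openin (gtop G) W" "ginv G t \<in> W"
    "\<forall>U. compact_slice G U \<longrightarrow> ginv G t \<in> U \<longrightarrow> U \<subseteq> W \<longrightarrow> \<chi> U m = \<tau> x v"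
proof -
  interpret P: induced_pair G M M x V \<tau> \<tau> by (rule pair_self)
  have "P.rel m m" using assms(1)
    by (induction rule: carrier_induct)
      (auto intro: linked.zero linked.add linked.smult
        intro!: linked.base[of "(_, _)" _ M M "\<lambda>(t, v). \<tau> t v" "\<lambda>(t, v). \<tau> t v", simplified])
  from P.germ[OF this assms(2)] show ?thesis using that by blast
qed

text \<open>Small compact open sets of units around \<open>x\<close> fix an element of the
  restriction, while by \<open>element_germ\<close> they send it to some \<open>\<tau> x v\<close>.
  Conversely the unit \<open>x\<close> in such a set carries \<open>\<tau> x v\<close> to
  itself.\<close>

lemma Res_eq: "Res G x M = \<tau> x ` carrier V"
proof
  show "\<tau> x ` carrier V \<subseteq> Res G x M"
    using x_unit by (auto simp: Res_iff ind_closed ind_eq_slice_act)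
  show "Res G x M \<subseteq> \<tau> x ` carrier V"
  proof
    fix m assume m: "m \<in> Res G x M"
    then have "m \<in> carrier M" by (simp add: Res_iff)
    obtain v W where v: "v \<in> carrier V" "openin (gtop G) W" "ginv G x \<in> W"
      "\<forall>U. compact_slice G U \<longrightarrow> ginv G x \<in> U \<longrightarrow> U \<subseteq> W \<longrightarrow> \<chi> U m = \<tau> x v"
      using element_germ[OF \<open>m \<in> carrier M\<close> x_in_fibre] .
    have "x \<in> W" using v(3) x_unit by simp
    then obtain U where U: "compact_slice G U" "x \<in> U" "U \<subseteq> W" "U \<subseteq> units G"
      by (rule compact_units_slice[OF v(2) _ x_unit])
    then have "m = \<tau> x v" using v(4)[rule_format, of U] m x_unit by (simp add: Res_iff)
    then show "m \<in> \<tau> x ` carrier V" using v(1) by simp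
  qed
qed

lemma nonzero_element_germ:
  assumes "m \<in> carrier M" "m \<noteq> \<zero>"
  obtains v U where "compact_slice G U" "v \<in> carrier V" "v \<noteq> \<zero>\<^bsub>V\<^esub>" "\<chi> U m = \<tau> x v"
proof -
  obtain t where t: "t \<in> L_fibre G x" "\<And>U. \<lbrakk>compact_slice G U; ginv G t \<in> U\<rbrakk> \<Longrightarrow> \<chi> U m \<noteq> \<zero>"
  proof -
    have "\<exists>t\<in>L_fibre G x. \<forall>U. compact_slice G U \<and> ginv G t \<in> U \<longrightarrow> \<chi> U m \<noteq> \<zero>"
    proof (rule ccontr)
      assume "\<not> ?thesis"
      then have "m = \<zero>" by (intro zero_if_zero_on_orbit[OF assms(1)]) blast
      then show False using assms(2) by simp
    qed
    then show ?thesis using that by blast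
  qed
  obtain v W where v: "v \<in> carrier V" "openin (gtop G) W" "ginv G t \<in> W"
    "\<forall>U. compact_slice G U \<longrightarrow> ginv G t \<in> U \<longrightarrow> U \<subseteq> W \<longrightarrow> \<chi> U m = \<tau> x v"
    using element_germ[OF assms(1) t(1)] .
  obtain U where U: "compact_slice G U" "ginv G t \<in> U" "U \<subseteq> W"
    using compact_slice_nbhd[OF v(2,3)] .
  have "v \<noteq> \<zero>\<^bsub>V\<^esub>" using t(2)[OF U(1,2)] v(4)[rule_format, OF U] ind_zero by auto
  then show ?thesis using that U(1) v(1) v(4)[rule_format, OF U] by blast
qed

lemma ind_nonzero: "\<lbrakk>v \<in> carrier V; v \<noteq> \<zero>\<^bsub>V\<^esub>\<rbrakk> \<Longrightarrow> \<tau> x v \<noteq> \<zero>"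
  using ind_inj by blast

text \<open>A non-zero element of a submodule \<open>N\<close> has a non-zero germ, so a slice
  brings it to some non-zero \<open>\<tau> x v\<close> in \<open>N\<close>. Hence \<open>N'\<close>
  is a non-zero submodule of \<open>V\<close> and equals \<open>V\<close>; slices then carry
  \<open>\<tau> x w\<close> to every \<open>\<tau> t w\<close>.\<close>

lemma simple:
  assumes "simple_module (isotropy_algebra G x) V"
  shows "simple_module (groupoid_algebra G) M"
proof -
  have V: "carrier V \<noteq> {\<zero>\<^bsub>V\<^esub>}"
    and Vs: "\<And>N. alg_submodule (isotropy_algebra G x) V N \<Longrightarrow> N = {\<zero>\<^bsub>V\<^esub>} \<or> N = carrier V"
    using assms by (auto simp: simple_module_def)
  obtain v where v: "v \<in> carrier V" "v \<noteq> \<zero>\<^bsub>V\<^esub>" using V V.zero_closed by blast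
  have M: "carrier M \<noteq> {\<zero>}" using ind_nonzero[OF v] ind_closed[OF x_in_fibre v(1)] by auto
  have "N = carrier M" if N: "alg_submodule (groupoid_algebra G) M N" and nz: "N \<noteq> {\<zero>}" for N
  proof -
    have sub: "submodule N (scalars :: 'k ring) M"
      and clos: "\<And>U n. \<lbrakk>compact_slice G U; n \<in> N\<rbrakk> \<Longrightarrow> \<chi> U n \<in> N"
      using N groupoid_algebra_closed(2) by (auto simp: alg_submodule_def)
    note E = submodule_scalarsE[OF sub]
    obtain m where m: "m \<in> N" "m \<noteq> \<zero>" "m \<in> carrier M" using E(1,2) nz by blast
    obtain v U where v: "compact_slice G U" "v \<in> carrier V" "v \<noteq> \<zero>\<^bsub>V\<^esub>" "\<chi> U m = \<tau> x v"
      using nonzero_element_germ[OF m(3,2)] .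
    define N' where "N' = {v \<in> carrier V. \<tau> x v \<in> N}"
    have "alg_submodule (isotropy_algebra G x) V N'"
    proof (rule V.isotropy_submoduleI)
      show "submodule N' (scalars :: 'k ring) V"
        unfolding N'_def
        by (rule submodule_vimage[OF linear_map_ind[OF x_in_fibre] V.kmodule_axioms kmodule_axioms sub])
      fix g n assume g: "g \<in> isotropy G x" and n: "n \<in> N'"
      then obtain U where U: "compact_slice G U" "g \<in> U"
        using compact_slice_at by (auto simp: isotropy_iff)
      have "g \<in> L_fibre G x" using g by (simp add: isotropy_iff L_fibre_iff)
      then have "\<tau> x (act V (delta g) n) = \<chi> U (\<tau> x n)"
        using g n U by (simp add: ind_isotropy[OF g, symmetric] ind_eq_slice_act N'_def)
      then show "act V (delta g) n \<in> N'"
        using clos U n g by (simp add: N'_def)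
    qed
    moreover have "v \<in> N'" using v clos[OF v(1) m(1)] by (simp add: N'_def)
    ultimately have N': "N' = carrier V" using Vs v(3) by blast
    have "{\<tau> t v | t v. t \<in> L_fibre G x \<and> v \<in> carrier V} \<subseteq> N"
    proof clarify
      fix t w assume t: "t \<in> L_fibre G x" and w: "w \<in> carrier V"
      then obtain U where U: "compact_slice G U" "t \<in> U"
        using compact_slice_at by (auto simp: L_fibre_iff)
      have "w \<in> N'" using w N' by simp
      then have "\<tau> x w \<in> N" by (simp add: N'_def)
      then show "\<tau> t w \<in> N" using clos[OF U(1)] ind_eq_slice_act[OF U t w] by metis
    qed
    from mspan_minimal[OF sub this] have "carrier M \<subseteq> N" unfolding ind_span .
    then show ?thesis using E(1) by blast
  qed
  then show ?thesis
    using M alg_mod_axioms by (auto simp: simple_module_def)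
qed

lemma spectral:
  assumes "carrier V \<noteq> {\<zero>\<^bsub>V\<^esub>}"
  shows "spectral G M"
proof -
  obtain v where v: "v \<in> carrier V" "v \<noteq> \<zero>\<^bsub>V\<^esub>" using assms V.zero_closed by blast
  then have "\<tau> x v \<in> Res G x M" "\<tau> x v \<noteq> \<zero>" "\<tau> x v \<in> carrier M"
    using Res_eq ind_nonzero ind_closed by auto
  then show ?thesis using x_unit by (auto simp: spectral_def)
qed

text \<open>A unit outside the orbit has a neighbourhood whose characteristic function kills a given
  element, by \<open>finite_orbit_support\<close>; but it has to fix the elements of the
  restriction.\<close>

lemma Res_nonzero_orbit:
  assumes "y \<in> units G" "Res G y M \<noteq> {\<zero>}"
  shows "y \<in> orbit G x"
proof (rule ccontr)
  assume ny: "y \<notin> orbit G x"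
  have "\<zero> \<in> Res G y M" by (auto simp: Res_iff slice_act_simps)
  then obtain m where m: "m \<in> Res G y M" "m \<noteq> \<zero>" using assms(2) by blast
  then have "m \<in> carrier M" by (simp add: Res_iff)
  from finite_orbit_support[OF this] obtain Z where Z: "finite Z" "Z \<subseteq> orbit G x"
    "\<forall>U. compact_slice G U \<and> gdom G ` U \<inter> Z = {} \<longrightarrow> \<chi> U m = \<zero>"
    by (elim exE conjE)
  have "Z \<subseteq> units G" "y \<in> units G - Z" using Z ny assms(1) orbit_units by auto
  then obtain U where "compact_slice G U" "y \<in> U" "U \<subseteq> units G" "gdom G ` U \<inter> Z = {}" 
    by (rule small_slice_avoiding[OF Z(1) _ _ openin_topspace]) (use assms in auto)
  then have "\<chi> U m = \<zero>" "\<chi> U m = m" using Z(3) m(1) unfolding Res_iff by blast+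
  then show False using m(2) by simp
qed

text \<open>Finitely many generators sit over a finite set \<open>Y\<close> of orbit points, while
  every orbit point carries some non-zero \<open>\<tau> t v\<close>. Finite generation passes down
  to the subspace formed by the \<open>\<tau> x v\<close>, which is where the field is used, and up
  again through one arrow for each point of the orbit.\<close>

lemma finitely_generated_iff:
  assumes fld: "field (scalars :: 'k ring)" and V: "carrier V \<noteq> {\<zero>\<^bsub>V\<^esub>}"
  shows "finitely_generated M \<longleftrightarrow> finite (orbit G x) \<and> finitely_generated V"
proof
  assume fg: "finitely_generated M"
  have "finite (orbit G x)"
  proof -
    obtain B where B: "finite B" "B \<subseteq> carrier M" "mspan M B = carrier M"
      using fg by (auto simp: finitely_generated_def)
    have "\<forall>b\<in>B. \<exists>Z. finite Z \<and> Z \<subseteq> orbit G x \<and>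
        (\<forall>U. compact_slice G U \<and> gdom G ` U \<inter> Z = {} \<longrightarrow> \<chi> U b = \<zero>)"
      using B(2) by (intro ballI finite_orbit_support) auto
    from bchoice[OF this] obtain Z where "\<forall>b\<in>B. finite (Z b) \<and> Z b \<subseteq> orbit G x \<and>
        (\<forall>U. compact_slice G U \<and> gdom G ` U \<inter> Z b = {} \<longrightarrow> \<chi> U b = \<zero>)" ..
    then have Z: "\<And>b. b \<in> B \<Longrightarrow> finite (Z b)"
      "\<And>b U. \<lbrakk>b \<in> B; compact_slice G U; gdom G ` U \<inter> Z b = {}\<rbrakk> \<Longrightarrow> \<chi> U b = \<zero>"
      "\<And>b. b \<in> B \<Longrightarrow> Z b \<subseteq> orbit G x"
      by auto
    define Y where "Y = (\<Union>b\<in>B. Z b)"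
    have Y: "finite Y" using B Z by (simp add: Y_def)
    have zero: "\<chi> U m = \<zero>" if "m \<in> carrier M" and U: "compact_slice G U" "gdom G ` U \<inter> Y = {}" for m U
    proof -
      have "m \<in> mspan M B" using that(1) B(3) by simp
      then show ?thesis using B(2)
      proof (induction rule: mspan_induct)
        case (base b)
        then show ?case using Z(2)[OF base U(1)] U(2) by (auto simp: Y_def)
      qed (use U in \<open>auto simp: slice_act_simps\<close>)
    qed
    have "orbit G x \<subseteq> Y"
    proof (rule ccontr)
      assume "\<not> orbit G x \<subseteq> Y"
      then obtain t where t: "t \<in> L_fibre G x" "gran G t \<notin> Y" by (auto simp: orbit_def L_fibre_iff)
      then have t': "t \<in> arrows G" "gdom G t = x" by (auto simp: L_fibre_iff)
      obtain v where v: "v \<in> carrier V" "v \<noteq> \<zero>\<^bsub>V\<^esub>" using V V.zero_closed by blast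
      have Yu: "Y \<subseteq> units G" using Z(3) orbit_units by (auto simp: Y_def)
      have "openin (gtop G) {g \<in> arrows G. gdom G g \<in> units G - Y}"
        by (intro open_dom_preimage open_units_minus_finite Y Yu)
      then obtain U where U: "compact_slice G U" "ginv G t \<in> U" "U \<subseteq> {g \<in> arrows G. gdom G g \<in> units G - Y}"
        by (rule compact_slice_nbhd[where g = "ginv G t"]) (use t t' in auto)
      \<comment> \<open>The slice avoids \<open>Y\<close> and so kills the whole module; yet it
        contains the inverse of \<open>t\<close> and brings \<open>\<tau> t v\<close> to the
        non-zero element \<open>\<tau> x v\<close>.\<close>
      have "\<chi> U (\<tau> t v) = \<tau> x v"
        using ind_act[OF U(1,2) t(1) v(1)] t' by simp
      moreover have "\<chi> U (\<tau> t v) = \<zero>"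
        by (rule zero[OF ind_closed[OF t(1) v(1)] U(1)]) (use U(3) in auto)
      ultimately show False using ind_nonzero[OF v] by simp
    qed
    then show ?thesis using Y finite_subset by blast
  qed
  moreover have "finitely_generated V"
  proof -
    have sub: "submodule (\<tau> x ` carrier V) (scalars :: 'k ring) M"
      by (rule submodule_image[OF linear_map_ind[OF x_in_fibre] V.kmodule_axioms kmodule_axioms
            V.carrier_is_submodule])
    obtain C where C: "finite C" "C \<subseteq> \<tau> x ` carrier V" "mspan M C = \<tau> x ` carrier V"
      using submodule_finitely_generated[OF fld fg sub] .
    then obtain C' where C': "C' \<subseteq> carrier V" "finite C'" "C = \<tau> x ` C'"
      using finite_subset_image[OF C(1,2)] by blast
    have "\<tau> x ` mspan V C' = \<tau> x ` carrier V"
      using image_mspan[OF linear_map_ind[OF x_in_fibre] V.kmodule_axioms kmodule_axioms C'(1)] C C' by simp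
    then have "mspan V C' = carrier V"
      using inj_on_image_eq_iff[OF inj_ind V.mspan_subset_carrier[OF C'(1)]] by simp
    then show ?thesis using C' by (auto simp: finitely_generated_def)
  qed
  ultimately show "finite (orbit G x) \<and> finitely_generated V" ..
next
  assume "finite (orbit G x) \<and> finitely_generated V"
  then obtain B where orb: "finite (orbit G x)" and B: "finite B" "B \<subseteq> carrier V" "mspan V B = carrier V"
    by (auto simp: finitely_generated_def)
  \<comment> \<open>One arrow from \<open>x\<close> to each point of the orbit. Any other arrow with
    the same ends differs from it by an isotropy element, which is absorbed into
    \<open>V\<close>.\<close>
  define T where "T y = (SOME t. t \<in> L_fibre G x \<and> gran G t = y)" for y
  have T: "T y \<in> L_fibre G x \<and> gran G (T y) = y" if "y \<in> orbit G x" for y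
    unfolding T_def by (rule someI_ex) (use that in \<open>auto simp: orbit_def L_fibre_iff\<close>)
  define S where "S = (\<Union>y\<in>orbit G x. \<tau> (T y) ` B)"
  have S: "S \<subseteq> carrier M" "finite S" using T B orb ind_closed by (auto simp: S_def)
  have "{\<tau> t v | t v. t \<in> L_fibre G x \<and> v \<in> carrier V} \<subseteq> mspan M S"
  proof clarify
    fix t v assume t: "t \<in> L_fibre G x" and v: "v \<in> carrier V"
    define y where "y = gran G t"
    have y: "y \<in> orbit G x" using t by (auto simp: y_def orbit_def L_fibre_iff)
    define g where "g = ginv G (T y) \<cdot> t"
    have a: "t \<in> arrows G" "gdom G t = x" "T y \<in> arrows G" "gdom G (T y) = x" "gran G (T y) = gran G t"
      using t T[OF y] by (auto simp: L_fibre_iff y_def)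
    then have g: "g \<in> isotropy G x" "T y \<cdot> g = t" by (auto simp: g_def isotropy_iff)
    have "\<tau> t v = \<tau> (T y) (act V (delta g) v)"
      using ind_balanced[OF _ g(1) v, of "T y"] T[OF y] g(2) by simp
    also have "\<dots> \<in> \<tau> (T y) ` mspan V B" using B g v by auto
    also have "\<tau> (T y) ` mspan V B = mspan M (\<tau> (T y) ` B)"
      using image_mspan[OF linear_map_ind V.kmodule_axioms kmodule_axioms B(2)] T[OF y] by simp
    also have "\<dots> \<subseteq> mspan M S"
      by (rule mspan_mono[OF _ S(1)]) (use y mspan_superset[of S] in \<open>auto simp: S_def\<close>)
    finally show "\<tau> t v \<in> mspan M S" .
  qed
  then have "mspan M S = carrier M"
    using mspan_minimal[OF mspan_submodule[OF S(1)]] ind_span mspan_subset_carrier[OF S(1)] by blast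
  then show "finitely_generated M" using S by (auto simp: finitely_generated_def)
qed

end

text \<open>Both isotropy modules are identified with the restriction of \<open>M\<close> at
  \<open>x\<close>, which refers to neither structure. The isotropy actions agree there, because
  each of them is the action of a slice through the isotropy element.\<close>

lemma induced_module_isotropy_iso:
  assumes "induced_module G M x V \<tau>" "induced_module G M x V' \<tau>'"
  shows "alg_module_iso (isotropy_algebra G x) V V'"
proof -
  interpret I: induced_module G M x V \<tau> by fact
  interpret I': induced_module G M x V' \<tau>' by fact
  have bij: "bij_betw (\<tau> x) (carrier V) (Res G x M)" "bij_betw (\<tau>' x) (carrier V') (Res G x M)"
    using I.inj_ind I.Res_eq I'.inj_ind I'.Res_eq by (auto simp: bij_betw_def)
  define h where "h = inv_into (carrier V') (\<tau>' x) \<circ> \<tau> x"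
  have h: "bij_betw h (carrier V) (carrier V')"
    unfolding h_def by (intro bij_betw_trans[OF bij(1)] bij_betw_inv_into bij(2))
  have hV: "h v \<in> carrier V'" if "v \<in> carrier V" for v using h that by (auto simp: bij_betw_def)
  have h': "\<tau>' x (h v) = \<tau> x v" if "v \<in> carrier V" for v
    using bij_betw_inv_into_right[OF bij(2)] bij(1) that by (auto simp: h_def bij_betw_def)
  have eqI: "h v = w" if "v \<in> carrier V" "w \<in> carrier V'" "\<tau>' x w = \<tau> x v" for v w
    using inj_onD[OF I'.inj_ind, of "h v" w] that h'[of v] hV[of v] by simp
  show ?thesis
  proof (rule isotropy_module_isoI[OF I.V.isotropy_module_axioms I'.V.isotropy_module_axioms h])
    show "linear_map V V' h"
      unfolding linear_map_def
      by (intro conjI ballI allI eqI hV)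
        (auto simp: hV h' I.ind_add I.ind_smult I'.ind_add I'.ind_smult)
    fix g v assume g: "g \<in> isotropy G x" and v: "v \<in> carrier V"
    then have gL: "g \<in> L_fibre G x" by (simp add: I.isotropy_iff I.L_fibre_iff)
    obtain U where U: "compact_slice G U" "g \<in> U"
      using I.compact_slice_at g by (auto simp: I.isotropy_iff)
    have "\<tau>' x (act V' (delta g) (h v)) = act M (char_fun U) (\<tau>' x (h v))"
      using I'.ind_eq_slice_act[OF U gL] I'.ind_isotropy[OF g] hV[OF v] by simp
    also have "\<dots> = \<tau> x (act V (delta g) v)"
      using I.ind_eq_slice_act[OF U gL] I.ind_isotropy[OF g] v h'[OF v] by simp
    finally show "h (act V (delta g) v) = act V' (delta g) (h v)"
      using g v hV by (intro eqI) auto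
  qed
qed

section \<open>Transport of structure\<close>

lemma kmodule_transport:
  fixes M :: "('k::{comm_ring,comm_monoid_mult}, 'm, 'z) module_scheme" and N :: "('k, 'n, 'y) module_scheme"
  assumes "kmodule N" and C: "carrier M = h ` carrier N" and inj: "inj_on h (carrier N)"
    and zero: "h \<zero>\<^bsub>N\<^esub> = \<zero>\<^bsub>M\<^esub>"
    and add: "\<And>a b. \<lbrakk>a \<in> carrier N; b \<in> carrier N\<rbrakk> \<Longrightarrow> h a \<oplus>\<^bsub>M\<^esub> h b = h (a \<oplus>\<^bsub>N\<^esub> b)"
    and smult: "\<And>c a. a \<in> carrier N \<Longrightarrow> c \<odot>\<^bsub>M\<^esub> h a = h (c \<odot>\<^bsub>N\<^esub> a)"
  shows "kmodule M"
proof -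
  interpret N: kmodule N by fact
  note zero' = zero[symmetric]
  show ?thesis unfolding kmodule_def
  proof (rule moduleI)
    show "abelian_group M"
    proof (rule abelian_groupI)
      fix y assume "y \<in> carrier M"
      then obtain a where a: "a \<in> carrier N" "y = h a" using C by auto
      then show "\<exists>z\<in>carrier M. z \<oplus>\<^bsub>M\<^esub> y = \<zero>\<^bsub>M\<^esub>"
        by (intro bexI[of _ "h (\<ominus>\<^bsub>N\<^esub> a)"]) (auto simp: C add zero' N.M.l_neg)
    qed (auto simp: C add zero' N.M.a_ac)
  qed (auto simp: C add smult N.smult_distribs cring_scalars)
qed

text \<open>The operations of \<open>M\<close> are prescribed only on the image of \<open>h\<close>.
  This suits copies on another type, where they are arbitrary elsewhere.\<close>

lemma alg_mod_transport:
  fixes M :: "('k::{comm_ring,comm_monoid_mult}, 'a, 'm) alg_module" and N :: "('k, 'a, 'n) alg_module"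
    and A :: "('k, 'a, 'z) module_scheme"
  assumes "alg_mod A N" and C: "carrier M = h ` carrier N" and inj: "inj_on h (carrier N)"
    and zero: "h \<zero>\<^bsub>N\<^esub> = \<zero>\<^bsub>M\<^esub>"
    and add: "\<And>a b. \<lbrakk>a \<in> carrier N; b \<in> carrier N\<rbrakk> \<Longrightarrow> h a \<oplus>\<^bsub>M\<^esub> h b = h (a \<oplus>\<^bsub>N\<^esub> b)"
    and smult: "\<And>c a. a \<in> carrier N \<Longrightarrow> c \<odot>\<^bsub>M\<^esub> h a = h (c \<odot>\<^bsub>N\<^esub> a)"
    and act: "\<And>f a. a \<in> carrier N \<Longrightarrow> act M f (h a) = h (act N f a)"
  shows "alg_mod A M" and "alg_module_iso A N M"
proof -
  interpret N: alg_mod A N by fact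
  have kM: "kmodule M" by (rule kmodule_transport[OF N.kmodule_axioms C inj zero add smult])
  have lin: "linear_map N M h" by (simp add: linear_map_def C add smult)
  have "mspan M {act M a m | a m. a \<in> carrier A \<and> m \<in> carrier M} = carrier M"
  proof -
    have "{act M a m | a m. a \<in> carrier A \<and> m \<in> carrier M} =
        h ` {act N a m | a m. a \<in> carrier A \<and> m \<in> carrier N}"
      by (force simp: C act)
    moreover have "{act N a m | a m. a \<in> carrier A \<and> m \<in> carrier N} \<subseteq> carrier N"
      using N.act_closed by auto
    ultimately have "mspan M {act M a m | a m. a \<in> carrier A \<and> m \<in> carrier M} =
        h ` mspan N {act N a m | a m. a \<in> carrier A \<and> m \<in> carrier N}"
      by (simp only: image_mspan[OF lin N.kmodule_axioms kM])
    then show ?thesis using N.nondegenerate C by simp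
  qed
  then show "alg_mod A M"
    using kM unfolding kmodule_def
    by (intro alg_mod.intro alg_mod_axioms.intro)
      (auto simp: C add smult act N.act_closed N.act_add_left N.act_add_right N.act_smult_left
        N.act_smult_right N.act_mult)
  show "alg_module_iso A N M"
    unfolding alg_module_iso_def using C inj add smult act
    by (intro exI[of _ h]) (auto simp: bij_betw_def)
qed

section \<open>Isomorphism as an equivalence across types\<close>

lemma alg_module_isoE:
  assumes "alg_module_iso A M N"
  obtains h where "bij_betw h (carrier M) (carrier N)" "linear_map M N h"
    "\<forall>a\<in>carrier A. \<forall>m\<in>carrier M. h (act M a m) = act N a (h m)"
proof -
  from assms obtain h where h: "bij_betw h (carrier M) (carrier N)"
    "\<forall>m\<in>carrier M. \<forall>n\<in>carrier M. h (m \<oplus>\<^bsub>M\<^esub> n) = h m \<oplus>\<^bsub>N\<^esub> h n"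
    "\<forall>c. \<forall>m\<in>carrier M. h (c \<odot>\<^bsub>M\<^esub> m) = c \<odot>\<^bsub>N\<^esub> h m"
    "\<forall>a\<in>carrier A. \<forall>m\<in>carrier M. h (act M a m) = act N a (h m)"
    unfolding alg_module_iso_def by (elim exE conjE)
  have "linear_map M N h" using h(2,3) bij_betw_apply[OF h(1)] by (simp add: linear_map_def)
  then show ?thesis using h(1,4) that by blast
qed

lemma alg_module_isoI:
  assumes "bij_betw h (carrier M) (carrier N)" "linear_map M N h"
    "\<And>a m. \<lbrakk>a \<in> carrier A; m \<in> carrier M\<rbrakk> \<Longrightarrow> h (act M a m) = act N a (h m)"
  shows "alg_module_iso A M N"
  unfolding alg_module_iso_def using assms by (intro exI[of _ h]) (auto simp: linear_map_def)

lemma alg_module_iso_refl: "alg_module_iso A M M"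
  by (rule alg_module_isoI[of id]) (auto simp: linear_map_def)

lemma alg_module_iso_trans:
  assumes "alg_module_iso A M N" "alg_module_iso A N K"
  shows "alg_module_iso A M K"
proof -
  obtain h where h: "bij_betw h (carrier M) (carrier N)" "linear_map M N h"
    "\<forall>a\<in>carrier A. \<forall>m\<in>carrier M. h (act M a m) = act N a (h m)"
    using assms(1) by (rule alg_module_isoE)
  obtain k where k: "bij_betw k (carrier N) (carrier K)" "linear_map N K k"
    "\<forall>a\<in>carrier A. \<forall>m\<in>carrier N. k (act N a m) = act K a (k m)"
    using assms(2) by (rule alg_module_isoE)
  note D = linear_mapD[OF h(2)] linear_mapD[OF k(2)]
  show ?thesis
    by (rule alg_module_isoI[of "k \<circ> h"])
      (auto simp: linear_map_def D h(3) k(3) intro: bij_betw_trans[OF h(1) k(1)])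
qed

lemma alg_module_iso_sym:
  assumes "alg_module_iso A M N" "alg_mod A M"
  shows "alg_module_iso A N M"
proof -
  interpret M: alg_mod A M by fact
  obtain h where h: "bij_betw h (carrier M) (carrier N)" "linear_map M N h"
    "\<forall>a\<in>carrier A. \<forall>m\<in>carrier M. h (act M a m) = act N a (h m)"
    using assms(1) by (rule alg_module_isoE)
  note D = linear_mapD[OF h(2)]
  define k where "k = inv_into (carrier M) h"
  have kb: "bij_betw k (carrier N) (carrier M)" unfolding k_def using h(1) by (rule bij_betw_inv_into)
  have kM: "k n \<in> carrier M" and hk: "h (k n) = n" if "n \<in> carrier N" for n
    using that kb bij_betw_inv_into_right[OF h(1)] by (auto simp: k_def bij_betw_def)
  have eqI: "k n = m" if "m \<in> carrier M" "h m = n" for m n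
    using bij_betw_inv_into_left[OF h(1)] that by (auto simp: k_def)
  show ?thesis
    by (rule alg_module_isoI[OF kb])
      (auto simp: linear_map_def kM hk D h(3) M.act_closed intro!: eqI)
qed

text \<open>The class of an induced module, whose elements are cosets, can by this be named by an
  isomorphic module on another type.\<close>

lemma iso_class_eq:
  fixes M :: "('k::{comm_ring,comm_monoid_mult}, 'a, 'm) alg_module" and N :: "('k, 'a, 'n) alg_module"
  assumes "alg_module_iso A M N" "alg_mod A M"
  shows "iso_class A M = (iso_class A N :: ('k, 'a, 'p) alg_module set)"
  unfolding iso_class_def
  using alg_module_iso_trans[OF assms(1)] alg_module_iso_trans[OF alg_module_iso_sym[OF assms]] by blast

lemma induced_module_transport:
  assumes "induced_module G M x V \<tau>" "alg_mod (groupoid_algebra G) M'"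
    "bij_betw h (carrier M) (carrier M')" "linear_map M M' h"
    "\<And>a m. \<lbrakk>a \<in> carrier (groupoid_algebra G); m \<in> carrier M\<rbrakk> \<Longrightarrow> h (act M a m) = act M' a (h m)"
  shows "induced_module G M' x V (\<lambda>t v. h (\<tau> t v))"
proof -
  interpret I: induced_module G M x V \<tau> by fact
  interpret M': alg_mod "groupoid_algebra G" M' by fact
  note h = linear_mapD[OF assms(4)] linear_map_zero[OF assms(4) I.kmodule_axioms M'.kmodule_axioms]
  have act: "act M' (char_fun U) (h m) = h (act M (char_fun U) m)"
    if "compact_slice G U" "m \<in> carrier M" for U m
    using assms(5) that I.groupoid_algebra_closed(2) by metis
  have inj: "inj_on h (carrier M)" and im: "h ` carrier M = carrier M'"
    using assms(3) by (auto simp: bij_betw_def)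
  show ?thesis
  proof unfold_locales
    show "x \<in> units G" by (rule I.x_unit)
    have "{h (\<tau> t v) |t v. t \<in> L_fibre G x \<and> v \<in> carrier V} =
        h ` {\<tau> t v |t v. t \<in> L_fibre G x \<and> v \<in> carrier V}" by auto
    then show "mspan M' {h (\<tau> t v) |t v. t \<in> L_fibre G x \<and> v \<in> carrier V} = carrier M'"
      using image_mspan[OF assms(4) I.kmodule_axioms M'.kmodule_axioms I.generators_subset] I.ind_span im
      by simp
    fix v assume v: "v \<in> carrier V" and "h (\<tau> x v) = \<zero>\<^bsub>M'\<^esub>"
    then have "\<tau> x v = \<zero>\<^bsub>M\<^esub>"
      using inj_onD[OF inj, of "\<tau> x v" "\<zero>\<^bsub>M\<^esub>"] h I.ind_closed by simp
    then show "v = \<zero>\<^bsub>V\<^esub>" using I.ind_inj v by blast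
  qed (simp_all add: h act I.ind_closed I.ind_add I.ind_smult I.ind_act I.ind_act_0 I.ind_balanced[symmetric])
qed

text \<open>Pulling the structure back along an isomorphism of isotropy modules is what makes
  induction depend only on the isomorphism class of \<open>V\<close>.\<close>

lemma induced_module_isotropy_transport:
  assumes "induced_module G M x V \<tau>" "alg_mod (isotropy_algebra G x) V'"
    "bij_betw h (carrier V') (carrier V)" "linear_map V' V h"
    "\<And>a m. \<lbrakk>a \<in> carrier (isotropy_algebra G x); m \<in> carrier V'\<rbrakk> \<Longrightarrow> h (act V' a m) = act V a (h m)"
  shows "induced_module G M x V' (\<lambda>t v. \<tau> t (h v))"
proof -
  interpret I: induced_module G M x V \<tau> by fact
  interpret V': alg_mod "isotropy_algebra G x" V' by fact
  note h = linear_mapD[OF assms(4)] linear_map_zero[OF assms(4) V'.kmodule_axioms I.V.kmodule_axioms]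
  have act: "h (act V' (delta g) m) = act V (delta g) (h m)"
    if "g \<in> isotropy G x" "m \<in> carrier V'" for g m
    using assms(5) that I.V.delta_closed by metis
  have inj: "inj_on h (carrier V')" and im: "h ` carrier V' = carrier V"
    using assms(3) by (auto simp: bij_betw_def)
  show ?thesis
  proof unfold_locales
    show "x \<in> units G" by (rule I.x_unit)
    have "{\<tau> t (h v) |t v. t \<in> L_fibre G x \<and> v \<in> carrier V'} =
        {\<tau> t v |t v. t \<in> L_fibre G x \<and> v \<in> carrier V}" using im[symmetric] by auto
    then show "mspan M {\<tau> t (h v) |t v. t \<in> L_fibre G x \<and> v \<in> carrier V'} = carrier M"
      using I.ind_span by simp
    fix v assume v: "v \<in> carrier V'" and "\<tau> x (h v) = \<zero>\<^bsub>M\<^esub>"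
    then have "h v = h \<zero>\<^bsub>V'\<^esub>" using I.ind_inj h by simp
    then show "v = \<zero>\<^bsub>V'\<^esub>" using inj_onD[OF inj] v by blast
  qed (simp_all add: h act I.ind_closed I.ind_add I.ind_smult I.ind_act I.ind_act_0 I.ind_balanced)
qed


section \<open>Restriction of simple modules\<close>

text \<open>
  For \<open>v\<close> in \<open>Res G x M\<close> and \<open>t\<close> in \<open>L_fibre G x\<close> the choice of the slice around \<open>t\<close> is irrelevant;
  the value is the image of \<open>t \<otimes> v\<close> in \<open>M\<close>.
\<close>

definition translate where
  "translate G M t v = act M (char_fun (SOME U. compact_slice G U \<and> t \<in> U)) v"

text \<open>Only the carrier and the action are replaced, so sums, multiples and the zero are
  literally those of \<open>M\<close>.\<close>

definition res_module ::
  "'g top_groupoid \<Rightarrow> 'g \<Rightarrow> ('k::{comm_ring,comm_monoid_mult}, 'g \<Rightarrow> 'k, 'm) alg_module \<Rightarrow>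
     ('k, 'g \<Rightarrow> 'k, 'm) alg_module" where
  "res_module G x M =
     M\<lparr>carrier := Res G x M, act := (\<lambda>a v. lin_comb M (\<lambda>g. translate G M g v) a)\<rparr>"

lemma res_module_simps [simp]:
  "carrier (res_module G x M) = Res G x M"
  "\<zero>\<^bsub>res_module G x M\<^esub> = \<zero>\<^bsub>M\<^esub>"
  "u \<oplus>\<^bsub>res_module G x M\<^esub> v = u \<oplus>\<^bsub>M\<^esub> v"
  "c \<odot>\<^bsub>res_module G x M\<^esub> v = c \<odot>\<^bsub>M\<^esub> v"
  "act (res_module G x M) a v = lin_comb M (\<lambda>g. translate G M g v) a"
  by (simp_all add: res_module_def)

locale groupoid_module_at = groupoid_module G M
  for G :: "'g top_groupoid" and M :: "('k::{comm_ring,comm_monoid_mult}, 'g \<Rightarrow> 'k, 'm) alg_module" (structure) +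
  fixes x assumes x_unit: "x \<in> units G"
begin

abbreviation R where "R \<equiv> Res G x M"

abbreviation tr where "tr \<equiv> translate G M"

lemma Res_closed: "v \<in> R \<Longrightarrow> v \<in> carrier M"
  by (simp add: Res_iff)

lemma Res_unit: "\<lbrakk>v \<in> R; compact_slice G W; W \<subseteq> units G; x \<in> W\<rbrakk> \<Longrightarrow> \<chi> W v = v"
  by (simp add: Res_iff)

lemma Res_submodule: "submodule R (scalars :: 'k ring) M"
  by (rule submodule_scalarsI) (auto simp: Res_iff slice_act_simps)

lemma kmodule_Res: "kmodule (res_module G x M)"
  by (rule kmodule_transport[OF kmodule_subset[OF kmodule_axioms Res_submodule], where h = id])
    (auto simp: res_module_def)

text \<open>\<open>v\<close> is fixed by the characteristic function of d(V), because d(V) contains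
  \<open>x\<close>; and multiplying \<open>U\<close> by d(V) cuts it down to
  \<open>V\<close>.\<close>

lemma slice_act_subset_Res:
  assumes "compact_slice G U" "compact_slice G V" "V \<subseteq> U" "t \<in> V" "t \<in> L_fibre G x" "v \<in> R"
  shows "\<chi> U v = \<chi> V v"
proof -
  have "x \<in> gdom G ` V" using assms(4,5) by (force simp: L_fibre_iff)
  then have "\<chi> U v = \<chi> U (\<chi> (gdom G ` V) v)"
    using Res_unit[OF assms(6) compact_slice_dom[OF assms(2)] dom_image_units[OF assms(2)]] by simp
  also have "\<dots> = \<chi> V v"
    using assms Res_closed
    by (simp add: slice_act_mult compact_slice_dom gprod_subset_dom compact_slice_slice)
  finally show ?thesis .
qed

text \<open>Two compact slices through \<open>t\<close> need not have a compact intersection, but it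
  is open and so contains a compact slice through \<open>t\<close>. Both slices agree with this one
  on the restriction.\<close>

lemma slice_act_Res:
  assumes "compact_slice G U" "t \<in> U" "t \<in> L_fibre G x" "v \<in> R"
  shows "\<chi> U v = tr t v"
proof -
  define U' where "U' = (SOME U. compact_slice G U \<and> t \<in> U)"
  have "compact_slice G U' \<and> t \<in> U'" unfolding U'_def by (rule someI[of _ U]) (use assms in auto)
  then have U': "compact_slice G U'" "t \<in> U'" by auto
  have "openin (gtop G) (U \<inter> U')" using assms U' compact_slice_open by blast
  then obtain V where V: "compact_slice G V" "t \<in> V" "V \<subseteq> U \<inter> U'"
    by (rule compact_slice_nbhd[where g = t]) (use assms U' in auto)
  have "\<chi> U v = \<chi> V v" "\<chi> U' v = \<chi> V v"
    by (rule slice_act_subset_Res[OF _ V(1) _ V(2) assms(3,4)]; use assms(1) U'(1) V(3) in blast)+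
  then show ?thesis by (simp add: translate_def U'_def)
qed

lemma fibre_slice:
  assumes "t \<in> L_fibre G x"
  obtains U where "compact_slice G U" "t \<in> U"
proof -
  have "t \<in> arrows G" using assms by (simp add: L_fibre_iff)
  then show ?thesis by (rule compact_slice_at) (rule that)
qed

lemma translate_closed:
  assumes "t \<in> L_fibre G x" "v \<in> R"
  shows "tr t v \<in> carrier M"
proof -
  obtain U where "compact_slice G U" "t \<in> U" using fibre_slice[OF assms(1)] .
  then show ?thesis using slice_act_Res[OF _ _ assms] Res_closed[OF assms(2)] slice_act_closed by metis
qed

lemma translate_linear:
  assumes "t \<in> L_fibre G x" "v \<in> R"
  shows "w \<in> R \<Longrightarrow> tr t (v \<oplus> w) = tr t v \<oplus> tr t w" "tr t (c \<odot> v) = c \<odot> tr t v"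
proof -
  obtain U where U: "compact_slice G U" "t \<in> U" using fibre_slice[OF assms(1)] .
  note E = submodule_scalarsE[OF Res_submodule]
  show "tr t (v \<oplus> w) = tr t v \<oplus> tr t w" if "w \<in> R"
    using that E assms Res_closed U
    by (simp add: slice_act_Res[OF U assms(1), symmetric] slice_act_simps)
  show "tr t (c \<odot> v) = c \<odot> tr t v"
    using E assms Res_closed U
    by (simp add: slice_act_Res[OF U assms(1), symmetric] slice_act_simps)
qed

lemma translate_act:
  assumes "compact_slice G U" "u \<in> U" "t \<in> L_fibre G x" "v \<in> R" "gdom G u = gran G t"
  shows "\<chi> U (tr t v) = tr (u \<cdot> t) v"
proof -
  obtain T where T: "compact_slice G T" "t \<in> T" using fibre_slice[OF assms(3)] .
  have "u \<cdot> t \<in> L_fibre G x"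
    using assms slice_arrow[OF compact_slice_slice[OF assms(1)]] by (simp add: L_fibre_iff)
  moreover have "u \<cdot> t \<in> gprod G U T" using assms T by (intro gprodI)
  ultimately show ?thesis
    using assms T Res_closed
    by (simp add: slice_act_Res[OF T assms(3), symmetric] slice_act_mult
        slice_act_Res[OF compact_slice_gprod[OF assms(1) T(1)], symmetric])
qed

text \<open>\<open>tr t v\<close> may be computed with any compact slice through \<open>t\<close>.
  One is chosen whose ranges avoid the closed set d(U), and then its product with \<open>U\<close>
  is empty.\<close>

lemma translate_act_0:
  assumes "compact_slice G U" "t \<in> L_fibre G x" "v \<in> R" "gran G t \<notin> gdom G ` U"
  shows "\<chi> U (tr t v) = \<zero>"
proof -
  have "openin (gtop G) (units G - gdom G ` U)"
    using compact_slice_dom[OF assms(1)] dom_image_units[OF assms(1)]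
    by (intro open_units_diff) (auto simp: compact_slice_def)
  then have "openin (gtop G) {g \<in> arrows G. gran G g \<in> units G - gdom G ` U}"
    by (rule open_ran_preimage)
  then obtain T where T: "compact_slice G T" "t \<in> T" "T \<subseteq> {g \<in> arrows G. gran G g \<in> units G - gdom G ` U}"
    by (rule compact_slice_nbhd[where g = t]) (use assms in \<open>auto simp: L_fibre_iff\<close>)
  have "gprod G U T = {}" using T(3) by (force simp: gprod_def)
  moreover have "(char_fun {} :: 'g \<Rightarrow> 'k) = (\<lambda>s. 0)" by (auto simp: char_fun_def)
  ultimately show ?thesis
    using assms T Res_closed
    by (simp add: slice_act_Res[OF T(1,2) assms(2), symmetric] slice_act_mult act_simps)
qed

lemma x_in_fibre: "x \<in> L_fibre G x"
  using x_unit by (simp add: L_fibre_iff)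

lemma translate_unit:
  assumes "v \<in> R"
  shows "tr x v = v"
proof -
  obtain U where U: "compact_slice G U" "x \<in> U" "U \<subseteq> units G"
    by (rule compact_units_slice[OF open_units x_unit x_unit])
  show ?thesis using slice_act_Res[OF U(1,2) x_in_fibre assms] Res_unit[OF assms U(1,3,2)] by simp
qed

lemma translate_ran:
  assumes "t \<in> L_fibre G x" "v \<in> R"
  shows "tr t v \<in> Res G (gran G t) M"
proof -
  have "\<chi> W (tr t v) = tr t v" if "compact_slice G W" "W \<subseteq> units G" "gran G t \<in> W" for W
    using translate_act[OF that(1,3) assms] assms that by (simp add: L_fibre_iff)
  then show ?thesis using translate_closed[OF assms] by (simp add: Res_iff)
qed

text \<open>A slice through the inverse of \<open>t\<close> brings \<open>tr t v\<close> back to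
  \<open>v\<close>.\<close>

lemma translate_nonzero:
  assumes "t \<in> L_fibre G x" "v \<in> R" "tr t v = \<zero>"
  shows "v = \<zero>"
proof -
  have t: "t \<in> arrows G" "gdom G t = x" using assms(1) by (auto simp: L_fibre_iff)
  then have "ginv G t \<in> arrows G" by simp
  then obtain U where U: "compact_slice G U" "ginv G t \<in> U" by (rule compact_slice_at)
  have "\<chi> U (tr t v) = tr x v" using translate_act[OF U assms(1,2)] t by simp
  then show ?thesis using assms U translate_unit by (simp add: slice_act_simps)
qed

lemma isotropy_fibre: "g \<in> isotropy G x \<Longrightarrow> g \<in> L_fibre G x \<and> gran G g = x"
  by (simp add: isotropy_iff L_fibre_iff)

lemma translate_isotropy: "\<lbrakk>g \<in> isotropy G x; v \<in> R\<rbrakk> \<Longrightarrow> tr g v \<in> R"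
  using translate_ran[of g v] isotropy_fibre by auto

lemma translate_mul:
  assumes "t \<in> L_fibre G x" "g \<in> isotropy G x" "v \<in> R"
  shows "tr t (tr g v) = tr (t \<cdot> g) v"
proof -
  obtain U where U: "compact_slice G U" "t \<in> U" using fibre_slice[OF assms(1)] .
  have "tr t (tr g v) = \<chi> U (tr g v)"
    using slice_act_Res[OF U assms(1) translate_isotropy[OF assms(2,3)]] by simp
  also have "\<dots> = tr (t \<cdot> g) v"
    using translate_act[OF U _ assms(3), of g] assms by (simp add: L_fibre_iff isotropy_iff)
  finally show ?thesis .
qed

section \<open>The isotropy group algebra acting on the restriction\<close>

definition res_act where "res_act a v = lin_comb M (\<lambda>g. tr g v) a"

lemma linear_map_res_act:
  assumes "v \<in> R"
  shows "linear_map (free_module (isotropy G x)) M (\<lambda>a. res_act a v)"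
  unfolding res_act_def
  using linear_map_lin_comb[of "isotropy G x" "\<lambda>g. tr g v"] translate_isotropy[OF _ assms] Res_closed
  by blast

lemma res_act_left:
  assumes "v \<in> R" "a \<in> carrier (free_module (isotropy G x))"
  shows "res_act a v \<in> carrier M"
    "b \<in> carrier (free_module (isotropy G x)) \<Longrightarrow> res_act (\<lambda>s. a s + b s) v = res_act a v \<oplus> res_act b v"
    "res_act (\<lambda>s. c * a s) v = c \<odot> res_act a v"
  using linear_mapD[OF linear_map_res_act[OF assms(1)]] assms(2) by simp_all

lemma res_act_zero: "v \<in> R \<Longrightarrow> res_act (\<lambda>s. 0) v = \<zero>"
  using linear_map_zero[OF linear_map_res_act kmodule_free_module kmodule_axioms] by simp

lemma res_act_delta: "\<lbrakk>g \<in> isotropy G x; v \<in> R\<rbrakk> \<Longrightarrow> res_act (delta g) v = tr g v"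
  unfolding res_act_def using translate_isotropy Res_closed by (intro lin_comb_delta) blast

lemma res_act_closed:
  assumes "a \<in> carrier (free_module (isotropy G x))" "v \<in> R"
  shows "res_act a v \<in> R"
  using assms(1)
proof (induction rule: free_module_induct)
  case zero
  then show ?case
    using res_act_zero[OF assms(2)] submodule_scalarsE[OF Res_submodule] by simp
next
  case (delta g)
  then show ?case using assms(2) translate_isotropy res_act_delta by simp
next
  case (add a b)
  then show ?case
    using res_act_left(2)[OF assms(2), of a b] submodule_scalarsE[OF Res_submodule] by simp
next
  case (smult c a)
  then show ?case
    using res_act_left(3)[OF assms(2), of a c] submodule_scalarsE[OF Res_submodule] by simp
qed

lemma res_act_right:
  assumes "a \<in> carrier (free_module (isotropy G x))" "v \<in> R" "w \<in> R"
  shows "res_act a (v \<oplus> w) = res_act a v \<oplus> res_act a w" "res_act a (c \<odot> v) = c \<odot> res_act a v"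
proof -
  note E = submodule_scalarsE[OF Res_submodule]
  have vw: "v \<oplus> w \<in> R" "c \<odot> v \<in> R" using E assms by auto
  note cl = res_act_closed[THEN Res_closed]
  show "res_act a (v \<oplus> w) = res_act a v \<oplus> res_act a w"
    using assms(1)
  proof (induction rule: free_module_induct)
    case zero
    then show ?case using assms vw by (simp add: res_act_zero)
  next
    case (delta g)
    then show ?case using assms vw isotropy_fibre by (simp add: res_act_delta translate_linear)
  next
    case (add a b)
    then show ?case
      using assms vw cl[OF add(1)] cl[OF add(2)]
      by (simp add: res_act_left M.a_ac)
  next
    case (smult d a)
    then show ?case
      using assms vw cl[OF smult(1)] by (simp add: res_act_left smult_distribs)
  qed
  show "res_act a (c \<odot> v) = c \<odot> res_act a v"
    using assms(1)
  proof (induction rule: free_module_induct)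
    case zero
    then show ?case using assms vw by (simp add: res_act_zero)
  next
    case (delta g)
    then show ?case using assms vw isotropy_fibre by (simp add: res_act_delta translate_linear)
  next
    case (add a b)
    then show ?case
      using assms vw cl[OF add(1)] cl[OF add(2)]
      by (simp add: res_act_left smult_distribs)
  next
    case (smult d a)
    then show ?case
      using assms vw cl[OF smult(1)] by (simp add: res_act_left smult_distribs(3)[symmetric] mult.commute)
  qed
qed

text \<open>Bilinearity leaves two isotropy elements, for which the claim is
  \<open>translate_mul\<close>.\<close>

lemma res_act_mult:
  assumes "a \<in> carrier (free_module (isotropy G x))" "b \<in> carrier (free_module (isotropy G x))" "v \<in> R"
  shows "res_act (bilinear_mul G a b) v = res_act a (res_act b v)"
proof -
  note E = submodule_scalarsE[OF Res_submodule]
  have bcl: "bilinear_mul G a b \<in> carrier (free_module (isotropy G x))"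
    if "a \<in> carrier (free_module (isotropy G x))" "b \<in> carrier (free_module (isotropy G x))" for a b :: "'g \<Rightarrow> 'k"
    using that
  proof (induction rule: free_module_induct)
    case (delta g)
    from delta(2,1) show ?case
    proof (induction rule: free_module_induct)
      case (delta h)
      then have "g \<cdot> h \<in> isotropy G x" by (simp add: isotropy_iff)
      then show ?case unfolding bilinear_mul_delta by (rule delta_in_free_module)
    qed (auto simp: bilinear_mul_right finite_support_add finite_support_mult)
  qed (auto simp: bilinear_mul_left finite_support_add finite_support_mult)
  show ?thesis using assms(1,2)
  proof (induction rule: free_module_induct)
    case (delta g)
    note g = delta(1)
    note dg = delta_in_free_module[OF g, where 'b = 'k]
    from delta(2) show ?case
    proof (induction rule: free_module_induct)
      case zero
      then show ?case
        \<comment> \<open>That the action sends zero to zero is read off from compatibility with the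
          scalar 0.\<close>
        using assms(3) E(2) res_act_right(2)[OF dg E(2) E(2), of 0] res_act_closed[OF dg E(2), THEN Res_closed]
        by (simp add: bilinear_mul_right res_act_zero)
    next
      case (delta h)
      then have "g \<cdot> h \<in> isotropy G x" using g by (simp add: isotropy_iff)
      then show ?case using g delta assms(3)
        by (simp add: bilinear_mul_delta res_act_delta translate_isotropy translate_mul isotropy_fibre)
    next
      case (add b c)
      then show ?case
        using assms(3) res_act_right(1)[OF dg res_act_closed[OF add(1) assms(3)] res_act_closed[OF add(2) assms(3)]]
          bcl[OF dg add(1)] bcl[OF dg add(2)]
        by (simp add: bilinear_mul_right res_act_left)
    next
      case (smult c b)
      then show ?case
        using assms(3) res_act_right(2)[OF dg res_act_closed[OF smult(1) assms(3)] res_act_closed[OF smult(1) assms(3)]]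
          bcl[OF dg smult(1)]
        by (simp add: bilinear_mul_right res_act_left)
    qed
  next
    case zero
    then show ?case
      using assms(3) res_act_closed[OF zero assms(3)] by (simp add: bilinear_mul_left res_act_zero)
  next
    case (add a c)
    then show ?case
      using assms(3) res_act_closed[OF add(5) assms(3)] bcl[OF add(1,5)] bcl[OF add(2,5)]
      by (simp add: bilinear_mul_left res_act_left)
  next
    case (smult c a)
    then show ?case
      using assms(3) res_act_closed[OF smult(3) assms(3)] bcl[OF smult(1,3)]
      by (simp add: bilinear_mul_left res_act_left)
  qed
qed

lemma res_module_act: "act (res_module G x M) a v = res_act a v"
  by (simp add: res_act_def)

lemma alg_mod_res_module: "alg_mod (isotropy_algebra G x) (res_module G x M)"
proof -
  interpret K: kmodule "res_module G x M" by (rule kmodule_Res)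
  have "mspan (res_module G x M)
      {act (res_module G x M) a m |a m. a \<in> carrier (isotropy_algebra G x) \<and> m \<in> R} = R" (is "mspan _ ?S = _")
  proof
    have "?S \<subseteq> carrier (res_module G x M)"
      using res_act_closed unfolding res_module_act isotropy_algebra_simps(5) by auto
    from K.mspan_subset_carrier[OF this] show "mspan (res_module G x M) ?S \<subseteq> R" by simp
    have "R \<subseteq> ?S"
    proof
      fix v assume v: "v \<in> R"
      have "x \<in> isotropy G x" using x_unit by (simp add: isotropy_iff)
      then have "v = act (res_module G x M) (delta x) v" "delta x \<in> carrier (isotropy_algebra G x)"
        using v unfolding res_module_act isotropy_algebra_simps(5)
        by (simp_all only: res_act_delta translate_unit delta_in_free_module)
      then show "v \<in> ?S" using v by blast
    qed
    then show "R \<subseteq> mspan (res_module G x M) ?S" using K.mspan_superset[of ?S] by (rule order_trans)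
  qed
  then show ?thesis
    using kmodule_Res unfolding kmodule_def
    by (intro alg_mod.intro alg_mod_axioms.intro)
      (simp_all only: res_module_act isotropy_algebra_simps res_module_simps(1-4) res_act_closed
        res_act_right res_act_mult res_act_left)
qed

text \<open>Slices move translates of \<open>N\<close> to translates of \<open>N\<close> or kill
  them, so their span is a submodule, and it contains \<open>n\<close>. \<open>N\<close> is a mere
  subset so that the result serves for the whole restriction as well as for a submodule of
  it.\<close>

lemma span_translates:
  assumes simp: "simple_module (groupoid_algebra G) M" and N: "N \<subseteq> R" "n \<in> N" "n \<noteq> \<zero>"
  shows "mspan M {tr t v | t v. t \<in> L_fibre G x \<and> v \<in> N} = carrier M"
proof -
  let ?S = "{tr t v | t v. t \<in> L_fibre G x \<and> v \<in> N}"
  have S: "?S \<subseteq> carrier M" using translate_closed N by auto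
  note E = submodule_scalarsE[OF mspan_submodule[OF S]]
  have "alg_submodule (groupoid_algebra G) M (mspan M ?S)"
  proof (rule alg_submoduleI[OF mspan_submodule[OF S]])
    fix U m assume U: "compact_slice G U" and "m \<in> mspan M ?S"
    from this(2) S show "\<chi> U m \<in> mspan M ?S"
    proof (induction rule: mspan_induct)
      case (base s)
      then obtain t v where s: "s = tr t v" "t \<in> L_fibre G x" "v \<in> N" "v \<in> R" using N by auto
      show ?case
      proof (cases "gran G t \<in> gdom G ` U")
        case True
        then obtain u where u: "u \<in> U" "gdom G u = gran G t" by force
        then have "u \<cdot> t \<in> L_fibre G x"
          using s slice_arrow[OF compact_slice_slice[OF U]] by (simp add: L_fibre_iff)
        moreover have "\<chi> U s = tr (u \<cdot> t) v" using translate_act[OF U u(1) s(2,4) u(2)] s(1) by simp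
        ultimately have "\<chi> U s \<in> ?S" using s(3) by blast
        then show ?thesis by (rule subsetD[OF mspan_superset])
      next
        case False
        then show ?thesis using translate_act_0[OF U s(2,4)] s(1) E(2) by simp
      qed
    qed (use U E in \<open>auto simp: slice_act_simps\<close>)
  qed
  moreover have "n \<in> ?S" using N translate_unit[of n] x_in_fibre by force
  then have "n \<in> mspan M ?S" by (rule subsetD[OF mspan_superset])
  ultimately show ?thesis using simp N(3) unfolding simple_module_def by blast
qed

text \<open>For simplicity, let \<open>n\<close> be a non-zero element of a submodule
  \<open>N\<close>. Then the translates of \<open>N\<close> span \<open>M\<close>. Small slices
  through \<open>x\<close> send them into \<open>N\<close>: those at isotropy elements stay in
  \<open>N\<close>, the others are killed. An element of the restriction is fixed by such slices
  made of units, hence lies in \<open>N\<close>.\<close>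

lemma induced_res_module:
  assumes "simple_module (groupoid_algebra G) M" "R \<noteq> {\<zero>}"
  shows "induced_module G M x (res_module G x M) tr"
    and "simple_module (isotropy_algebra G x) (res_module G x M)"
proof -
  interpret V: alg_mod "isotropy_algebra G x" "res_module G x M" by (rule alg_mod_res_module)
  note E = submodule_scalarsE[OF Res_submodule]
  obtain n where n: "n \<in> R" "n \<noteq> \<zero>" using assms(2) E(2) by blast
  show "induced_module G M x (res_module G x M) tr"
  proof unfold_locales
    show "mspan M {tr t v |t v. t \<in> L_fibre G x \<and> v \<in> carrier (res_module G x M)} = carrier M"
      using span_translates[OF assms(1) order_refl n] by simp
    fix t g v assume "t \<in> L_fibre G x" "g \<in> isotropy G x" "v \<in> carrier (res_module G x M)"
    then show "tr (t \<cdot> g) v = tr t (act (res_module G x M) (delta g) v)"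
      unfolding res_module_act by (simp add: res_act_delta translate_mul)
  qed (use x_unit translate_unit in \<open>auto simp: translate_closed translate_linear translate_act translate_act_0\<close>)
  show "simple_module (isotropy_algebra G x) (res_module G x M)"
    unfolding simple_module_def
  proof (intro conjI allI impI)
    show "alg_mod (isotropy_algebra G x) (res_module G x M)" by (rule alg_mod_res_module)
    show "carrier (res_module G x M) \<noteq> {\<zero>\<^bsub>res_module G x M\<^esub>}" using assms(2) by simp
    fix N assume N: "alg_submodule (isotropy_algebra G x) (res_module G x M) N"
    then have NE: "N \<subseteq> R" "\<zero> \<in> N" "\<And>a b. \<lbrakk>a \<in> N; b \<in> N\<rbrakk> \<Longrightarrow> a \<oplus> b \<in> N" "\<And>c a. a \<in> N \<Longrightarrow> c \<odot> a \<in> N"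
      using V.submodule_scalarsE[of N] by (simp_all add: alg_submodule_def)
    have Nact: "tr g v \<in> N" if g: "g \<in> isotropy G x" and "v \<in> N" for g v
    proof -
      have "(delta g :: 'g \<Rightarrow> 'k) \<in> carrier (isotropy_algebra G x)"
        using g by (simp only: isotropy_algebra_simps delta_in_free_module)
      then have "act (res_module G x M) (delta g) v \<in> N" using N that(2) by (simp only: alg_submodule_def)
      then show ?thesis unfolding res_module_act using res_act_delta[OF g, of v] NE(1) that(2) by auto
    qed
    show "N = {\<zero>\<^bsub>res_module G x M\<^esub>} \<or> N = carrier (res_module G x M)"
    proof (rule disjCI)
      assume "N \<noteq> carrier (res_module G x M)"
      then obtain v where v: "v \<in> R" "v \<notin> N" using NE(1) by auto
      have "n = \<zero>" if n: "n \<in> N" for n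
      proof (rule ccontr)
        assume "n \<noteq> \<zero>"
        let ?S = "{tr t v | t v. t \<in> L_fibre G x \<and> v \<in> N}"
        have "v \<in> mspan M ?S"
          using span_translates[OF assms(1) NE(1) n \<open>n \<noteq> \<zero>\<close>] Res_closed[OF v(1)] by simp
        moreover have "?S \<subseteq> carrier M" using translate_closed NE(1) by auto
        ultimately have "\<exists>W. openin (gtop G) W \<and> x \<in> W \<and>
            (\<forall>U. compact_slice G U \<and> x \<in> U \<and> U \<subseteq> W \<longrightarrow> \<chi> U v \<in> N)"
        proof (induction rule: mspan_induct)
          case zero
          then show ?case using NE(2) x_unit
            by (intro exI[of _ "arrows G"]) (auto simp: slice_act_simps)
        next
          case (base s)
          then obtain t w where s: "s = tr t w" "t \<in> L_fibre G x" "w \<in> N" "w \<in> R" using NE(1) by auto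
          show ?case
          proof (cases "gran G t = x")
            case True
            then have t: "t \<in> isotropy G x" using s(2) by (simp add: isotropy_iff L_fibre_iff)
            have "\<chi> U s = s" if "compact_slice G U" "x \<in> U" for U
              using translate_act[OF that s(2,4)] s True x_unit by (simp add: L_fibre_iff)
            then show ?thesis using Nact[OF t s(3)] x_unit s(1)
              by (intro exI[of _ "arrows G"]) auto
          next
            case False
            obtain W where W: "openin (gtop G) W" "x \<in> W" "\<And>h. h \<in> W \<Longrightarrow> gdom G h \<noteq> gran G t"
              by (rule separate_units[of x "gran G t"]) (use s False x_unit in \<open>auto simp: L_fibre_iff\<close>)
            have "\<chi> U s = \<zero>" if "compact_slice G U" "U \<subseteq> W" for U
            proof -
              have "gran G t \<notin> gdom G ` U" using that W(3) by fastforce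
              then show ?thesis using translate_act_0[OF that(1) s(2,4)] s(1) by simp
            qed
            then show ?thesis using W(1,2) NE(2) by (intro exI[of _ W]) auto
          qed
        next
          case (add m n)
          then obtain W W' where "openin (gtop G) W" "x \<in> W"
            "\<forall>U. compact_slice G U \<and> x \<in> U \<and> U \<subseteq> W \<longrightarrow> \<chi> U m \<in> N"
            "openin (gtop G) W'" "x \<in> W'"
            "\<forall>U. compact_slice G U \<and> x \<in> U \<and> U \<subseteq> W' \<longrightarrow> \<chi> U n \<in> N"
            by blast
          then show ?case using add(1,2) NE(3)
            by (intro exI[of _ "W \<inter> W'"]) (auto simp: slice_act_simps)
        next
          case (smult c m)
          then show ?case using NE(4) by (auto simp: slice_act_simps)
        qed
        then obtain W where W: "openin (gtop G) W" "x \<in> W"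
          "\<forall>U. compact_slice G U \<and> x \<in> U \<and> U \<subseteq> W \<longrightarrow> \<chi> U v \<in> N" by blast
        obtain U where U: "compact_slice G U" "x \<in> U" "U \<subseteq> W" "U \<subseteq> units G"
          by (rule compact_units_slice[OF W(1,2) x_unit])
        then have "\<chi> U v \<in> N" "\<chi> U v = v" using W(3) Res_unit[OF v(1)] by auto
        then show False using v(2) by simp
      qed
      then have "N \<subseteq> {\<zero>}" by (intro subsetI) simp
      then show "N = {\<zero>\<^bsub>res_module G x M\<^esub>}" using NE(2) by (simp add: subset_antisym)
    qed
  qed
qed

lemma Res_nonzero_along_orbit:
  assumes "t \<in> L_fibre G x" "R \<noteq> {\<zero>}"
  shows "Res G (gran G t) M \<noteq> {\<zero>}"
proof -
  obtain n where n: "n \<in> R" "n \<noteq> \<zero>" using assms(2) submodule_scalarsE(2)[OF Res_submodule] by blast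
  then show ?thesis using translate_ran[OF assms(1) n(1)] translate_nonzero[OF assms(1) n(1)] by auto
qed

end

context groupoid_module
begin

text \<open>
  At a unit where no characteristic function acts as zero, the kernels of the characteristic
  functions of its neighbourhoods form a directed family whose union is finitely generated,
  hence is attained; below such a neighbourhood the images are constant.
\<close>

lemma spectral_if_finitely_generated:
  assumes fld: "field (scalars :: 'k ring)" and fg: "finitely_generated M" and nz: "carrier M \<noteq> {\<zero>}"
  shows "spectral G M"
proof -
  \<comment> \<open>Otherwise every unit has a neighbourhood annihilating all of \<open>M\<close>,
    and \<open>zero_if_locally_zero\<close> makes \<open>M\<close> zero.\<close>
  have "\<exists>z\<in>units G. \<forall>W. compact_slice G W \<and> W \<subseteq> units G \<and> z \<in> W \<longrightarrow> (\<exists>m\<in>carrier M. \<chi> W m \<noteq> \<zero>)"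
  proof (rule ccontr)
    assume neg: "\<not> ?thesis"
    have "m = \<zero>" if m: "m \<in> carrier M" for m
    proof (rule zero_if_locally_zero[OF m])
      fix z assume z: "z \<in> units G"
      then obtain W where "compact_slice G W" "W \<subseteq> units G" "z \<in> W" "\<forall>m\<in>carrier M. \<chi> W m = \<zero>"
        using neg by blast
      then show "\<exists>U. compact_slice G U \<and> z \<in> gdom G ` U \<and> \<chi> U m = \<zero>"
        using m z by (intro exI[of _ W]) (auto intro!: image_eqI[of _ _ z])
    qed
    then show False using nz M.zero_closed by blast
  qed
  then obtain z where z: "z \<in> units G"
    "\<And>W. \<lbrakk>compact_slice G W; W \<subseteq> units G; z \<in> W\<rbrakk> \<Longrightarrow> \<exists>m\<in>carrier M. \<chi> W m \<noteq> \<zero>"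
    by blast
  define nb where "nb W \<longleftrightarrow> compact_slice G W \<and> W \<subseteq> units G \<and> z \<in> W" for W
  have nb_Int: "nb (W \<inter> W')" if "nb W" "nb W'" for W W'
    using that compact_slice_units_Int by (auto simp: nb_def)
  have shrink: "\<chi> W' m = \<zero>" if "nb W" "nb W'" "W' \<subseteq> W" "m \<in> carrier M" "\<chi> W m = \<zero>" for W W' m
    using slice_act_units_subset(2)[of W' W m] that by (auto simp: nb_def slice_act_simps)
  define N where "N = {m \<in> carrier M. \<exists>W. nb W \<and> \<chi> W m = \<zero>}"
  obtain W1 where W1: "nb W1"
    by (rule compact_units_slice[OF open_units z(1) z(1)]) (auto simp: nb_def)
  have sub: "submodule N (scalars :: 'k ring) M"
  proof (rule submodule_scalarsI)
    show "N \<subseteq> carrier M" by (auto simp: N_def)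
    show "\<zero> \<in> N" using W1 by (auto simp: N_def nb_def slice_act_simps)
    fix a c assume "a \<in> N"
    then obtain W where W: "nb W" "\<chi> W a = \<zero>" "a \<in> carrier M" by (auto simp: N_def)
    then show "c \<odot> a \<in> N" by (auto simp: N_def nb_def slice_act_simps)
    fix b assume "b \<in> N"
    then obtain W' where W': "nb W'" "\<chi> W' b = \<zero>" "b \<in> carrier M" by (auto simp: N_def)
    have "\<chi> (W \<inter> W') a = \<zero>" "\<chi> (W \<inter> W') b = \<zero>"
      using shrink[OF W(1) nb_Int[OF W(1) W'(1)] _ W(3,2)] shrink[OF W'(1) nb_Int[OF W(1) W'(1)] _ W'(3,2)]
      by auto
    then show "a \<oplus> b \<in> N"
      using W W' nb_Int[OF W(1) W'(1)] unfolding N_def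
      by (intro CollectI conjI exI[of _ "W \<inter> W'"]) (auto simp: nb_def slice_act_simps)
  qed
  obtain C where C: "finite C" "C \<subseteq> N" "mspan M C = N"
    using submodule_finitely_generated[OF fld fg sub] .
  have "\<exists>W. nb W \<and> (\<forall>c\<in>C. \<chi> W c = \<zero>)"
    using C(1,2)
  proof (induction C rule: finite_induct)
    case empty
    then show ?case using W1 by auto
  next
    case (insert c C)
    then obtain W where W: "nb W" "\<forall>c\<in>C. \<chi> W c = \<zero>" by auto
    obtain W' where W': "nb W'" "\<chi> W' c = \<zero>" "c \<in> carrier M" using insert.prems by (auto simp: N_def)
    have CM: "C \<subseteq> carrier M" using insert.prems by (auto simp: N_def)
    have "\<chi> (W \<inter> W') b = \<zero>" if "b \<in> insert c C" for b
      using that shrink[OF W(1) nb_Int[OF W(1) W'(1)], of b] shrink[OF W'(1) nb_Int[OF W(1) W'(1)], of b]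
        W W' CM by auto
    then show ?case using nb_Int[OF W(1) W'(1)] by blast
  qed
  then obtain W0 where W0: "nb W0" "\<forall>c\<in>C. \<chi> W0 c = \<zero>" by blast
  have ker: "\<chi> W0 m = \<zero>" if "m \<in> N" for m
  proof -
    have "m \<in> mspan M C" "C \<subseteq> carrier M" using that C by (auto simp: N_def)
    then show ?thesis
      by (induction rule: mspan_induct) (use W0 in \<open>auto simp: nb_def slice_act_simps\<close>)
  qed
  obtain m where m: "m \<in> carrier M" "\<chi> W0 m \<noteq> \<zero>" using z(2)[of W0] W0(1) by (auto simp: nb_def)
  define v where "v = \<chi> W0 m"
  have cs0: "compact_slice G W0" "W0 \<subseteq> units G" using W0(1) by (auto simp: nb_def)
  have v: "v \<in> carrier M" "\<chi> W0 v = v"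
    using m cs0 slice_act_units_subset(1)[of W0 W0 m] by (auto simp: v_def)
  have "\<chi> W v = v" if W: "nb W" for W
  proof -
    define W' where "W' = W \<inter> W0"
    have W': "nb W'" "W' \<subseteq> W" "W' \<subseteq> W0" using nb_Int[OF W W0(1)] by (auto simp: W'_def)
    then have cs': "compact_slice G W'" "W' \<subseteq> units G" and cs: "compact_slice G W" "W \<subseteq> units G"
      using W by (auto simp: nb_def)
    have v': "\<chi> W' v \<in> carrier M" using cs' v by auto
    \<comment> \<open>The difference of \<open>v\<close> and \<open>\<chi> W' v\<close> is killed by
      \<open>W'\<close>, so it lies in the union \<open>N\<close> of the kernels and is killed by
      \<open>W0\<close>. But \<open>W0\<close> fixes both terms, so the difference is zero.\<close>
    have "\<chi> W' (v \<oplus> (- 1) \<odot> \<chi> W' v) = \<chi> W' v \<oplus> (- 1) \<odot> \<chi> W' v"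
      using cs' v v' slice_act_units_subset(1)[of W' W' v] by (simp add: slice_act_simps)
    also have "\<dots> = \<zero>" using v' by (simp add: smult_minus_one M.r_neg)
    finally have "v \<oplus> (- 1) \<odot> \<chi> W' v \<in> N" using W' v v' by (auto simp: N_def)
    then have "\<zero> = \<chi> W0 (v \<oplus> (- 1) \<odot> \<chi> W' v)" using ker by simp
    also have "\<dots> = v \<oplus> (- 1) \<odot> \<chi> W' v"
      using cs0 cs' v v' slice_act_units_subset(1)[of W' W0 v] W'(3) by (simp add: slice_act_simps)
    finally have "v \<ominus> \<chi> W' v = \<zero>" using v' by (simp add: smult_minus_one a_minus_def)
    then have eq: "v = \<chi> W' v" using v v' by (simp add: diff_eq_zero_iff)
    have "\<chi> W (\<chi> W' v) = \<chi> W' v"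
      using cs cs' v W'(2) by (intro slice_act_units_subset(1))
    then show ?thesis using eq by simp
  qed
  then have "v \<in> Res G z M" using v by (auto simp: Res_iff nb_def)
  moreover have "v \<noteq> \<zero>" using m by (simp add: v_def)
  ultimately show ?thesis using nz z(1) by (auto simp: spectral_def)
qed

end

section \<open>The tensor product model of induction\<close>

lemma (in kmodule) minus_zero_right: "m \<in> carrier M \<Longrightarrow> m \<ominus> \<zero> = m"
  by (simp add: a_minus_def)

lemma linear_map_minus:
  assumes "linear_map M N h" "kmodule M" "kmodule N" "m \<in> carrier M" "n \<in> carrier M"
  shows "h (m \<ominus>\<^bsub>M\<^esub> n) = h m \<ominus>\<^bsub>N\<^esub> h n"
proof -
  interpret M: kmodule M by fact
  interpret N: kmodule N by fact
  note h = linear_mapD[OF assms(1)]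
  have "h (m \<oplus>\<^bsub>M\<^esub> (- 1) \<odot>\<^bsub>M\<^esub> n) = h m \<oplus>\<^bsub>N\<^esub> (- 1) \<odot>\<^bsub>N\<^esub> h n"
    using assms(4,5) h by (simp del: M.smult_minus_one)
  then show ?thesis using assms(4,5) h
    by (simp add: a_minus_def M.smult_minus_one[symmetric] N.smult_minus_one[symmetric])
qed

lemma free_map_superset:
  fixes w :: "'s \<Rightarrow> 'k::{comm_ring,comm_monoid_mult}"
  assumes "finite S" "{s. w s \<noteq> 0} \<subseteq> S"
  shows "free_map \<phi> w t = (\<Sum>s\<in>S. if \<phi> s = t then w s else 0)"
  unfolding free_map_def
  by (rule sum.mono_neutral_cong_left) (use assms in \<open>auto split: if_splits\<close>)

lemma free_map_delta: "free_map \<phi> (delta s) = (delta (\<phi> s) :: 't \<Rightarrow> 'k::{comm_ring,comm_monoid_mult})"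
proof
  fix t show "free_map \<phi> (delta s) t = (delta (\<phi> s) t :: 'k)"
    by (subst free_map_superset[where S = "{s}"]) (auto simp: delta_def)
qed

lemma free_map_linear:
  fixes u v :: "'s \<Rightarrow> 'k::{comm_ring,comm_monoid_mult}"
  shows "free_map \<phi> (\<lambda>s. 0 :: 'k) = (\<lambda>t. 0)"
    "\<lbrakk>finite {s. u s \<noteq> 0}; finite {s. v s \<noteq> 0}\<rbrakk> \<Longrightarrow>
      free_map \<phi> (\<lambda>s. u s + v s) = (\<lambda>t. free_map \<phi> u t + free_map \<phi> v t)"
    "finite {s. u s \<noteq> 0} \<Longrightarrow> free_map \<phi> (\<lambda>s. c * u s) = (\<lambda>t. c * free_map \<phi> u t)"
proof -
  show "free_map \<phi> (\<lambda>s. 0 :: 'k) = (\<lambda>t. 0)" by (simp add: free_map_def)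
  assume u: "finite {s. u s \<noteq> 0}"
  have c: "{s. c * u s \<noteq> 0} \<subseteq> {s. u s \<noteq> 0}" by auto
  show "free_map \<phi> (\<lambda>s. c * u s) = (\<lambda>t. c * free_map \<phi> u t)"
    by (rule ext) (auto simp: free_map_superset[OF u order_refl] free_map_superset[OF u c] sum_distrib_left intro!: sum.cong)
  assume "finite {s. v s \<noteq> 0}"
  with u have S: "finite ({s. u s \<noteq> 0} \<union> {s. v s \<noteq> 0})" by simp
  have d: "{s. u s + v s \<noteq> 0} \<subseteq> {s. u s \<noteq> 0} \<union> {s. v s \<noteq> 0}" by auto
  show "free_map \<phi> (\<lambda>s. u s + v s) = (\<lambda>t. free_map \<phi> u t + free_map \<phi> v t)"
    by (rule ext) (auto simp: free_map_superset[OF S d] free_map_superset[OF S Un_upper1] free_map_superset[OF S Un_upper2] sum.distrib[symmetric]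
        intro!: sum.cong)
qed

lemma linear_map_free_map:
  assumes "\<And>s. s \<in> S \<Longrightarrow> \<phi> s \<in> T"
  shows "linear_map (free_module S) (free_module T :: ('k::{comm_ring,comm_monoid_mult}, 't \<Rightarrow> 'k) module) (free_map \<phi>)"
proof -
  have "free_map \<phi> u \<in> carrier (free_module T)" if "u \<in> carrier (free_module S)" for u :: "_ \<Rightarrow> 'k"
    using that
  proof (induction rule: free_module_induct)
    case zero
    then show ?case by (simp add: free_map_linear)
  next
    case (delta s)
    then show ?case by (simp only: free_map_delta delta_in_free_module assms)
  next
    case (add u v)
    then show ?case by (simp add: free_map_linear finite_support_add)
  next
    case (smult c u)
    then show ?case by (simp add: free_map_linear finite_support_mult)
  qed
  then show ?thesis by (simp add: linear_map_def free_map_linear)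
qed

lemma Ind_simps:
  "carrier (Ind G x V) = carrier (tensor (isotropy_algebra G x) (free_module (L_fibre G x)) (bilinear_mul G) V)"
  "\<zero>\<^bsub>Ind G x V\<^esub> = \<zero>\<^bsub>tensor (isotropy_algebra G x) (free_module (L_fibre G x)) (bilinear_mul G) V\<^esub>"
  "X \<oplus>\<^bsub>Ind G x V\<^esub> Y = X \<oplus>\<^bsub>tensor (isotropy_algebra G x) (free_module (L_fibre G x)) (bilinear_mul G) V\<^esub> Y"
  "c \<odot>\<^bsub>Ind G x V\<^esub> X = c \<odot>\<^bsub>tensor (isotropy_algebra G x) (free_module (L_fibre G x)) (bilinear_mul G) V\<^esub> X"
  "act (Ind G x V) f X =
     tensor_act (isotropy_algebra G x) (free_module (L_fibre G x)) (bilinear_mul G) V (L_act G x) f X"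
  by (simp_all add: Ind_def module.extend_def alg_module.fields_def)

section \<open>The tensor product presented by generators and relations\<close>

context isotropy_module
begin

abbreviation P :: "('k, 'g \<Rightarrow> 'k) module" where
  "P \<equiv> free_module (L_fibre G x)"

abbreviation F :: "('k, ('g \<Rightarrow> 'k) \<times> 'v \<Rightarrow> 'k) module" where
  "F \<equiv> free_module (carrier P \<times> carrier V)"

abbreviation rels where
  "rels \<equiv> tensor_relations (isotropy_algebra G x) P (bilinear_mul G) V"

abbreviation N where
  "N \<equiv> tensor_kernel (isotropy_algebra G x) P (bilinear_mul G) V"

abbreviation Dl :: "('g \<Rightarrow> 'k) \<Rightarrow> 'v \<Rightarrow> ('g \<Rightarrow> 'k) \<times> 'v \<Rightarrow> 'k" where
  "Dl p v \<equiv> delta (p, v)"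

lemma kmodule_F: "kmodule F"
  by (rule kmodule_free_module)

lemma Dl_closed: "\<lbrakk>p \<in> carrier P; v \<in> carrier V\<rbrakk> \<Longrightarrow> Dl p v \<in> carrier F"
  by (rule delta_in_free_module) blast

lemma P_closed:
  "(\<lambda>s. 0) \<in> carrier P"
  "\<lbrakk>p \<in> carrier P; q \<in> carrier P\<rbrakk> \<Longrightarrow> (\<lambda>s. p s + q s) \<in> carrier P"
  "p \<in> carrier P \<Longrightarrow> (\<lambda>s. c * p s) \<in> carrier P"
  by (auto intro: finite_support_add finite_support_mult)

lemma tensor_free_eq: "tensor_free P V = F"
  by (simp add: tensor_free_def)

lemma rels_cases:
  assumes "r \<in> rels"
  obtains p q v where "p \<in> carrier P" "q \<in> carrier P" "v \<in> carrier V"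
      "r = Dl (\<lambda>s. p s + q s) v \<ominus>\<^bsub>F\<^esub> (Dl p v \<oplus>\<^bsub>F\<^esub> Dl q v)"
  | p v w where "p \<in> carrier P" "v \<in> carrier V" "w \<in> carrier V"
      "r = Dl p (v \<oplus> w) \<ominus>\<^bsub>F\<^esub> (Dl p v \<oplus>\<^bsub>F\<^esub> Dl p w)"
  | c p v where "p \<in> carrier P" "v \<in> carrier V" "r = Dl (\<lambda>s. c * p s) v \<ominus>\<^bsub>F\<^esub> (c \<odot>\<^bsub>F\<^esub> Dl p v)"
  | c p v where "p \<in> carrier P" "v \<in> carrier V" "r = Dl p (c \<odot> v) \<ominus>\<^bsub>F\<^esub> (c \<odot>\<^bsub>F\<^esub> Dl p v)"
  | p a v where "p \<in> carrier P" "a \<in> carrier (isotropy_algebra G x)" "v \<in> carrier V"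
      "r = Dl (bilinear_mul G p a) v \<ominus>\<^bsub>F\<^esub> Dl p (act V a v)"
  using assms
  \<comment> \<open>Only the operations of the module on the fibre are unfolded. Those of
    \<open>F\<close> stay folded, so that the relations keep the shape of module laws.\<close>
  unfolding tensor_relations_def Let_def tensor_free_eq free_module_simps(3,4)[where S = "L_fibre G x"]
  apply (elim UnE CollectE exE conjE)
      apply (rule that(1); assumption)
     apply (rule that(2); assumption)
    apply (rule that(3); assumption)
   apply (rule that(4); assumption)
  apply (rule that(5); assumption)
  done

lemma relsI:
  assumes "p \<in> carrier P" "v \<in> carrier V"
  shows "q \<in> carrier P \<Longrightarrow> Dl (\<lambda>s. p s + q s) v \<ominus>\<^bsub>F\<^esub> (Dl p v \<oplus>\<^bsub>F\<^esub> Dl q v) \<in> rels"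
    "w \<in> carrier V \<Longrightarrow> Dl p (v \<oplus> w) \<ominus>\<^bsub>F\<^esub> (Dl p v \<oplus>\<^bsub>F\<^esub> Dl p w) \<in> rels"
    "Dl (\<lambda>s. c * p s) v \<ominus>\<^bsub>F\<^esub> (c \<odot>\<^bsub>F\<^esub> Dl p v) \<in> rels"
    "Dl p (c \<odot> v) \<ominus>\<^bsub>F\<^esub> (c \<odot>\<^bsub>F\<^esub> Dl p v) \<in> rels"
    "a \<in> carrier (isotropy_algebra G x) \<Longrightarrow> Dl (bilinear_mul G p a) v \<ominus>\<^bsub>F\<^esub> Dl p (act V a v) \<in> rels"
  unfolding tensor_relations_def Let_def tensor_free_eq free_module_simps(3,4)[where S = "L_fibre G x"]
  using assms
      apply -
      apply (rule UnI1, rule UnI1, rule UnI1, rule UnI1, rule CollectI, intro exI conjI, rule refl, assumption+)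
     apply (rule UnI1, rule UnI1, rule UnI1, rule UnI2, rule CollectI, intro exI conjI, rule refl, assumption+)
    apply (rule UnI1, rule UnI1, rule UnI2, rule CollectI, intro exI conjI, rule refl, assumption+)
   apply (rule UnI1, rule UnI2, rule CollectI, intro exI conjI, rule refl, assumption+)
  apply (rule UnI2, rule CollectI, intro exI conjI, rule refl, assumption+)
  done

lemma bilinear_mul_P:
  "\<lbrakk>p \<in> carrier P; a \<in> carrier (isotropy_algebra G x)\<rbrakk> \<Longrightarrow> bilinear_mul G p a \<in> carrier P"
  by (rule bilinear_mul_closed) (simp_all only: isotropy_algebra_simps)

lemma rels_subset: "rels \<subseteq> carrier F"
proof
  interpret F: kmodule F by (rule kmodule_F)
  fix r assume "r \<in> rels"
  then show "r \<in> carrier F"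
    by (rule rels_cases)
      (simp_all only: F.M.minus_closed F.M.add.m_closed F.smult_in Dl_closed P_closed add.m_closed smult_in
        bilinear_mul_P act_closed)
qed

lemma N_submodule: "submodule N (scalars :: 'k ring) F"
proof -
  interpret F: kmodule F by (rule kmodule_F)
  show ?thesis unfolding tensor_kernel_def tensor_free_eq by (rule F.mspan_submodule[OF rels_subset])
qed

text \<open>One half of the universal property: a linear map on the free module that respects the
  five kinds of relations vanishes on their span. It provides both the left action and the
  retraction onto \<open>V\<close>.\<close>

lemma tensor_lift:
  fixes K :: "('k, 'n, 'y) module_scheme"
  assumes k: "linear_map F K k" and K: "kmodule K"
    and "\<And>p q v. \<lbrakk>p \<in> carrier P; q \<in> carrier P; v \<in> carrier V\<rbrakk> \<Longrightarrow>
      k (Dl (\<lambda>s. p s + q s) v) = k (Dl p v) \<oplus>\<^bsub>K\<^esub> k (Dl q v)"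
    and "\<And>p v w. \<lbrakk>p \<in> carrier P; v \<in> carrier V; w \<in> carrier V\<rbrakk> \<Longrightarrow>
      k (Dl p (v \<oplus> w)) = k (Dl p v) \<oplus>\<^bsub>K\<^esub> k (Dl p w)"
    and "\<And>c p v. \<lbrakk>p \<in> carrier P; v \<in> carrier V\<rbrakk> \<Longrightarrow> k (Dl (\<lambda>s. c * p s) v) = c \<odot>\<^bsub>K\<^esub> k (Dl p v)"
    and "\<And>c p v. \<lbrakk>p \<in> carrier P; v \<in> carrier V\<rbrakk> \<Longrightarrow> k (Dl p (c \<odot> v)) = c \<odot>\<^bsub>K\<^esub> k (Dl p v)"
    and "\<And>p a v. \<lbrakk>p \<in> carrier P; a \<in> carrier (isotropy_algebra G x); v \<in> carrier V\<rbrakk> \<Longrightarrow>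
      k (Dl (bilinear_mul G p a) v) = k (Dl p (act V a v))"
    and "n \<in> N"
  shows "k n = \<zero>\<^bsub>K\<^esub>"
proof -
  interpret F: kmodule F by (rule kmodule_F)
  interpret K: kmodule K by fact
  note D = linear_mapD[OF k]
  have Z: "submodule {\<zero>\<^bsub>K\<^esub>} (scalars :: 'k ring) K" by (rule K.submodule_scalarsI) auto
  have "k r = \<zero>\<^bsub>K\<^esub>" if "r \<in> rels" for r
  proof -
    have *: "k (m \<ominus>\<^bsub>F\<^esub> n) = \<zero>\<^bsub>K\<^esub>" if "m \<in> carrier F" "n \<in> carrier F" "k m = k n" for m n
      using linear_map_minus[OF k kmodule_F K that(1,2)] K.diff_eq_zero_iff[of "k m" "k n"] that D(1) by simp
    show ?thesis
      using that
      by (rule rels_cases; simp only:; intro * F.M.add.m_closed F.smult_in Dl_closed)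
        (simp_all only: P_closed add.m_closed smult_in bilinear_mul_P act_closed D Dl_closed assms(3-7))
  qed
  then have "rels \<subseteq> {m \<in> carrier F. k m \<in> {\<zero>\<^bsub>K\<^esub>}}" using rels_subset by blast
  then have "mspan F rels \<subseteq> {m \<in> carrier F. k m \<in> {\<zero>\<^bsub>K\<^esub>}}"
    by (rule F.mspan_minimal[OF submodule_vimage[OF k kmodule_F K Z]])
  then show ?thesis using assms(8) unfolding tensor_kernel_def tensor_free_eq by blast
qed

sublocale T: kmodule_quotient F N
  by (intro kmodule_quotient.intro kmodule_F kmodule_quotient_axioms.intro N_submodule)

abbreviation tens :: "('g \<Rightarrow> 'k) \<Rightarrow> 'v \<Rightarrow> (('g \<Rightarrow> 'k) \<times> 'v \<Rightarrow> 'k) set" where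
  "tens p v \<equiv> N +>\<^bsub>F\<^esub> Dl p v"

lemma tens_closed: "\<lbrakk>p \<in> carrier P; v \<in> carrier V\<rbrakk> \<Longrightarrow> tens p v \<in> carrier T.Q"
  using T.coset_closed[OF Dl_closed] .

lemma rel_coset_eq:
  assumes "m \<in> carrier F" "n \<in> carrier F" "m \<ominus>\<^bsub>F\<^esub> n \<in> rels"
  shows "N +>\<^bsub>F\<^esub> m = N +>\<^bsub>F\<^esub> n"
proof -
  have "rels \<subseteq> N" unfolding tensor_kernel_def tensor_free_eq by (rule T.mspan_superset)
  then show ?thesis using T.coset_eq_iff[OF assms(1,2)] assms(3) by blast
qed

lemma tens_simps:
  assumes "p \<in> carrier P" "v \<in> carrier V"
  shows "q \<in> carrier P \<Longrightarrow> tens (\<lambda>s. p s + q s) v = tens p v \<oplus>\<^bsub>T.Q\<^esub> tens q v"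
    "w \<in> carrier V \<Longrightarrow> tens p (v \<oplus> w) = tens p v \<oplus>\<^bsub>T.Q\<^esub> tens p w"
    "tens (\<lambda>s. c * p s) v = c \<odot>\<^bsub>T.Q\<^esub> tens p v"
    "tens p (c \<odot> v) = c \<odot>\<^bsub>T.Q\<^esub> tens p v"
    "a \<in> carrier (isotropy_algebra G x) \<Longrightarrow> tens (bilinear_mul G p a) v = tens p (act V a v)"
proof -
  note cl = T.M.add.m_closed T.smult_in Dl_closed P_closed add.m_closed smult_in bilinear_mul_P act_closed assms
  show "tens (\<lambda>s. p s + q s) v = tens p v \<oplus>\<^bsub>T.Q\<^esub> tens q v" if "q \<in> carrier P"
    unfolding T.quotient_add[OF Dl_closed[OF assms] Dl_closed[OF that assms(2)]]
    by (intro rel_coset_eq relsI cl that)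
  show "tens p (v \<oplus> w) = tens p v \<oplus>\<^bsub>T.Q\<^esub> tens p w" if "w \<in> carrier V"
    unfolding T.quotient_add[OF Dl_closed[OF assms] Dl_closed[OF assms(1) that]]
    by (intro rel_coset_eq relsI cl that)
  show "tens (\<lambda>s. c * p s) v = c \<odot>\<^bsub>T.Q\<^esub> tens p v"
    unfolding T.quotient_smult[OF Dl_closed[OF assms]]
    by (intro rel_coset_eq relsI cl)
  show "tens p (c \<odot> v) = c \<odot>\<^bsub>T.Q\<^esub> tens p v"
    unfolding T.quotient_smult[OF Dl_closed[OF assms]]
    by (intro rel_coset_eq relsI cl)
  show "tens (bilinear_mul G p a) v = tens p (act V a v)" if "a \<in> carrier (isotropy_algebra G x)"
    by (intro rel_coset_eq relsI cl that)
qed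

lemma tens_zero:
  assumes "v \<in> carrier V"
  shows "tens (\<lambda>s. 0) v = \<zero>\<^bsub>T.Q\<^esub>"
proof -
  interpret Q: kmodule T.Q by (rule T.kmodule_quotient)
  show ?thesis
    using tens_simps(3)[OF P_closed(1) assms, of 0] tens_closed[OF P_closed(1) assms]
    by (simp only: Q.smult_simps(2) mult_zero_left)
qed

lemma tensor_induct [consumes 1, case_names zero tens add smult]:
  assumes "X \<in> carrier T.Q"
    and "Pr \<zero>\<^bsub>T.Q\<^esub>" "\<And>p v. \<lbrakk>p \<in> carrier P; v \<in> carrier V\<rbrakk> \<Longrightarrow> Pr (tens p v)"
    and "\<And>X Y. \<lbrakk>X \<in> carrier T.Q; Y \<in> carrier T.Q; Pr X; Pr Y\<rbrakk> \<Longrightarrow> Pr (X \<oplus>\<^bsub>T.Q\<^esub> Y)"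
    and "\<And>c X. \<lbrakk>X \<in> carrier T.Q; Pr X\<rbrakk> \<Longrightarrow> Pr (c \<odot>\<^bsub>T.Q\<^esub> X)"
  shows "Pr X"
proof -
  obtain w where w: "w \<in> carrier F" "X = N +>\<^bsub>F\<^esub> w"
    using assms(1) unfolding T.quotient_carrier by blast
  have "Pr (N +>\<^bsub>F\<^esub> w)" using w(1)
  proof (induction rule: free_module_induct)
    case zero
    then show ?case using assms(2) T.quotient_zero by simp
  next
    case (delta s)
    then show ?case using assms(3) by (cases s) blast
  next
    case (add u v)
    then show ?case
      using assms(4)[OF T.coset_closed T.coset_closed, of u v] T.quotient_add[OF add(1,2)]
      by (simp only: free_module_simps(3))
  next
    case (smult c u)
    then show ?case
      using assms(5)[OF T.coset_closed, of u c] T.quotient_smult[OF smult(1), of c]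
      by (simp only: free_module_simps(4))
  qed
  then show ?thesis using w(2) by simp
qed

lemma tensor_eq: "tensor (isotropy_algebra G x) P (bilinear_mul G) V = T.Q"
  by (simp add: tensor_def tensor_free_eq)

lemmas Ind_eqs = Ind_simps[where V = V and x = x and G = G, unfolded tensor_eq]

abbreviation I where "I \<equiv> Ind G x V"

lemma kmodule_Ind: "kmodule I"
  by (rule kmodule_transport[OF T.kmodule_quotient, where h = id]) (auto simp: Ind_eqs)

text \<open>The action of \<open>f\<close> tensored with the identity, before the relations are
  divided out.\<close>

definition lmap :: "('g \<Rightarrow> 'k) \<Rightarrow> (('g \<Rightarrow> 'k) \<times> 'v \<Rightarrow> 'k) \<Rightarrow> ('g \<Rightarrow> 'k) \<times> 'v \<Rightarrow> 'k" where
  "lmap f = free_map (\<lambda>(p, v). (L_act G x f p, v))"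

lemma lmap_Dl: "lmap f (Dl p v) = Dl (L_act G x f p) v"
  by (simp add: lmap_def free_map_delta)

lemma linear_map_lmap:
  "f \<in> carrier (groupoid_algebra G) \<Longrightarrow> linear_map F F (lmap f)"
  unfolding lmap_def
  by (rule linear_map_free_map) (use L_act_closed[of f _ x] in \<open>auto simp del: free_module_simps(1)\<close>)

lemma L_act_P:
  assumes "f \<in> carrier (groupoid_algebra G)" "p \<in> carrier P"
  shows "L_act G x f p \<in> carrier P"
    "q \<in> carrier P \<Longrightarrow> L_act G x f (\<lambda>s. p s + q s) = (\<lambda>s. L_act G x f p s + L_act G x f q s)"
    "L_act G x f (\<lambda>s. c * p s) = (\<lambda>s. c * L_act G x f p s)"
    "a \<in> carrier (isotropy_algebra G x) \<Longrightarrow> L_act G x f (bilinear_mul G p a) = bilinear_mul G (L_act G x f p) a"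
  using L_act_closed[OF assms] L_act_right(2)[of p q G x f] L_act_right(3)[of p G x f c]
    L_act_bilinear_mul[OF assms, of a] assms(2)
  by simp_all

text \<open>\<open>tensor_lift\<close> is applied to \<open>lmap f\<close> followed by the quotient
  map. The balancing relation survives because the left action commutes with the right action of the
  isotropy algebra.\<close>

lemma lmap_N:
  assumes f: "f \<in> carrier (groupoid_algebra G)" and n: "n \<in> N"
  shows "lmap f n \<in> N"
proof -
  note D = linear_mapD[OF linear_map_lmap[OF f]]
  have nF: "n \<in> carrier F" using T.submodule_scalarsE(1)[OF N_submodule] n by blast
  have "N +>\<^bsub>F\<^esub> lmap f n = \<zero>\<^bsub>T.Q\<^esub>"
  proof (rule tensor_lift[OF _ T.kmodule_quotient _ _ _ _ _ n])
    show "linear_map F T.Q (\<lambda>n. N +>\<^bsub>F\<^esub> lmap f n)"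
      unfolding linear_map_def
      by (intro conjI ballI allI; simp only: D T.coset_closed T.quotient_add T.quotient_smult)
  qed (simp_all only: lmap_Dl L_act_P[OF f] tens_simps P_closed act_closed)
  then have "N +>\<^bsub>F\<^esub> lmap f n = N +>\<^bsub>F\<^esub> \<zero>\<^bsub>F\<^esub>" by (simp only: T.quotient_zero)
  then have "lmap f n \<ominus>\<^bsub>F\<^esub> \<zero>\<^bsub>F\<^esub> \<in> N"
    using T.coset_eq_iff[OF D(1)[OF nF] T.M.zero_closed] by blast
  moreover have "lmap f n \<ominus>\<^bsub>F\<^esub> \<zero>\<^bsub>F\<^esub> = lmap f n"
    using D(1)[OF nF] by (simp only: T.minus_zero_right)
  ultimately show ?thesis by simp
qed

lemma Ind_act_coset:
  assumes "f \<in> carrier (groupoid_algebra G)" "w \<in> carrier F"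
  shows "act I f (N +>\<^bsub>F\<^esub> w) = N +>\<^bsub>F\<^esub> lmap f w"
  unfolding Ind_eqs(5) tensor_act_def tensor_free_eq lmap_def[symmetric]
  by (rule T.quotient_lift[OF linear_map_lmap[OF assms(1)] lmap_N[OF assms(1)] assms(2)])

lemma Ind_act_tens:
  "\<lbrakk>f \<in> carrier (groupoid_algebra G); p \<in> carrier P; v \<in> carrier V\<rbrakk> \<Longrightarrow>
    act I f (tens p v) = tens (L_act G x f p) v"
  using Ind_act_coset[OF _ Dl_closed] lmap_Dl by simp

lemma linear_map_Ind_act:
  assumes f: "f \<in> carrier (groupoid_algebra G)"
  shows "linear_map T.Q T.Q (act I f)"
  unfolding linear_map_def
proof (intro conjI ballI allI)
  note D = linear_mapD[OF linear_map_lmap[OF f]]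
  fix X c assume "X \<in> carrier T.Q"
  then obtain w where w: "w \<in> carrier F" "X = N +>\<^bsub>F\<^esub> w" unfolding T.quotient_carrier by blast
  show "act I f X \<in> carrier T.Q" using w D by (simp only: Ind_act_coset[OF f] T.coset_closed)
  show "act I f (c \<odot>\<^bsub>T.Q\<^esub> X) = c \<odot>\<^bsub>T.Q\<^esub> act I f X"
    using w D by (simp only: Ind_act_coset[OF f] T.coset_closed T.quotient_smult T.smult_in)
  fix Y assume "Y \<in> carrier T.Q"
  then obtain w' where w': "w' \<in> carrier F" "Y = N +>\<^bsub>F\<^esub> w'" unfolding T.quotient_carrier by blast
  show "act I f (X \<oplus>\<^bsub>T.Q\<^esub> Y) = act I f X \<oplus>\<^bsub>T.Q\<^esub> act I f Y"
    using w w' D by (simp only: Ind_act_coset[OF f] T.coset_closed T.quotient_add T.M.add.m_closed)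
qed

lemmas Ind_act_linear = linear_mapD[OF linear_map_Ind_act]

lemma Ind_act_zero: "f \<in> carrier (groupoid_algebra G) \<Longrightarrow> act I f \<zero>\<^bsub>T.Q\<^esub> = \<zero>\<^bsub>T.Q\<^esub>"
  using linear_map_zero[OF linear_map_Ind_act T.kmodule_quotient T.kmodule_quotient] .

lemma Ind_act_left:
  assumes f: "f \<in> carrier (groupoid_algebra G)" and g: "g \<in> carrier (groupoid_algebra G)"
    and X: "X \<in> carrier T.Q"
  shows "act I (\<lambda>s. f s + g s) X = act I f X \<oplus>\<^bsub>T.Q\<^esub> act I g X"
    "act I (\<lambda>s. c * f s) X = c \<odot>\<^bsub>T.Q\<^esub> act I f X"
    "act I (convolution G f g) X = act I f (act I g X)"
proof -
  interpret Q: kmodule T.Q by (rule T.kmodule_quotient)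
  note fg = groupoid_algebra_closed(3)[OF f g] and cf = groupoid_algebra_closed(4)[OF f, of c]
    and cv = convolution_closed[OF f g]
  show "act I (\<lambda>s. f s + g s) X = act I f X \<oplus>\<^bsub>T.Q\<^esub> act I g X"
    using X
  proof (induction rule: tensor_induct)
    case zero
    then show ?case by (simp only: Ind_act_zero f g fg Q.M.r_zero Q.M.zero_closed)
  next
    case (tens p v)
    then show ?case
      by (simp only: Ind_act_tens f g fg L_act_left tens_simps(1) L_act_P(1))
  next
    case (add X Y)
    then show ?case
      by (simp only: Ind_act_linear f g fg Q.M.a_ac Q.M.add.m_closed)
  next
    case (smult d X)
    then show ?case
      by (simp only: Ind_act_linear f g fg Q.smult_distribs(2))
  qed
  show "act I (\<lambda>s. c * f s) X = c \<odot>\<^bsub>T.Q\<^esub> act I f X"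
    using X
  proof (induction rule: tensor_induct)
    case zero
    then show ?case by (simp only: Ind_act_zero f cf Q.smult_simps)
  next
    case (tens p v)
    then show ?case
      by (simp only: Ind_act_tens f cf L_act_left tens_simps(3) L_act_P(1))
  next
    case (add X Y)
    then show ?case
      by (simp only: Ind_act_linear f cf Q.smult_distribs(2))
  next
    case (smult d X)
    then show ?case
      by (simp only: Ind_act_linear f cf Q.smult_distribs(3)[symmetric] mult.commute)
  qed
  show "act I (convolution G f g) X = act I f (act I g X)"
    using X
  proof (induction rule: tensor_induct)
    case zero
    then show ?case by (simp only: Ind_act_zero f g cv)
  next
    case (tens p v)
    then show ?case
      by (simp only: Ind_act_tens f g cv L_act_convolution L_act_P(1))
  next
    case (add X Y)
    then show ?case
      by (simp only: Ind_act_linear f g cv)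
  next
    case (smult d X)
    then show ?case
      by (simp only: Ind_act_linear f g cv)
  qed
qed

text \<open>Linearity in the first factor reduces it to arrows of the fibre, which is the form of
  the generators in \<open>induced_module\<close>.\<close>

lemma tens_delta_span:
  assumes "\<And>t v. \<lbrakk>t \<in> L_fibre G x; v \<in> carrier V\<rbrakk> \<Longrightarrow> tens (delta t) v \<in> H"
    and H: "submodule H (scalars :: 'k ring) T.Q"
  shows "carrier T.Q \<subseteq> H"
proof
  interpret Q: kmodule T.Q by (rule T.kmodule_quotient)
  note E = Q.submodule_scalarsE[OF H]
  fix X assume "X \<in> carrier T.Q"
  then show "X \<in> H"
  proof (induction rule: tensor_induct)
    case (tens p v)
    then show ?case
    proof (induction rule: free_module_induct)
      case zero
      then show ?case using tens_zero E(2) by simp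
    next
      case (delta t)
      then show ?case using assms(1) by blast
    next
      case (add p q)
      then show ?case using tens_simps(1)[OF add(1,5) add(2)] E(3) by (simp only:)
    next
      case (smult c p)
      then show ?case using tens_simps(3)[OF smult(1,3)] E(4) by (simp only:)
    qed
  qed (use E in blast)+
qed

lemma L_act_unit_slice:
  assumes "t \<in> L_fibre G x"
  obtains W where "compact_slice G W" "L_act G x (char_fun W) (delta t) = (delta t :: 'g \<Rightarrow> 'k)"
proof -
  have t: "t \<in> arrows G" using assms by (simp add: L_fibre_iff)
  obtain W where W: "compact_slice G W" "gran G t \<in> W" "W \<subseteq> units G"
    by (rule compact_units_slice[OF open_units, of "gran G t"]) (use t in auto)
  have "L_act G x (char_fun W) (delta t) = (delta (gran G t \<cdot> t) :: 'g \<Rightarrow> 'k)"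
    by (rule L_act_char_fun[OF compact_slice_slice[OF W(1)] assms W(2)]) (use t in simp)
  then show ?thesis using that[OF W(1)] t by simp
qed

text \<open>Beyond the routine laws, non-degeneracy has to be shown: each generator
  \<open>tens (delta t) v\<close> is fixed by a compact open set of units around r(t), so it is a
  product itself.\<close>

lemma alg_mod_Ind: "alg_mod (groupoid_algebra G) I"
proof -
  interpret Q: kmodule T.Q by (rule T.kmodule_quotient)
  interpret IK: kmodule I by (rule kmodule_Ind)
  let ?S = "{act I a m |a m. a \<in> carrier (groupoid_algebra G) \<and> m \<in> carrier I}"
  have S: "?S \<subseteq> carrier I" using Ind_act_linear(1) by (auto simp: Ind_eqs(1))
  \<comment> \<open>\<open>I\<close> adds an action to the quotient module and keeps its operations;
    the identity carries submodules from one record to the other.\<close>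
  have lin: "linear_map T.Q I id" by (simp add: linear_map_def Ind_eqs)
  have "submodule (mspan I ?S) (scalars :: 'k ring) I" by (rule IK.mspan_submodule[OF S])
  then have "submodule {m \<in> carrier T.Q. id m \<in> mspan I ?S} (scalars :: 'k ring) T.Q"
    by (rule submodule_vimage[OF lin T.kmodule_quotient kmodule_Ind])
  then have "carrier T.Q \<subseteq> {m \<in> carrier T.Q. id m \<in> mspan I ?S}"
  proof (rule tens_delta_span[rotated])
    fix t v assume t: "t \<in> L_fibre G x" and v: "v \<in> carrier V"
    obtain W where W: "compact_slice G W" "L_act G x (char_fun W) (delta t) = (delta t :: 'g \<Rightarrow> 'k)"
      using L_act_unit_slice[OF t] .
    have tv: "tens (delta t) v \<in> carrier T.Q" by (rule tens_closed[OF delta_in_free_module[OF t] v])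
    have "tens (delta t) v = act I (char_fun W) (tens (delta t) v)"
      using Ind_act_tens[OF groupoid_algebra_closed(2)[OF W(1)] delta_in_free_module[OF t] v] W(2) by simp
    then have "tens (delta t) v \<in> ?S" using groupoid_algebra_closed(2)[OF W(1)] tv Ind_eqs(1) by blast
    then have "tens (delta t) v \<in> mspan I ?S" by (rule subsetD[OF IK.mspan_superset])
    then show "tens (delta t) v \<in> {m \<in> carrier T.Q. id m \<in> mspan I ?S}" using tv by simp
  qed
  then have "carrier I \<subseteq> mspan I ?S" by (auto simp: Ind_eqs(1))
  then have "mspan I ?S = carrier I" using IK.mspan_subset_carrier[OF S] by (rule subset_antisym[rotated])
  then show ?thesis
    using kmodule_Ind unfolding kmodule_def
    by (intro alg_mod.intro alg_mod_axioms.intro)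
      (simp_all only: Ind_eqs(1-4) groupoid_algebra_simps(1-4) Ind_act_linear Ind_act_left)
qed

section \<open>A retraction of the tensor product onto \<open>V\<close>\<close>

definition restr :: "('g \<Rightarrow> 'k) \<Rightarrow> 'g \<Rightarrow> 'k" where
  "restr p = (\<lambda>s. if s \<in> isotropy G x then p s else 0)"

lemma restr_closed: "p \<in> carrier P \<Longrightarrow> restr p \<in> carrier (free_module (isotropy G x))"
  by (auto simp: restr_def intro: rev_finite_subset)

lemma restr_linear:
  "restr (\<lambda>s. 0) = (\<lambda>s. 0)"
  "restr (\<lambda>s. p s + q s) = (\<lambda>s. restr p s + restr q s)"
  "restr (\<lambda>s. c * p s) = (\<lambda>s. c * restr p s)"
  by (auto simp: restr_def)

lemma restr_delta: "restr (delta t) = (if t \<in> isotropy G x then delta t else (\<lambda>s. 0))"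
  by (auto simp: restr_def delta_def)

text \<open>For \<open>g\<close> in the isotropy group, the product of \<open>t\<close> and
  \<open>g\<close> lies in that group exactly if \<open>t\<close> does. Arrows outside the group
  thus span a right submodule and can be discarded.\<close>

lemma restr_bilinear_mul:
  assumes "p \<in> carrier P" "a \<in> carrier (free_module (isotropy G x))"
  shows "restr (bilinear_mul G p a) = bilinear_mul G (restr p) a"
proof -
  have fin: "finite {s. restr p s \<noteq> 0}" if "p \<in> carrier P" for p
    using restr_closed[OF that] by simp
  show ?thesis using assms
  proof (induction rule: free_module_induct)
    case (delta t)
    note t = delta(1)
    from delta(2) show ?case
    proof (induction rule: free_module_induct)
      case (delta g)
      then have "t \<cdot> g \<in> isotropy G x \<longleftrightarrow> t \<in> isotropy G x"
        using t by (simp add: L_fibre_iff isotropy_iff)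
      then show ?case
        by (simp add: bilinear_mul_delta restr_delta bilinear_mul_left)
    qed (simp_all add: bilinear_mul_right restr_linear fin[OF delta_in_free_module[OF t]])
  qed (simp_all add: bilinear_mul_left restr_linear fin)
qed

text \<open>On the tensor product this becomes a left inverse of \<open>v\<close> going to
  \<open>tens (delta x) v\<close>, which is all that injectivity requires; no representatives of the
  isotropy orbits in the fibre have to be chosen.\<close>

definition proj where
  "proj = lin_comb V (\<lambda>(p, v). act V (restr p) v)"

lemma restr_act_closed: "\<lbrakk>p \<in> carrier P; v \<in> carrier V\<rbrakk> \<Longrightarrow> act V (restr p) v \<in> carrier V"
  by (rule act_closed) (simp_all only: isotropy_algebra_simps restr_closed)

lemma proj_Dl: "\<lbrakk>p \<in> carrier P; v \<in> carrier V\<rbrakk> \<Longrightarrow> proj (Dl p v) = act V (restr p) v"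
  unfolding proj_def by (subst lin_comb_delta) (simp_all only: case_prod_conv restr_act_closed)

lemma linear_map_proj: "linear_map F V proj"
  unfolding proj_def by (rule linear_map_lin_comb) (use restr_act_closed in \<open>auto simp del: free_module_simps(1)\<close>)

lemma proj_kernel:
  assumes "n \<in> N"
  shows "proj n = \<zero>"
proof (rule tensor_lift[OF linear_map_proj kmodule_axioms _ _ _ _ _ assms])
  have cl: "restr p \<in> carrier (isotropy_algebra G x)" if "p \<in> carrier P" for p
    using restr_closed[OF that] by (simp only: isotropy_algebra_simps)
  fix p v assume p: "p \<in> carrier P" and v: "v \<in> carrier V"
  show "proj (Dl (\<lambda>s. c * p s) v) = c \<odot> proj (Dl p v)" for c
    using p v restr_closed[OF p]
    by (simp only: proj_Dl P_closed restr_linear isotropy_act_simps)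
  show "proj (Dl p (c \<odot> v)) = c \<odot> proj (Dl p v)" for c
    using p v cl[OF p] by (simp only: proj_Dl act_smult_right smult_in)
  show "proj (Dl (\<lambda>s. p s + q s) v) = proj (Dl p v) \<oplus> proj (Dl q v)" if "q \<in> carrier P" for q
    using p v that restr_closed[OF p] restr_closed[OF that]
    by (simp only: proj_Dl P_closed restr_linear isotropy_act_simps)
  show "proj (Dl p (v \<oplus> w)) = proj (Dl p v) \<oplus> proj (Dl p w)" if "w \<in> carrier V" for w
    using p v cl[OF p] that by (simp only: proj_Dl act_add_right add.m_closed)
  show "proj (Dl (bilinear_mul G p a) v) = proj (Dl p (act V a v))"
    if a: "a \<in> carrier (isotropy_algebra G x)" for a
  proof -
    have a': "a \<in> carrier (free_module (isotropy G x))" using a by (simp only: isotropy_algebra_simps)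
    have "proj (Dl (bilinear_mul G p a) v) = act V (bilinear_mul G (restr p) a) v"
      using proj_Dl[OF bilinear_mul_P[OF p a] v] restr_bilinear_mul[OF p a'] by simp
    also have "\<dots> = act V (restr p) (act V a v)"
      using act_mult[OF cl[OF p] a v] by (simp only: isotropy_algebra_simps)
    also have "\<dots> = proj (Dl p (act V a v))"
      using proj_Dl[OF p act_closed[OF a v]] by simp
    finally show ?thesis .
  qed
qed

text \<open>Connects the construction with the axioms. Injectivity at \<open>x\<close> is the one
  axiom that could fail through unexpected relations; it holds because \<open>proj\<close> vanishes
  on the kernel and returns \<open>v\<close>.\<close>

lemma induced_module_Ind: "induced_module G I x V (\<lambda>t v. tens (delta t) v)"
proof -
  interpret Q: kmodule T.Q by (rule T.kmodule_quotient)
  interpret IM: alg_mod "groupoid_algebra G" I by (rule alg_mod_Ind)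
  note dP = delta_in_free_module[where 'b = 'k, of _ "L_fibre G x"]
  show ?thesis
  proof (unfold_locales, unfold Ind_eqs(1-4))
    show "x \<in> units G" by (rule x_unit)
    fix t v assume t: "t \<in> L_fibre G x" and v: "v \<in> carrier V"
    show "tens (delta t) v \<in> carrier T.Q" by (rule tens_closed[OF dP[OF t] v])
    show "tens (delta t) (v \<oplus> w) = tens (delta t) v \<oplus>\<^bsub>T.Q\<^esub> tens (delta t) w" if "w \<in> carrier V" for w
      by (rule tens_simps(2)[OF dP[OF t] v that])
    show "tens (delta t) (c \<odot> v) = c \<odot>\<^bsub>T.Q\<^esub> tens (delta t) v" for c
      by (rule tens_simps(4)[OF dP[OF t] v])
    show "tens (delta (t \<cdot> g)) v = tens (delta t) (act V (delta g) v)" if "g \<in> isotropy G x" for g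
      using tens_simps(5)[OF dP[OF t] v delta_closed[OF that]] by (simp only: bilinear_mul_delta)
    show "act I (char_fun U) (tens (delta t) v) = tens (delta (u \<cdot> t)) v"
      if "compact_slice G U" "u \<in> U" "gdom G u = gran G t" for U u
      using Ind_act_tens[OF groupoid_algebra_closed(2)[OF that(1)] dP[OF t] v]
        L_act_char_fun[OF compact_slice_slice[OF that(1)] t that(2,3), where 'k = 'k] by (simp only:)
    show "act I (char_fun U) (tens (delta t) v) = \<zero>\<^bsub>T.Q\<^esub>"
      if "compact_slice G U" "gran G t \<notin> gdom G ` U" for U
      using Ind_act_tens[OF groupoid_algebra_closed(2)[OF that(1)] dP[OF t] v]
        L_act_char_fun_0[OF compact_slice_slice[OF that(1)] t that(2), where 'k = 'k] tens_zero[OF v]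
      by (simp only:)
  next
    let ?S = "{tens (delta t) v |t v. t \<in> L_fibre G x \<and> v \<in> carrier V}"
    have S: "?S \<subseteq> carrier I" using tens_closed[OF dP] by (auto simp: Ind_eqs(1))
    have lin: "linear_map T.Q I id" by (simp add: linear_map_def Ind_eqs)
    have "submodule (mspan I ?S) (scalars :: 'k ring) I" by (rule IM.mspan_submodule[OF S])
    then have "submodule {m \<in> carrier T.Q. id m \<in> mspan I ?S} (scalars :: 'k ring) T.Q"
      by (rule submodule_vimage[OF lin T.kmodule_quotient kmodule_Ind])
    then have "carrier T.Q \<subseteq> {m \<in> carrier T.Q. id m \<in> mspan I ?S}"
    proof (rule tens_delta_span[rotated])
      fix t v assume t: "t \<in> L_fibre G x" and v: "v \<in> carrier V"
      then have "tens (delta t) v \<in> ?S" by blast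
      then have "tens (delta t) v \<in> mspan I ?S" by (rule subsetD[OF IM.mspan_superset])
      then show "tens (delta t) v \<in> {m \<in> carrier T.Q. id m \<in> mspan I ?S}"
        using tens_closed[OF dP[OF t] v] by simp
    qed
    then show "mspan I ?S = carrier T.Q"
      using IM.mspan_subset_carrier[OF S] by (auto simp: Ind_eqs(1))
  next
    fix v assume v: "v \<in> carrier V" and zero: "tens (delta x) v = \<zero>\<^bsub>T.Q\<^esub>"
    have xL: "x \<in> L_fibre G x" using x_unit by (simp add: L_fibre_iff)
    have D: "Dl (delta x) v \<in> carrier F" by (rule Dl_closed[OF dP[OF xL] v])
    have "Dl (delta x) v \<ominus>\<^bsub>F\<^esub> \<zero>\<^bsub>F\<^esub> \<in> N"
      using zero T.coset_eq_iff[OF D T.M.zero_closed] by (simp only: T.quotient_zero)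
    then have "Dl (delta x) v \<in> N"
      using D by (simp only: T.minus_zero_right)
    then have "act V (restr (delta x)) v = \<zero>"
      using proj_kernel proj_Dl[OF dP[OF xL] v] by simp
    then show "v = \<zero>" using isotropy_act_unit[OF v] by (simp add: restr_delta)
  qed
qed

end

section \<open>The classification\<close>

text \<open>As the algebra may lack a unit, non-degeneracy is used to find an \<open>m\<close> with
  some non-zero product. The products with this \<open>m\<close> then form a non-zero
  submodule.\<close>

lemma (in groupoid_module) simple_cyclic:
  assumes "simple_module (groupoid_algebra G) M"
  obtains m where "m \<in> carrier M" "(\<lambda>a. act M a m) ` carrier (groupoid_algebra G) = carrier M"
proof -
  let ?A = "carrier (groupoid_algebra G) :: ('g \<Rightarrow> 'k) set"
  have "\<exists>a\<in>?A. \<exists>m\<in>carrier M. act M a m \<noteq> \<zero>"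
  proof (rule ccontr)
    assume "\<not> ?thesis"
    then have "{act M a m | a m. a \<in> ?A \<and> m \<in> carrier M} \<subseteq> {\<zero>}" by blast
    moreover have "submodule {\<zero>} (scalars :: 'k ring) M" by (rule submodule_scalarsI) auto
    ultimately have "mspan M {act M a m | a m. a \<in> ?A \<and> m \<in> carrier M} \<subseteq> {\<zero>}"
      by (intro mspan_minimal)
    then have "carrier M \<subseteq> {\<zero>}" unfolding nondegenerate .
    then have "carrier M = {\<zero>}" by blast
    then show False using assms by (simp add: simple_module_def)
  qed
  then obtain a m where am: "a \<in> ?A" "m \<in> carrier M" "act M a m \<noteq> \<zero>" by blast
  let ?N = "(\<lambda>a. act M a m) ` ?A"
  have "submodule ?N (scalars :: 'k ring) M"
  proof (rule submodule_scalarsI)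
    show "?N \<subseteq> carrier M" using am(2) act_closed by blast
    show "\<zero> \<in> ?N"
      by (rule image_eqI[of _ _ "\<lambda>s. 0"]) (simp_all only: act_simps am(2) groupoid_algebra_closed)
    fix n c assume "n \<in> ?N"
    then obtain b where b: "b \<in> ?A" "n = act M b m" by blast
    show "c \<odot> n \<in> ?N"
      by (rule image_eqI[of _ _ "\<lambda>s. c * b s"]) (simp_all only: b act_simps am(2) groupoid_algebra_closed)
    fix n' assume "n' \<in> ?N"
    then obtain b' where b': "b' \<in> ?A" "n' = act M b' m" by blast
    show "n \<oplus> n' \<in> ?N"
      by (rule image_eqI[of _ _ "\<lambda>s. b s + b' s"])
        (simp_all only: b b' act_simps am(2) groupoid_algebra_closed)
  qed
  moreover have "act M b n \<in> ?N" if b: "b \<in> ?A" and n: "n \<in> ?N" for b n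
  proof -
    obtain b' where b': "b' \<in> ?A" "n = act M b' m" using n by blast
    have "act M b n = act M (convolution G b b') m"
      using act_mult[OF b b'(1) am(2)] b'(2) by simp
    then show ?thesis using convolution_closed[OF b b'(1)] by blast
  qed
  ultimately have "alg_submodule (groupoid_algebra G) M ?N" unfolding alg_submodule_def by blast
  moreover have "?N \<noteq> {\<zero>}" using am by blast
  ultimately have "?N = carrier M" using assms unfolding simple_module_def by blast
  then show ?thesis using that[OF am(2)] by blast
qed

text \<open>Every element of a cyclic module is a product \<open>act M a m\<close>. Choosing such an
  \<open>a\<close> for each element injects the module into the functions on the groupoid, the first
  summand of the universe.\<close>

lemma (in groupoid_module) simple_copy:
  assumes "simple_module (groupoid_algebra G) M"
  obtains M' :: "('k, 'g \<Rightarrow> 'k, ('g, 'k, 'u) universe) alg_module"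
  where "alg_mod (groupoid_algebra G) M'" "alg_module_iso (groupoid_algebra G) M M'"
proof -
  obtain m where m: "m \<in> carrier M" "(\<lambda>a. act M a m) ` carrier (groupoid_algebra G) = carrier M"
    using simple_cyclic[OF assms] .
  define e :: "'m \<Rightarrow> ('g, 'k, 'u) universe" where
    "e n = Inl (SOME a. a \<in> carrier (groupoid_algebra G) \<and> act M a m = n)" for n
  have ex: "\<exists>a. a \<in> carrier (groupoid_algebra G) \<and> act M a m = n" if "n \<in> carrier M" for n
  proof -
    have "n \<in> (\<lambda>a. act M a m) ` carrier (groupoid_algebra G)" using that by (simp only: m(2))
    then show ?thesis by (elim imageE) blast
  qed
  have inj: "inj_on e (carrier M)"
  proof (rule inj_onI)
    fix n n' assume n: "n \<in> carrier M" "n' \<in> carrier M" and "e n = e n'"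
    then have "(SOME a. a \<in> carrier (groupoid_algebra G) \<and> act M a m = n) =
        (SOME a. a \<in> carrier (groupoid_algebra G) \<and> act M a m = n')" by (simp add: e_def)
    then show "n = n'" using someI_ex[OF ex[OF n(1)]] someI_ex[OF ex[OF n(2)]] by metis
  qed
  define i where "i = inv_into (carrier M) e"
  have i: "i (e n) = n" if "n \<in> carrier M" for n using inj that by (simp add: i_def)
  define M' :: "('k, 'g \<Rightarrow> 'k, ('g, 'k, 'u) universe) alg_module" where
    "M' = \<lparr>carrier = e ` carrier M, mult = undefined, one = undefined, zero = e \<zero>,
       add = (\<lambda>a b. e (i a \<oplus> i b)), smult = (\<lambda>c a. e (c \<odot> i a)), act = (\<lambda>f a. e (act M f (i a)))\<rparr>"
  have M': "carrier M' = e ` carrier M" "e \<zero> = \<zero>\<^bsub>M'\<^esub>"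
    "\<And>a b. \<lbrakk>a \<in> carrier M; b \<in> carrier M\<rbrakk> \<Longrightarrow> e a \<oplus>\<^bsub>M'\<^esub> e b = e (a \<oplus> b)"
    "\<And>c a. a \<in> carrier M \<Longrightarrow> c \<odot>\<^bsub>M'\<^esub> e a = e (c \<odot> a)"
    "\<And>f a. a \<in> carrier M \<Longrightarrow> act M' f (e a) = e (act M f a)"
    by (simp_all add: M'_def i)
  show ?thesis
    using that alg_mod_transport[OF alg_mod_axioms M'(1) inj M'(2-5)] by blast
qed

lemma Ind_is_induced:
  assumes "ample_groupoid G" "x \<in> units G" "alg_mod (isotropy_algebra G x) V"
  obtains \<tau> where "induced_module G (Ind G x V) x V \<tau>"
proof -
  interpret ample_groupoid G by fact
  interpret V: alg_mod "isotropy_algebra G x" V by fact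
  interpret isotropy_module G x V by unfold_locales fact
  show ?thesis using that induced_module_Ind by blast
qed

lemma induced_modules_iso:
  assumes "induced_module G M x V \<tau>" "induced_module G M' x V \<tau>'"
  shows "alg_module_iso (groupoid_algebra G) M M'"
proof -
  interpret I: induced_module G M x V \<tau> by fact
  interpret I': induced_module G M' x V \<tau>' by fact
  interpret induced_pair G M M' x V \<tau> \<tau>' by unfold_locales
  show ?thesis by (rule alg_module_iso)
qed

lemma iso_class_refl: "alg_mod A M \<Longrightarrow> M \<in> iso_class A M"
  by (simp add: iso_class_def alg_module_iso_refl)

text \<open>Every \<open>W\<close> in the class of \<open>V\<close> is linked to it by an
  isomorphism, so \<open>Ind G x W\<close> is induced from \<open>V\<close> as well and is
  isomorphic to \<open>M\<close>; the union is over a non-empty family of equal sets. Any model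
  \<open>M\<close> may be used, in particular a simple module with its own restriction.\<close>

lemma Ind_class_eq:
  fixes V :: "('k::{comm_ring,comm_monoid_mult}, 'g \<Rightarrow> 'k, 'v) alg_module"
    and M :: "('k, 'g \<Rightarrow> 'k, 'm) alg_module"
  assumes "induced_module G M x V \<tau>"
  shows "Ind_class G (x, iso_class (isotropy_algebra G x) V :: ('k, 'g \<Rightarrow> 'k, 'v) alg_module set) =
    (iso_class (groupoid_algebra G) M :: ('k, 'g \<Rightarrow> 'k, 'n) alg_module set)"
proof -
  interpret I: induced_module G M x V \<tau> by fact
  let ?C = "iso_class (isotropy_algebra G x) V :: ('k, 'g \<Rightarrow> 'k, 'v) alg_module set"
  have *: "iso_class (groupoid_algebra G) (Ind G x W) = (iso_class (groupoid_algebra G) M :: ('k, 'g \<Rightarrow> 'k, 'n) alg_module set)"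
    if "W \<in> ?C" for W
  proof -
    have W: "alg_mod (isotropy_algebra G x) W" and iso: "alg_module_iso (isotropy_algebra G x) V W"
      using that by (auto simp: iso_class_def)
    obtain \<tau>' where I': "induced_module G (Ind G x W) x W \<tau>'"
      using Ind_is_induced[OF I.ample_groupoid_axioms I.x_unit W] .
    obtain h where h: "bij_betw h (carrier V) (carrier W)" "linear_map V W h"
      "\<forall>a\<in>carrier (isotropy_algebra G x). \<forall>m\<in>carrier V. h (act V a m) = act W a (h m)"
      using iso by (rule alg_module_isoE)
    have "induced_module G (Ind G x W) x V (\<lambda>t v. \<tau>' t (h v))"
      by (rule induced_module_isotropy_transport[OF I' I.V.alg_mod_axioms h(1,2)]) (use h(3) in blast)
    then have "alg_module_iso (groupoid_algebra G) M (Ind G x W)"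
      by (rule induced_modules_iso[OF assms])
    then show ?thesis by (rule iso_class_eq[OF _ I.alg_mod_axioms, symmetric])
  qed
  have "V \<in> ?C" by (rule iso_class_refl[OF I.V.alg_mod_axioms])
  then have "(\<Union>W\<in>?C. iso_class (groupoid_algebra G) (Ind G x W)) =
      (iso_class (groupoid_algebra G) M :: ('k, 'g \<Rightarrow> 'k, 'n) alg_module set)"
    using * by blast
  then show ?thesis by (simp only: Ind_class_def case_prod_conv)
qed

text \<open>The elements of \<open>Ind G x V\<close> are sets of functions on pairs, a type other
  than the universe. The induced module is simple, hence cyclic, and so has a copy there.\<close>

lemma induced_module_copy:
  fixes V :: "('k::{comm_ring,comm_monoid_mult}, 'g \<Rightarrow> 'k, 'v) alg_module"
  assumes "ample_groupoid G" "x \<in> units G" "simple_module (isotropy_algebra G x) V"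
  obtains M :: "('k, 'g \<Rightarrow> 'k, ('g, 'k, 'u) universe) alg_module" and \<tau>
  where "induced_module G M x V \<tau>"
proof -
  have V: "alg_mod (isotropy_algebra G x) V" using assms(3) by (simp add: simple_module_def)
  obtain \<tau> where I: "induced_module G (Ind G x V) x V \<tau>"
    using Ind_is_induced[OF assms(1,2) V] .
  interpret I: induced_module G "Ind G x V" x V \<tau> by fact
  obtain M :: "('k, 'g \<Rightarrow> 'k, ('g, 'k, 'u) universe) alg_module"
    where M: "alg_mod (groupoid_algebra G) M" "alg_module_iso (groupoid_algebra G) (Ind G x V) M"
    using I.simple_copy[OF I.simple[OF assms(3)]] .
  from M(2) obtain h where h: "bij_betw h (carrier (Ind G x V)) (carrier M)" "linear_map (Ind G x V) M h"
      "\<forall>a\<in>carrier (groupoid_algebra G). \<forall>m\<in>carrier (Ind G x V). h (act (Ind G x V) a m) = act M a (h m)"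
    by (rule alg_module_isoE)
  have "induced_module G M x V (\<lambda>t v. h (\<tau> t v))"
    using h by (intro induced_module_transport[OF I M(1)]) simp_all
  then show ?thesis using that by blast
qed

text \<open>The unit at which the restriction is non-zero need not lie in \<open>D\<close>;
  translation along an arrow moves the non-vanishing to the representative of its orbit.\<close>

lemma spectral_simple_induced:
  assumes G: "ample_groupoid G" and D: "orbit_transversal G D"
    and M: "simple_module (groupoid_algebra G) M" "spectral G M"
  obtains x \<tau> where "x \<in> D" "induced_module G M x (res_module G x M) \<tau>"
    "simple_module (isotropy_algebra G x) (res_module G x M)"
proof -
  interpret ample_groupoid G by fact
  interpret M: alg_mod "groupoid_algebra G" M using M(1) by (simp add: simple_module_def)
  obtain y where y: "y \<in> units G" "Res G y M \<noteq> {\<zero>\<^bsub>M\<^esub>}" using M(2) by (auto simp: spectral_def)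
  obtain x where x: "x \<in> D" "x \<in> orbit G y" using D y(1) unfolding orbit_transversal_def by blast
  then obtain t where t: "t \<in> L_fibre G y" "x = gran G t" by (auto simp: orbit_def L_fibre_iff)
  have xu: "x \<in> units G" using D x(1) by (auto simp: orbit_transversal_def)
  interpret Y: groupoid_module_at G M y by unfold_locales (rule y)
  interpret X: groupoid_module_at G M x by unfold_locales (rule xu)
  have "Res G x M \<noteq> {\<zero>\<^bsub>M\<^esub>}" using Y.Res_nonzero_along_orbit[OF t(1) y(2)] t(2) by simp
  then show ?thesis using that[OF x(1)] X.induced_res_module[OF M(1)] by blast
qed

text \<open>A module induced from \<open>x'\<close> has a non-zero restriction there; being induced
  from \<open>x\<close> too, it forces \<open>x'\<close> into the orbit of \<open>x\<close>, where
  \<open>D\<close> has a single element.\<close>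

lemma induced_transversal_unique:
  assumes D: "orbit_transversal G D" "x \<in> D" "x' \<in> D"
    and "induced_module G M x V \<tau>" "induced_module G M x' V' \<tau>'"
    and V': "carrier V' \<noteq> {\<zero>\<^bsub>V'\<^esub>}"
  shows "x' = x"
proof -
  interpret I: induced_module G M x V \<tau> by fact
  interpret I': induced_module G M x' V' \<tau>' by fact
  obtain v where v: "v \<in> carrier V'" "v \<noteq> \<zero>\<^bsub>V'\<^esub>" using V' I'.V.zero_closed by blast
  then have "\<tau>' x' v \<in> Res G x' M" "\<tau>' x' v \<noteq> \<zero>\<^bsub>M\<^esub>" using I'.Res_eq I'.ind_nonzero by auto
  then have "x' \<in> orbit G x" by (intro I.Res_nonzero_orbit[OF I'.x_unit]) auto
  moreover have "x \<in> orbit G x"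
    using I.x_unit by (auto simp: orbit_def intro!: exI[of _ x])
  ultimately show ?thesis
    using D I.x_unit unfolding orbit_transversal_def by blast
qed

theorem theorem6p26:
  fixes G :: "'g top_groupoid" and D :: "'g set"
  assumes "ample_groupoid G" and "orbit_transversal G D"
  shows
    "(\<forall>x\<in>D. \<forall>V :: ('k::{comm_ring,comm_monoid_mult}, 'g \<Rightarrow> 'k, ('g, 'k, 'u) universe) alg_module.
        simple_module (isotropy_algebra G x) V \<longrightarrow>
        simple_module (groupoid_algebra G) (Ind G x V) \<and> spectral G (Ind G x V)) \<and>
     bij_betw
       (Ind_class G :: 'g \<times> ('k, 'g \<Rightarrow> 'k, ('g, 'k, 'u) universe) alg_module set \<Rightarrow>
                       ('k, 'g \<Rightarrow> 'k, ('g, 'k, 'u) universe) alg_module set)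
       (SIGMA x:D. iso_classes (isotropy_algebra G x) (simple_module (isotropy_algebra G x)))
       (iso_classes (groupoid_algebra G)
          (\<lambda>M. simple_module (groupoid_algebra G) M \<and> spectral G M)) \<and>
     (field (scalars :: 'k ring) \<longrightarrow>
      bij_betw
        (Ind_class G :: 'g \<times> ('k, 'g \<Rightarrow> 'k, ('g, 'k, 'u) universe) alg_module set \<Rightarrow>
                        ('k, 'g \<Rightarrow> 'k, ('g, 'k, 'u) universe) alg_module set)
        (SIGMA x:{x \<in> D. finite (orbit G x)}.
           iso_classes (isotropy_algebra G x)
             (\<lambda>V. simple_module (isotropy_algebra G x) V \<and> finite_dimensional V))
        (iso_classes (groupoid_algebra G)
           (\<lambda>M. simple_module (groupoid_algebra G) M \<and> finite_dimensional M)))"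
proof -
  let ?S = "\<lambda>x V. simple_module (isotropy_algebra G x) (V :: ('k, 'g \<Rightarrow> 'k, ('g, 'k, 'u) universe) alg_module)"
  let ?T = "\<lambda>M. simple_module (groupoid_algebra G) (M :: ('k, 'g \<Rightarrow> 'k, ('g, 'k, 'u) universe) alg_module)"
  let ?f = "Ind_class G :: 'g \<times> ('k, 'g \<Rightarrow> 'k, ('g, 'k, 'u) universe) alg_module set \<Rightarrow>
                        ('k, 'g \<Rightarrow> 'k, ('g, 'k, 'u) universe) alg_module set"
  let ?X = "SIGMA x:D. iso_classes (isotropy_algebra G x) (?S x)"
  let ?Y = "iso_classes (groupoid_algebra G) (\<lambda>M. ?T M \<and> spectral G M)"
  note G = assms(1)
  have Du: "x \<in> units G" if "x \<in> D" for x using assms(2) that by (auto simp: orbit_transversal_def)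
  have mem: "x \<in> D \<and> (\<exists>V. C = iso_class (isotropy_algebra G x) V \<and> ?S x V)" if "(x, C) \<in> ?X" for x C
    using that by (auto simp: iso_classes_def)
  \<comment> \<open>\<open>Ind\<close> itself is not on the type of the target classes, so its class
    is named by a copy \<open>M\<close> in the universe.\<close>
  have fwd: "\<exists>M \<tau>. induced_module G M x V \<tau> \<and> ?f (x, iso_class (isotropy_algebra G x) V) =
      iso_class (groupoid_algebra G) M \<and> alg_mod (groupoid_algebra G) M \<and> ?T M \<and> spectral G M"
    if xD: "x \<in> D" and xV: "?S x V" for x V
  proof -
    obtain M :: "('k, 'g \<Rightarrow> 'k, ('g, 'k, 'u) universe) alg_module" and \<tau>
      where I: "induced_module G M x V \<tau>"
      using induced_module_copy[OF G Du[OF xD] xV] .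
    interpret I: induced_module G M x V \<tau> by fact
    have "carrier V \<noteq> {\<zero>\<^bsub>V\<^esub>}" using xV by (simp add: simple_module_def)
    then show ?thesis
      using I Ind_class_eq[OF I] I.alg_mod_axioms I.simple[OF xV] I.spectral by blast
  qed
  have part1: "simple_module (groupoid_algebra G) (Ind G x V) \<and> spectral G (Ind G x V)"
    if xD: "x \<in> D" and xV: "?S x V" for x V
  proof -
    have V: "alg_mod (isotropy_algebra G x) V" "carrier V \<noteq> {\<zero>\<^bsub>V\<^esub>}"
      using xV by (auto simp: simple_module_def)
    obtain \<tau> where "induced_module G (Ind G x V) x V \<tau>"
      using Ind_is_induced[OF G Du[OF xD] V(1)] .
    then interpret I: induced_module G "Ind G x V" x V \<tau> .
    show ?thesis using I.simple[OF xV] I.spectral[OF V(2)] by blast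
  qed
  have bij: "bij_betw ?f ?X ?Y"
  proof (rule bij_betw_imageI)
    show "inj_on ?f ?X"
    proof (rule inj_onI)
      fix q q' assume q: "q \<in> ?X" "q' \<in> ?X" "?f q = ?f q'"
      obtain x C x' C' where xC: "q = (x, C)" "q' = (x', C')" by (cases q, cases q')
      have eq: "?f (x, C) = ?f (x', C')" using q(3) xC by simp
      obtain V V' where V: "x \<in> D" "C = iso_class (isotropy_algebra G x) V" "?S x V"
        and V': "x' \<in> D" "C' = iso_class (isotropy_algebra G x') V'" "?S x' V'"
        using mem[of x C] mem[of x' C'] q(1,2) unfolding xC by blast
      obtain M :: "('k, 'g \<Rightarrow> 'k, ('g, 'k, 'u) universe) alg_module" and \<tau>
        where M: "induced_module G M x V \<tau>" "?f (x, C) = iso_class (groupoid_algebra G) M"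
        "alg_mod (groupoid_algebra G) M" using fwd[OF V(1,3)] V(2) by blast
      obtain M' :: "('k, 'g \<Rightarrow> 'k, ('g, 'k, 'u) universe) alg_module" and \<tau>'
        where M': "induced_module G M' x' V' \<tau>'" "?f (x', C') = iso_class (groupoid_algebra G) M'"
        using fwd[OF V'(1,3)] V'(2) by blast
      have "alg_module_iso (groupoid_algebra G) M' M"
      proof -
        have "iso_class (groupoid_algebra G) M' =
            (iso_class (groupoid_algebra G) M :: ('k, 'g \<Rightarrow> 'k, ('g, 'k, 'u) universe) alg_module set)"
          using M(2) M'(2) eq by simp
        then have "M \<in> iso_class (groupoid_algebra G) M'"
          using iso_class_refl[OF M(3)] by simp
        then show ?thesis by (simp add: iso_class_def)
      qed
      then obtain h where h: "bij_betw h (carrier M') (carrier M)" "linear_map M' M h"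
        "\<forall>a\<in>carrier (groupoid_algebra G). \<forall>m\<in>carrier M'. h (act M' a m) = act M a (h m)"
        by (rule alg_module_isoE)
      \<comment> \<open>Carrying the second structure over to \<open>M\<close> makes one module
        induced in two ways, to which both uniqueness results apply.\<close>
      have I': "induced_module G M x' V' (\<lambda>t v. h (\<tau>' t v))"
        using h by (intro induced_module_transport[OF M'(1) M(3)]) simp_all
      have "x' = x"
        by (rule induced_transversal_unique[OF assms(2) V(1) V'(1) M(1) I'])
          (use V'(3) in \<open>simp add: simple_module_def\<close>)
      moreover from this have "alg_module_iso (isotropy_algebra G x) V V'"
        using induced_module_isotropy_iso[OF M(1)] I' by simp
      ultimately show "q = q'"
        using xC V V' iso_class_eq[of "isotropy_algebra G x" V V'] by (simp add: simple_module_def)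
    qed
    show "?f ` ?X = ?Y"
    proof
      show "?f ` ?X \<subseteq> ?Y"
      proof (rule image_subsetI)
        fix q assume q: "q \<in> ?X"
        obtain x C where xC: "q = (x, C)" by (cases q)
        then obtain V where V: "x \<in> D" "C = iso_class (isotropy_algebra G x) V" "?S x V"
          using mem[of x C] q by blast
        then show "?f q \<in> ?Y" using fwd[OF V(1,3)] xC unfolding iso_classes_def by blast
      qed
      show "?Y \<subseteq> ?f ` ?X"
      proof
        fix c assume "c \<in> ?Y"
        then obtain M where M: "c = iso_class (groupoid_algebra G) M" "?T M" "spectral G M"
          by (auto simp: iso_classes_def)
        obtain x \<tau> where x: "x \<in> D" "induced_module G M x (res_module G x M) \<tau>" "?S x (res_module G x M)"
          using spectral_simple_induced[OF G assms(2) M(2,3)] .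
        have "alg_mod (isotropy_algebra G x) (res_module G x M)" using x(3) by (simp add: simple_module_def)
        then have "(x, iso_class (isotropy_algebra G x) (res_module G x M)) \<in> ?X"
          using x unfolding iso_classes_def by blast
        then show "c \<in> ?f ` ?X"
          by (rule rev_image_eqI) (simp only: M(1) Ind_class_eq[OF x(2)])
      qed
    qed
  qed
  have fin: "bij_betw ?f
      (SIGMA x:{x \<in> D. finite (orbit G x)}.
         iso_classes (isotropy_algebra G x) (\<lambda>V. ?S x V \<and> finite_dimensional V))
      (iso_classes (groupoid_algebra G) (\<lambda>M. ?T M \<and> finite_dimensional M))" (is "bij_betw _ ?X' ?Y'")
    if fld: "field (scalars :: 'k ring)"
  \<comment> \<open>The second bijection is a restriction of the first; only the image has to be
    identified.\<close>
  proof (rule bij_betw_subset[OF bij])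
    have fd: "finite_dimensional M \<longleftrightarrow> finite (orbit G x) \<and> finite_dimensional V"
      if "induced_module G M x V \<tau>" "carrier V \<noteq> {\<zero>\<^bsub>V\<^esub>}"
      for M V :: "('k, 'g \<Rightarrow> 'k, ('g, 'k, 'u) universe) alg_module" and x \<tau>
    proof -
      interpret I: induced_module G M x V \<tau> by fact
      show ?thesis
        using I.finitely_generated_iff[OF fld that(2)] I.finite_dimensional_iff[OF fld]
          I.V.finite_dimensional_iff[OF fld] by simp
    qed
    show "?X' \<subseteq> ?X" by (auto simp: iso_classes_def)
    show "?f ` ?X' = ?Y'"
    proof
      show "?f ` ?X' \<subseteq> ?Y'"
      proof (rule image_subsetI)
        fix q assume q: "q \<in> ?X'"
        obtain x C where xC: "q = (x, C)" by (cases q)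
        then obtain V where V: "x \<in> D" "finite (orbit G x)" "C = iso_class (isotropy_algebra G x) V"
          "?S x V" "finite_dimensional V"
          using q by (auto simp: iso_classes_def)
        obtain M :: "('k, 'g \<Rightarrow> 'k, ('g, 'k, 'u) universe) alg_module" and \<tau>
        where M: "induced_module G M x V \<tau>" "?f q = iso_class (groupoid_algebra G) M"
          "alg_mod (groupoid_algebra G) M" "?T M" using fwd[OF V(1,4)] V(3) xC by blast
        have "carrier V \<noteq> {\<zero>\<^bsub>V\<^esub>}" using V(4) by (simp add: simple_module_def)
        then have "finite_dimensional M" using fd[OF M(1)] V(2,5) by blast
        then show "?f q \<in> ?Y'" using M(2-4) unfolding iso_classes_def by blast
      qed
      show "?Y' \<subseteq> ?f ` ?X'"
      proof
        fix c assume "c \<in> ?Y'"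
        then obtain M where M: "c = iso_class (groupoid_algebra G) M" "?T M" "finite_dimensional M"
          by (auto simp: iso_classes_def)
        interpret ample_groupoid G by fact
        interpret M: alg_mod "groupoid_algebra G" M using M(2) by (simp add: simple_module_def)
        interpret M: groupoid_module G M by unfold_locales
        have "carrier M \<noteq> {\<zero>\<^bsub>M\<^esub>}" using M(2) by (simp add: simple_module_def)
        \<comment> \<open>Spectrality is not part of the description of the target here; over a
          field it follows from finite dimension.\<close>
        then have sp: "spectral G M"
          using M.spectral_if_finitely_generated[OF fld] M.finite_dimensional_iff[OF fld] M(3) by blast
        obtain x \<tau> where x: "x \<in> D" "induced_module G M x (res_module G x M) \<tau>" "?S x (res_module G x M)"
          using spectral_simple_induced[OF G assms(2) M(2) sp] .
        have R: "alg_mod (isotropy_algebra G x) (res_module G x M)"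
          "carrier (res_module G x M) \<noteq> {\<zero>\<^bsub>res_module G x M\<^esub>}"
          using x(3) unfolding simple_module_def by blast+
        then have "(x, iso_class (isotropy_algebra G x) (res_module G x M)) \<in> ?X'"
          using x fd[OF x(2) R(2)] M(3) unfolding iso_classes_def by blast
        then show "c \<in> ?f ` ?X'"
          by (rule rev_image_eqI) (simp only: M(1) Ind_class_eq[OF x(2)])
      qed
    qed
  qed
  show ?thesis using part1 bij fin by blast
qed

end
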